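(* Let $l>0$, $\Omega=(0,\pi)\times(-l,l)$, $\sigma\in(0,1)$, and let $\Omega_O\subset\overline\Omega$ be nonempty, closed, symmetric with respect to the $x$-axis, with $L_-\cup L_+\subseteq\Omega_O$, where $L_\pm:=[0,\pi]\times\{\pm l\}$. Fix $\alpha\in(0,1)$ and $\kappa\ge\gamma>0$, and let $\Psi^e_+$, $\mathcal{F}_{odd}$, $\mathcal{G}^\infty_\psi$, $\mathcal{G}^\infty$ be as defined below. Let $(\bar f,\bar\psi)\in\mathcal{F}_{odd}\times\Psi^e_+$ be an optimal pair, i.e. $\mathcal{G}^\infty_{\bar f,\bar\psi}=\mathcal{G}^\infty_{\bar\psi}=\mathcal{G}^\infty$, and let $\bar u:=u_{\bar f,\bar\psi}$. Then: (i) $\mathcal{G}^\infty<2\gamma$ if and only if $\max_{x\in[0,\pi]}|\bar u(x,l)|<\gamma$; (ii) $\mathcal{G}^\infty=2\gamma$ if and only if $|\bar u(x_0,l)|=\gamma$ for some $x_0\in(0,\pi)$. In particular, if case (ii) occurs, then $\mathcal{G}^\infty=\mathcal{G}^\infty_{\psi_\gamma}$ for every $\psi_\gamma\in\Psi^e_+$ with $\psi_\gamma\equiv\gamma$ on $L_+$.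
   Context: $H^2_*(\Omega):=\{v\in H^2(\Omega): v=0\text{ on }\{0,\pi\}\times(-l,l)\}$ with scalar product $(u,v)_{H^2_*(\Omega)}:=\int_\Omega\big(\Delta u\Delta v+(1-\sigma)(2u_{xy}v_{xy}-u_{xx}v_{yy}-u_{yy}v_{xx})\big)$; elements identified with continuous functions on $\overline\Omega$. $(C^0(\overline\Omega))'$: dual of $C^0(\overline\Omega)$ with dual norm and pairing $\langle f,u\rangle$. A function $u$ on $\overline\Omega$ is even (odd) in $y$ if $u(x,-y)=u(x,y)$ ($=-u(x,y)$). $\mathcal{F}_{odd}:=\{f\in(C^0(\overline\Omega))':\|f\|\le1,\ \langle f,u\rangle=0\text{ for all }u\in C^0(\overline\Omega)\text{ even in }y\}$. $\|v\|_{C^{0,\alpha}(\Omega_O)}:=\|v\|_{L^\infty(\Omega_O)}+\sup_{x\neq y}|v(x)-v(y)|/|x-y|^\alpha$. $\Psi^e_+:=\{\psi\in C^{0,\alpha}(\Omega_O):\psi\ge\gamma\text{ on }\Omega_O,\ \|\psi\|_{C^{0,\alpha}(\Omega_O)}\le\kappa,\ \psi(x,-y)=\psi(x,y)\}$. For $\psi\in\Psi^e_+$, $H^2_{*,\psi}(\Omega):=\{v\in H^2_*(\Omega):-\psi\le v\le\psi\text{ on }\Omega_O\}$ and $u_{f,\psi}$ is the unique $u\in H^2_{*,\psi}(\Omega)$ with $(u,\varphi-u)_{H^2_*(\Omega)}\ge\langle f,\varphi-u\rangle$ for all $\varphi\in H^2_{*,\psi}(\Omega)$. $\mathcal{G}^\infty_{f,\psi}:=\max_{x\in[0,\pi]}|u_{f,\psi}(x,l)-u_{f,\psi}(x,-l)|$,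 $\mathcal{G}^\infty_\psi:=\sup_{f\in\mathcal{F}_{odd}}\mathcal{G}^\infty_{f,\psi}$, and $\mathcal{G}^\infty:=\inf_{\psi\in\Psi^e_+}\mathcal{G}^\infty_\psi$. *)

theory Defs
  imports "HOL-Analysis.Analysis"
begin

definition Omega :: "real \<Rightarrow> (real \<times> real) set" where
  "Omega l = {0<..<pi} \<times> {-l<..<l}"

definition Omegabar :: "real \<Rightarrow> (real \<times> real) set" where
  "Omegabar l = {0..pi} \<times> {-l..l}"

definition pdx :: "(real \<times> real \<Rightarrow> real) \<Rightarrow> real \<times> real \<Rightarrow> real" where
  "pdx f = (\<lambda>p. deriv (\<lambda>t. f (t, snd p)) (fst p))"

definition pdy :: "(real \<times> real \<Rightarrow> real) \<Rightarrow> real \<times> real \<Rightarrow> real" where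
  "pdy f = (\<lambda>p. deriv (\<lambda>t. f (fst p, t)) (snd p))"

fun Dw :: "bool list \<Rightarrow> (real \<times> real \<Rightarrow> real) \<Rightarrow> real \<times> real \<Rightarrow> real" where
  "Dw [] f = f"
| "Dw (b # bs) f = (if b then pdx else pdy) (Dw bs f)"

definition smooth2 :: "(real \<times> real \<Rightarrow> real) \<Rightarrow> bool" where
  "smooth2 f \<longleftrightarrow> (\<forall>bs. Dw bs f differentiable_on UNIV)"

definition test_fun :: "(real \<times> real) set \<Rightarrow> (real \<times> real \<Rightarrow> real) \<Rightarrow> bool" where
  "test_fun U \<phi> \<longleftrightarrow> smooth2 \<phi> \<and> (\<exists>K. compact K \<and> K \<subseteq> U \<and> (\<forall>p. p \<notin> K \<longrightarrow> \<phi> p = 0))"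

definition L2 :: "(real \<times> real) set \<Rightarrow> (real \<times> real \<Rightarrow> real) \<Rightarrow> bool" where
  "L2 U g \<longleftrightarrow> g \<in> borel_measurable (lebesgue_on U) \<and> integrable (lebesgue_on U) (\<lambda>p. (g p)\<^sup>2)"

definition weak_deriv :: "(real \<times> real) set \<Rightarrow> bool list \<Rightarrow> (real \<times> real \<Rightarrow> real) \<Rightarrow> (real \<times> real \<Rightarrow> real) \<Rightarrow> bool" where
  "weak_deriv U ws u g \<longleftrightarrow> L2 U g \<and>
     (\<forall>\<phi>. test_fun U \<phi> \<longrightarrow>
        integral\<^sup>L (lebesgue_on U) (\<lambda>p. u p * Dw ws \<phi> p)
        = (-1) ^ length ws * integral\<^sup>L (lebesgue_on U) (\<lambda>p. g p * \<phi> p))"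

definition H2 :: "(real \<times> real) set \<Rightarrow> (real \<times> real \<Rightarrow> real) \<Rightarrow> bool" where
  "H2 U u \<longleftrightarrow> L2 U u \<and> (\<forall>ws. length ws \<in> {1, 2} \<longrightarrow> (\<exists>g. weak_deriv U ws u g))"

definition wd :: "(real \<times> real) set \<Rightarrow> bool list \<Rightarrow> (real \<times> real \<Rightarrow> real) \<Rightarrow> real \<times> real \<Rightarrow> real" where
  "wd U ws u = (SOME g. weak_deriv U ws u g)"

text \<open>Elements of H^2_*, identified with their continuous representatives on the closure.\<close>
definition H2star :: "real \<Rightarrow> (real \<times> real \<Rightarrow> real) \<Rightarrow> bool" where
  "H2star l v \<longleftrightarrow> H2 (Omega l) v \<and> continuous_on (Omegabar l) v \<and>
     (\<forall>x y. x \<in> {0, pi} \<and> y \<in> {-l<..<l} \<longrightarrow> v (x, y) = 0)"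

definition inner_H2star :: "real \<Rightarrow> real \<Rightarrow> (real \<times> real \<Rightarrow> real) \<Rightarrow> (real \<times> real \<Rightarrow> real) \<Rightarrow> real" where
  "inner_H2star l \<sigma> u v =
    (let U = Omega l;
         uxx = wd U [True, True] u; uyy = wd U [False, False] u; uxy = wd U [True, False] u;
         vxx = wd U [True, True] v; vyy = wd U [False, False] v; vxy = wd U [True, False] v
     in integral\<^sup>L (lebesgue_on U)
          (\<lambda>p. (uxx p + uyy p) * (vxx p + vyy p)
               + (1 - \<sigma>) * (2 * uxy p * vxy p - uxx p * vyy p - uyy p * vxx p)))"

definition F_odd :: "real \<Rightarrow> ((real \<times> real \<Rightarrow> real) \<Rightarrow> real) set" where
  "F_odd l = {f.
     (\<forall>u v c. continuous_on (Omegabar l) u \<longrightarrow> continuous_on (Omegabar l) v \<longrightarrow>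
        f (\<lambda>p. u p + v p) = f u + f v \<and> f (\<lambda>p. c * u p) = c * f u) \<and>
     (\<forall>u. continuous_on (Omegabar l) u \<longrightarrow> \<bar>f u\<bar> \<le> Sup ((\<lambda>p. \<bar>u p\<bar>) ` Omegabar l)) \<and>
     (\<forall>u. continuous_on (Omegabar l) u \<longrightarrow>
        (\<forall>x y. (x, y) \<in> Omegabar l \<longrightarrow> u (x, -y) = u (x, y)) \<longrightarrow> f u = 0)}"

definition holder_sup :: "real \<Rightarrow> (real \<times> real) set \<Rightarrow> (real \<times> real \<Rightarrow> real) \<Rightarrow> real set" where
  "holder_sup \<alpha> S v = {\<bar>v p - v q\<bar> / dist p q powr \<alpha> | p q. p \<in> S \<and> q \<in> S \<and> p \<noteq> q}"

definition in_holder :: "real \<Rightarrow> (real \<times> real) set \<Rightarrow> (real \<times> real \<Rightarrow> real) \<Rightarrow> bool" where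
  "in_holder \<alpha> S v \<longleftrightarrow> bdd_above ((\<lambda>p. \<bar>v p\<bar>) ` S) \<and> bdd_above (holder_sup \<alpha> S v)"

definition holder_norm :: "real \<Rightarrow> (real \<times> real) set \<Rightarrow> (real \<times> real \<Rightarrow> real) \<Rightarrow> real" where
  "holder_norm \<alpha> S v = Sup ((\<lambda>p. \<bar>v p\<bar>) ` S) + Sup (holder_sup \<alpha> S v)"

definition Psi_e_plus :: "(real \<times> real) set \<Rightarrow> real \<Rightarrow> real \<Rightarrow> real \<Rightarrow> (real \<times> real \<Rightarrow> real) set" where
  "Psi_e_plus OmO \<alpha> \<gamma> \<kappa> = {\<psi>. in_holder \<alpha> OmO \<psi> \<and> holder_norm \<alpha> OmO \<psi> \<le> \<kappa> \<and>
      (\<forall>p \<in> OmO. \<psi> p \<ge> \<gamma>) \<and> (\<forall>x y. (x, y) \<in> OmO \<longrightarrow> \<psi> (x, -y) = \<psi> (x, y))}"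

definition K_psi :: "real \<Rightarrow> (real \<times> real) set \<Rightarrow> (real \<times> real \<Rightarrow> real) \<Rightarrow> (real \<times> real \<Rightarrow> real) set" where
  "K_psi l OmO \<psi> = {v. H2star l v \<and> (\<forall>p \<in> OmO. - \<psi> p \<le> v p \<and> v p \<le> \<psi> p)}"

text \<open>u solves the variational inequality, i.e. u is (a representative of) u_{f,psi}.\<close>
definition is_u :: "real \<Rightarrow> real \<Rightarrow> (real \<times> real) set \<Rightarrow> ((real \<times> real \<Rightarrow> real) \<Rightarrow> real)
    \<Rightarrow> (real \<times> real \<Rightarrow> real) \<Rightarrow> (real \<times> real \<Rightarrow> real) \<Rightarrow> bool" where
  "is_u l \<sigma> OmO f \<psi> u \<longleftrightarrow> u \<in> K_psi l OmO \<psi> \<and>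
     (\<forall>\<phi> \<in> K_psi l OmO \<psi>. inner_H2star l \<sigma> u (\<lambda>p. \<phi> p - u p) \<ge> f (\<lambda>p. \<phi> p - u p))"

definition gap :: "real \<Rightarrow> (real \<times> real \<Rightarrow> real) \<Rightarrow> real" where
  "gap l u = Sup ((\<lambda>x. \<bar>u (x, l) - u (x, -l)\<bar>) ` {0..pi})"

definition G_f_psi :: "real \<Rightarrow> real \<Rightarrow> (real \<times> real) set \<Rightarrow> ((real \<times> real \<Rightarrow> real) \<Rightarrow> real)
    \<Rightarrow> (real \<times> real \<Rightarrow> real) \<Rightarrow> real" where
  "G_f_psi l \<sigma> OmO f \<psi> = (THE g. \<exists>u. is_u l \<sigma> OmO f \<psi> u \<and> g = gap l u)"

definition G_psi :: "real \<Rightarrow> real \<Rightarrow> (real \<times> real) set \<Rightarrow> (real \<times> real \<Rightarrow> real) \<Rightarrow> real" where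
  "G_psi l \<sigma> OmO \<psi> = Sup ((\<lambda>f. G_f_psi l \<sigma> OmO f \<psi>) ` F_odd l)"

definition G_inf :: "real \<Rightarrow> real \<Rightarrow> (real \<times> real) set \<Rightarrow> real \<Rightarrow> real \<Rightarrow> real \<Rightarrow> real" where
  "G_inf l \<sigma> OmO \<alpha> \<gamma> \<kappa> = Inf ((\<lambda>\<psi>. G_psi l \<sigma> OmO \<psi>) ` Psi_e_plus OmO \<alpha> \<gamma> \<kappa>)"

end

theory Submission
  imports Defs "HOL-Computational_Algebra.Polynomial"
begin

text \<open>If \<open>f\<close> is odd and the obstacle is even in \<open>y\<close>, reflecting the solution of the variational
  inequality and changing its sign gives another solution, so by uniqueness solutions are odd and the gap
  equals \<open>2 max |u(x, l)|\<close>. The constant obstacle \<open>\<gamma>\<close> therefore shows that the optimal value is at most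
  \<open>2 \<gamma>\<close>, and the maximum cannot be attained at \<open>x \<in> {0, \<pi>}\<close>, where \<open>u\<close> vanishes.

  This needs existence of solutions for every obstacle and every \<open>f\<close>, since \<open>G_f_psi\<close> is a description operator.
  Existence follows by minimising the energy, once the energy is seen to control the sup norm and limits of
  bounded energy stay in the space. No mollification or general Sobolev embedding is used: on a
  rectangle the double increments of \<open>u\<close> are integrals of \<open>u_xy\<close> over subrectangles, and the weighted
  vertical mean of \<open>u\<close> solves a two-point boundary value problem whose right-hand side is the mean of \<open>u_xx\<close>.\<close>

section \<open>Smooth functions of one variable and bumps\<close>

text \<open>The functional acts on continuous functions, so everything hinges on bounding
  \<open>|u|\<close> by the energy, which sees only second derivatives. The boundary condition sits
  on the vertical sides; along the horizontal edges \<open>u\<close> is free, so nothing can be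
  integrated from there. A weight in \<open>y\<close> with compact support in \<open>(-l, l)\<close>
  avoids these edges: it is an admissible test factor, and \<open>u\<close> minus its weighted mean
  has an \<open>x\<close>-derivative given by \<open>u_xy\<close> alone.

  A second obstacle is that \<open>inner_H2star\<close> uses derivatives picked by Hilbert choice,
  so even bilinearity presupposes that weak derivatives are unique almost everywhere. This is the
  increment formula again, for \<open>u = 0\<close>: the difference of two candidates has integral
  zero over every quadrant. Products \<open>\<phi> x * \<theta> y\<close> suffice as test functions
  there, so the arguments are one-dimensional.

  Finally, \<open>H2\<close> asks for all derivatives of order one and two, while the energy bounds
  three of them. The limit of a minimising sequence stays in the space because the same
  representation formulas produce the others.\<close>

primrec diffn :: "nat \<Rightarrow> (real \<Rightarrow> real) \<Rightarrow> bool" where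
  "diffn 0 f = True"
| "diffn (Suc n) f = (\<exists>f'. (\<forall>x. (f has_real_derivative f' x) (at x)) \<and> diffn n f')"

text \<open>\<open>diffn\<close> asks for witnesses of the successive derivatives, so that the sum,
  product and chain rules hand over the next witness without any computation of
  \<open>deriv\<close>.\<close>

definition smooth1 :: "(real \<Rightarrow> real) \<Rightarrow> bool" where
  "smooth1 f \<longleftrightarrow> (\<forall>n. diffn n f)"

lemma diffn_Suc_imp: "diffn (Suc n) f \<Longrightarrow> diffn n f"
  by (induction n arbitrary: f) auto

lemma diffn_add: "diffn n f \<Longrightarrow> diffn n g \<Longrightarrow> diffn n (\<lambda>x. f x + g x)"
proof (induction n arbitrary: f g)
  case (Suc n)
  then obtain f' g' where "\<forall>x. (f has_real_derivative f' x) (at x)" "diffn n f'"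
    "\<forall>x. (g has_real_derivative g' x) (at x)" "diffn n g'" by auto
  with Suc.IH[of f' g'] show ?case
    by (auto intro!: exI[of _ "\<lambda>x. f' x + g' x"] derivative_intros)
qed auto

lemma diffn_mult: "diffn n f \<Longrightarrow> diffn n g \<Longrightarrow> diffn n (\<lambda>x. f x * g x)"
proof (induction n arbitrary: f g)
  case (Suc n)
  then obtain f' g' where d: "\<forall>x. (f has_real_derivative f' x) (at x)" "diffn n f'"
    "\<forall>x. (g has_real_derivative g' x) (at x)" "diffn n g'" by auto
  \<comment> \<open>The derivative of the product contains \<open>f\<close> and \<open>g\<close>
    undifferentiated, so their order has to be lowered to \<open>n\<close>.\<close>
  have "diffn n f" "diffn n g" using Suc.prems diffn_Suc_imp by blast+
  hence "diffn n (\<lambda>x. f' x * g x + g' x * f x)"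
    using d Suc.IH by (intro diffn_add) auto
  with d show ?case
    by (auto intro!: exI[of _ "\<lambda>x. f' x * g x + g' x * f x"] derivative_intros)
qed auto

lemma diffn_const: "diffn n (\<lambda>x. c)"
  by (induction n arbitrary: c) (auto intro!: exI[of _ "\<lambda>x. 0"])

lemma diffn_affine: "diffn n f \<Longrightarrow> diffn n (\<lambda>x. f (a * x + b))"
proof (induction n arbitrary: f)
  case (Suc n)
  then obtain f' where d: "\<forall>x. (f has_real_derivative f' x) (at x)" "diffn n f'" by auto
  have "diffn n (\<lambda>x. a * f' (a * x + b))"
    using Suc.IH d(2) diffn_const by (intro diffn_mult) auto
  moreover have "((\<lambda>x. f (a * x + b)) has_real_derivative a * f' (a * x + b)) (at x)" for x
  proof -
    have "((\<lambda>x. f (a * x + b)) has_real_derivative f' (a * x + b) * a) (at x)"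
      by (rule DERIV_chain2[of f]) (auto simp: d(1) intro!: derivative_eq_intros)
    thus ?thesis by (simp add: mult.commute)
  qed
  ultimately show ?case unfolding diffn.simps by (intro exI[of _ "\<lambda>x. a * f' (a * x + b)"]) auto
qed auto

lemma smooth1I:
  assumes "\<And>x. (f has_real_derivative f' x) (at x)" "smooth1 f'"
  shows "smooth1 f"
  unfolding smooth1_def
proof
  fix n show "diffn n f"
    using assms by (cases n) (auto simp: smooth1_def)
qed

lemma smooth1_DERIV: "smooth1 f \<Longrightarrow> (f has_real_derivative deriv f x) (at x)"
proof -
  assume "smooth1 f"
  hence "diffn (Suc 0) f" unfolding smooth1_def by blast
  then obtain f' where "(f has_real_derivative f' x) (at x)" by auto
  thus ?thesis using DERIV_imp_deriv by metis
qed

lemma smooth1_deriv: "smooth1 f \<Longrightarrow> smooth1 (deriv f)"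
  unfolding smooth1_def
proof
  fix n assume "\<forall>n. diffn n f"
  then obtain f' where "\<forall>x. (f has_real_derivative f' x) (at x)" "diffn n f'"
    using diffn.simps(2) by blast
  moreover have "deriv f = f'"
    using calculation(1) DERIV_imp_deriv by blast
  ultimately show "diffn n (deriv f)" by simp
qed

lemma smooth1_add: "smooth1 f \<Longrightarrow> smooth1 g \<Longrightarrow> smooth1 (\<lambda>x. f x + g x)"
  by (simp add: smooth1_def diffn_add)

lemma smooth1_mult: "smooth1 f \<Longrightarrow> smooth1 g \<Longrightarrow> smooth1 (\<lambda>x. f x * g x)"
  by (simp add: smooth1_def diffn_mult)

lemma smooth1_const: "smooth1 (\<lambda>x. c)"
  by (simp add: smooth1_def diffn_const)

lemma smooth1_affine: "smooth1 f \<Longrightarrow> smooth1 (\<lambda>x. f (a * x + b))"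
  by (simp add: smooth1_def diffn_affine)

lemma smooth1_continuous: "smooth1 f \<Longrightarrow> continuous_on S f"
  by (meson DERIV_continuous_on continuous_on_subset has_field_derivative_at_within smooth1_DERIV)

section \<open>Flat exponentials, smooth bumps and smooth steps\<close>

definition flat_exp :: "real poly \<Rightarrow> real \<Rightarrow> real" where
  "flat_exp p x = (if x > 0 then poly p (inverse x) * exp (- inverse x) else 0)"

lemma poly_exp_tendsto_0: "((\<lambda>x::real. poly p x * exp (- x)) \<longlongrightarrow> 0) at_top"
proof -
  have "((\<lambda>x::real. \<Sum>i\<le>degree p. coeff p i * (x ^ i / exp x)) \<longlongrightarrow> (\<Sum>i\<le>degree p. coeff p i * 0)) at_top"
    by (intro tendsto_intros tendsto_power_div_exp_0)
  moreover have "(\<Sum>i\<le>degree p. coeff p i * (x ^ i / exp x)) = poly p x * exp (- x)" for x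
    by (simp add: poly_altdef exp_minus divide_inverse sum_distrib_right mult.assoc)
  ultimately show ?thesis by simp
qed

text \<open>The functions p(1/x) exp(-1/x), extended by 0, form a family closed under
  differentiation: the chain rule replaces p by X^2 (p - p'), and at 0 the exponential beats every
  polynomial in 1/h. The member with p = 1 is the classical flat function.\<close>

lemma flat_exp_DERIV:
  "(flat_exp p has_real_derivative flat_exp ([:0, 0, 1:] * (p - pderiv p)) x) (at x)"
proof (cases "x = 0")
  case False
  let ?g = "\<lambda>x. poly p (inverse x) * exp (- inverse x)"
  show ?thesis
  proof (cases "x > 0")
    case True
    have "(?g has_real_derivative flat_exp ([:0, 0, 1:] * (p - pderiv p)) x) (at x)"
      using True by (auto simp: flat_exp_def algebra_simps power2_eq_square
          intro!: derivative_eq_intros)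
    moreover have "eventually (\<lambda>y. flat_exp p y = ?g y) (nhds x)"
      using eventually_nhds_in_open[of "{0<..}" x] True
      by (auto elim!: eventually_mono simp: flat_exp_def)
    ultimately show ?thesis by (simp add: DERIV_cong_ev)
  next
    case False
    with \<open>x \<noteq> 0\<close> have "x < 0" by simp
    have "((\<lambda>_. 0) has_real_derivative 0) (at x)" by simp
    moreover have "eventually (\<lambda>y. flat_exp p y = 0) (nhds x)"
      using eventually_nhds_in_open[of "{..<0}" x] \<open>x < 0\<close>
      by (auto elim!: eventually_mono simp: flat_exp_def)
    ultimately show ?thesis using \<open>x < 0\<close> by (simp add: DERIV_cong_ev flat_exp_def)
  qed
next
  case True
  have "((\<lambda>h. (flat_exp p (0 + h) - flat_exp p 0) / h) \<longlongrightarrow> 0) (at 0)"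
  proof (subst filterlim_at_split, safe)
    have "((\<lambda>h. 0) \<longlongrightarrow> (0::real)) (at_left 0)" by simp
    moreover have "eventually (\<lambda>h. (flat_exp p (0 + h) - flat_exp p 0) / h = 0) (at_left 0)"
      using eventually_at_left[of "-1" "0::real"] by (auto simp: flat_exp_def intro!: exI[of _ "-1"])
    ultimately show "((\<lambda>h. (flat_exp p (0 + h) - flat_exp p 0) / h) \<longlongrightarrow> 0) (at_left 0)"
      by (subst tendsto_cong) auto
  next
    \<comment> \<open>Dividing by \<open>h\<close> multiplies the polynomial in 1/h by its variable,
      which gives \<open>pCons 0 p\<close>.\<close>
    have "((\<lambda>h. poly (pCons 0 p) (inverse h) * exp (- inverse h)) \<longlongrightarrow> 0) (at_right (0::real))"
      using poly_exp_tendsto_0 filterlim_inverse_at_top_right by (rule filterlim_compose)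
    moreover have "eventually (\<lambda>h. (flat_exp p (0 + h) - flat_exp p 0) / h
        = poly (pCons 0 p) (inverse h) * exp (- inverse h)) (at_right 0)"
      using eventually_at_right_less[of "0::real"]
      by (auto elim!: eventually_mono simp: flat_exp_def divide_inverse)
    ultimately show "((\<lambda>h. (flat_exp p (0 + h) - flat_exp p 0) / h) \<longlongrightarrow> 0) (at_right 0)"
      by (subst tendsto_cong) auto
  qed
  thus ?thesis using True by (simp add: DERIV_def flat_exp_def)
qed

lemma smooth1_flat_exp: "smooth1 (flat_exp p)"
proof -
  have "diffn n (flat_exp p)" for n p
  proof (induction n arbitrary: p)
    case (Suc n)
    show ?case unfolding diffn.simps using flat_exp_DERIV Suc by blast
  qed auto
  thus ?thesis by (simp add: smooth1_def)
qed

lemma bump_exists: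
  assumes "a < b"
  obtains \<eta> where "smooth1 \<eta>" "\<And>x. \<eta> x \<ge> 0" "\<And>x. x \<notin> {a..b} \<Longrightarrow> \<eta> x = 0"
    "integrable lborel \<eta>" "integral\<^sup>L lborel \<eta> = 1"
proof -
  define e where "e = flat_exp 1"
  \<comment> \<open>One factor is flat at \<open>a\<close> and the other at \<open>b\<close>, so the
    product is positive exactly on the open interval.\<close>
  define f where "f = (\<lambda>x. e (1 * x + (-a)) * e ((-1) * x + b))"
  have sm: "smooth1 f" unfolding f_def e_def
    by (intro smooth1_mult smooth1_affine smooth1_flat_exp)
  have cont: "continuous_on A f" for A using smooth1_continuous[OF sm] .
  have nn: "f x \<ge> 0" for x by (auto simp: f_def e_def flat_exp_def)
  have z: "f x = 0" if "x \<notin> {a..b}" for x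
    using that by (auto simp: f_def e_def flat_exp_def)
  have pos: "f x > 0" if "a < x" "x < b" for x
    using that by (auto simp: f_def e_def flat_exp_def)
  have int: "integrable lborel f"
  proof -
    have "set_integrable lborel {a..b} f"
      using cont by (intro borel_integrable_atLeastAtMost') 
    moreover have "indicator {a..b} x *\<^sub>R f x = f x" for x using z by (auto simp: indicator_def)
    ultimately show ?thesis by (simp only: set_integrable_def)
  qed
  define I where "I = integral\<^sup>L lborel f"
  have "I \<noteq> 0"
  proof
    assume "I = 0"
    hence "AE x in lborel. f x = 0"
      using integral_nonneg_eq_0_iff_AE[OF int] nn by (auto simp: I_def)
    hence "AE x in lborel. x \<notin> {a<..<b}" using pos by (auto elim!: eventually_mono) (metis less_irrefl)
    hence "emeasure lborel {a<..<b} = 0" by (subst (asm) AE_iff_measurable[OF _ refl]) (auto simp: greaterThanLessThan_def lessThan_def greaterThan_def Collect_conj_eq)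
    thus False using assms by simp
  qed
  moreover have "I \<ge> 0" using nn by (simp add: I_def)
  ultimately have "I > 0" by simp
  show thesis
  proof
    show "smooth1 (\<lambda>x. inverse I * f x)" by (intro smooth1_mult smooth1_const sm)
    show "0 \<le> inverse I * f x" for x using nn \<open>I > 0\<close> by simp
    show "x \<notin> {a..b} \<Longrightarrow> inverse I * f x = 0" for x using z by simp
    show "integrable lborel (\<lambda>x. inverse I * f x)" using int by simp
    show "(LBINT x. inverse I * f x) = 1" using \<open>I > 0\<close> by (simp add: I_def)
  qed
qed

text \<open>Normalised at \<open>a\<close>, the antiderivative is constant on either side of the
  support by the mean value theorem: 0 on the left and the total mass on the right.\<close>

lemma smooth1_primitive:
  assumes sm: "smooth1 \<eta>" and z: "\<And>x. x \<notin> {a..b} \<Longrightarrow> \<eta> x = 0" and "a \<le> b"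
  obtains H where "smooth1 H" "\<And>x. (H has_real_derivative \<eta> x) (at x)" "\<And>x. x \<le> a \<Longrightarrow> H x = 0"
    "\<And>x. x \<ge> b \<Longrightarrow> H x = integral\<^sup>L lborel \<eta>"
proof -
  have cont: "continuous_on A \<eta>" for A using smooth1_continuous[OF sm] .
  have "\<exists>F. \<forall>x. (F has_vector_derivative \<eta> x) (at x)"
    using einterval_antiderivative[of "-\<infinity>" "\<infinity>" \<eta>] cont[of UNIV]
    by (auto simp: continuous_on_eq_continuous_at)
  then obtain F where F: "\<And>x. (F has_real_derivative \<eta> x) (at x)"
    by (auto simp: has_real_derivative_iff_has_vector_derivative)
  define H where "H = (\<lambda>x. F x - F a)"
  have H: "(H has_real_derivative \<eta> x) (at x)" for x
    unfolding H_def using F by (auto intro!: derivative_eq_intros)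
  have eqc: "H x = H y" if "x < y" "\<And>t. x < t \<Longrightarrow> t < y \<Longrightarrow> \<eta> t = 0" for x y
  proof -
    have "\<exists>t>x. t < y \<and> H y - H x = (y - x) * \<eta> t"
      by (rule MVT2[OF that(1)]) (rule H)
    then obtain t where "x < t" "t < y" "H y - H x = (y - x) * \<eta> t" by blast
    with that show ?thesis by simp
  qed
  have H0: "H a = 0" by (simp add: H_def)
  have "integral\<^sup>L lborel \<eta> = H b"
  proof -
    have "(LBINT x. \<eta> x * indicator {a..b} x) = H b - H a"
      using \<open>a \<le> b\<close> H cont[of UNIV]
      by (intro integral_FTC_Icc_real) (simp_all add: continuous_on_eq_continuous_at)
    moreover have "\<eta> x * indicator {a..b} x = \<eta> x" for x using z by (auto simp: indicator_def)
    ultimately show ?thesis by (simp add: H0)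
  qed
  show thesis
  proof
    show "smooth1 H" using smooth1I[OF H sm] .
    show "(H has_real_derivative \<eta> x) (at x)" for x using H .
    show "x \<le> a \<Longrightarrow> H x = 0" for x using eqc[of x a] z H0 by (cases "x = a") auto
    show "x \<ge> b \<Longrightarrow> H x = integral\<^sup>L lborel \<eta>" for x
      using eqc[of b x] z \<open>integral\<^sup>L lborel \<eta> = H b\<close> by (cases "x = b") auto
  qed
qed


text \<open>The primitive of a unit bump is a smooth Heaviside function. Differences of two such
  steps will approximate indicators of intervals.\<close>

lemma smooth_step_exists:
  assumes "a < b"
  obtains H \<eta> where "smooth1 H" "smooth1 \<eta>" "\<And>x. (H has_real_derivative \<eta> x) (at x)"
    "\<And>x. \<eta> x \<ge> 0" "\<And>x. x \<notin> {a..b} \<Longrightarrow> \<eta> x = 0" "integral\<^sup>L lborel \<eta> = 1"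
    "\<And>x. x \<le> a \<Longrightarrow> H x = 0" "\<And>x. x \<ge> b \<Longrightarrow> H x = 1" "\<And>x. 0 \<le> H x" "\<And>x. H x \<le> 1"
proof -
  obtain \<eta> where e: "smooth1 \<eta>" "\<And>x. \<eta> x \<ge> 0" "\<And>x. x \<notin> {a..b} \<Longrightarrow> \<eta> x = 0"
    "integrable lborel \<eta>" "integral\<^sup>L lborel \<eta> = 1"
    using bump_exists[OF assms] by blast
  obtain H where H: "smooth1 H" "\<And>x. (H has_real_derivative \<eta> x) (at x)" "\<And>x. x \<le> a \<Longrightarrow> H x = 0"
    "\<And>x. x \<ge> b \<Longrightarrow> H x = integral\<^sup>L lborel \<eta>"
    using smooth1_primitive[OF e(1,3)] assms by (metis less_imp_le)
  have mono: "H x \<le> H y" if "x \<le> y" for x y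
    using that H(2) e(2) by (meson DERIV_nonneg_imp_nondecreasing)
  have "0 \<le> H x" for x using mono[of "min x a" x] H(3)[of "min x a"] by simp
  moreover have "H x \<le> 1" for x using mono[of x "max x b"] H(4)[of "max x b"] e(5) by simp
  ultimately show thesis using that[OF H(1) e(1) H(2) e(2,3,5) H(3)] H(4) e(5) by simp
qed

section \<open>Weak derivatives on an interval\<close>

definition test1 :: "real \<Rightarrow> real \<Rightarrow> (real \<Rightarrow> real) \<Rightarrow> bool" where
  "test1 a b \<phi> \<longleftrightarrow> smooth1 \<phi> \<and> (\<exists>c d. a < c \<and> c \<le> d \<and> d < b \<and> (\<forall>x. x \<notin> {c..d} \<longrightarrow> \<phi> x = 0))"

text \<open>Integration starts at minus infinity. For integrands that vanish left of an endpoint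
  this is the primitive from that endpoint, and it is defined for every \<open>x\<close> without
  orientation of the interval.\<close>

definition prim :: "(real \<Rightarrow> real) \<Rightarrow> real \<Rightarrow> real" where
  "prim h x = (LBINT s. indicator {..x} s * h s)"

lemma test1_outside: "test1 a b \<phi> \<Longrightarrow> x \<notin> {a<..<b} \<Longrightarrow> \<phi> x = 0"
  by (force simp: test1_def)

lemma deriv_zero_outside:
  fixes \<phi> :: "real \<Rightarrow> real"
  assumes "\<And>x. x \<notin> K \<Longrightarrow> \<phi> x = 0" "closed K" "x \<notin> K"
  shows "(\<phi> has_real_derivative 0) (at x)"
proof -
  have "eventually (\<lambda>y. \<phi> y = 0) (nhds x)"
    using eventually_nhds_in_open[of "- K" x] assms(2,3)
    by (rule_tac eventually_mono[of "\<lambda>y. y \<in> - K"]) (use assms(1) in auto)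
  thus ?thesis using DERIV_cong_ev[of x x \<phi> "\<lambda>_. 0" 0 0] by simp
qed

lemma test1_deriv: "test1 a b \<phi> \<Longrightarrow> test1 a b (deriv \<phi>)"
  unfolding test1_def
proof safe
  fix c d assume *: "smooth1 \<phi>" "a < c" "c \<le> d" "d < b" "\<forall>x. x \<notin> {c..d} \<longrightarrow> \<phi> x = 0"
  show "smooth1 (deriv \<phi>)" using *(1) by (rule smooth1_deriv)
  have "deriv \<phi> x = 0" if "x \<notin> {c..d}" for x
    using deriv_zero_outside[of "{c..d}" \<phi> x] * that by (simp add: DERIV_imp_deriv)
  with * show "\<exists>c d. a < c \<and> c \<le> d \<and> d < b \<and> (\<forall>x. x \<notin> {c..d} \<longrightarrow> deriv \<phi> x = 0)" by blast
qed

lemma test1_diff_mult: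
  assumes "test1 a b \<phi>" "test1 a b \<theta>"
  shows "test1 a b (\<lambda>x. \<phi> x - k * \<theta> x)"
proof -
  obtain c d where 1: "a < c" "c \<le> d" "d < b" "\<forall>x. x \<notin> {c..d} \<longrightarrow> \<phi> x = 0"
    using assms(1) by (auto simp: test1_def)
  obtain c' d' where 2: "a < c'" "c' \<le> d'" "d' < b" "\<forall>x. x \<notin> {c'..d'} \<longrightarrow> \<theta> x = 0"
    using assms(2) by (auto simp: test1_def)
  have "smooth1 (\<lambda>x. \<phi> x + (-k) * \<theta> x)"
    using assms by (intro smooth1_add smooth1_mult smooth1_const) (auto simp: test1_def)
  moreover have "\<forall>x. x \<notin> {min c c'..max d d'} \<longrightarrow> \<phi> x - k * \<theta> x = 0"
    using 1(4) 2(4) by (metis (no_types, opaque_lifting) atLeastAtMost_iff diff_zero max.bounded_iff max.coboundedI1 max.coboundedI2 min.coboundedI1 min.coboundedI2 mult_zero_right)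
  moreover have "a < min c c'" "min c c' \<le> max d d'" "max d d' < b" using 1 2 by auto
  ultimately show ?thesis unfolding test1_def
    by (intro conjI exI[of _ "min c c'"] exI[of _ "max d d'"]) auto
qed

lemma test1_continuous: "test1 a b \<phi> \<Longrightarrow> continuous_on S \<phi>"
  by (auto simp: test1_def intro: smooth1_continuous)

lemma test1_borel: "test1 a b \<phi> \<Longrightarrow> \<phi> \<in> borel_measurable borel"
  using test1_continuous by (intro borel_measurable_continuous_onI)

lemma test1_bounded:
  assumes "test1 a b \<phi>" obtains B where "\<And>x. \<bar>\<phi> x\<bar> \<le> B"
proof -
  have "compact (\<phi> ` {a..b})" using assms test1_continuous by (intro compact_continuous_image) auto
  hence "bounded (\<phi> ` {a..b})" by (rule compact_imp_bounded)
  then obtain B where B: "\<And>x. x \<in> {a..b} \<Longrightarrow> \<bar>\<phi> x\<bar> \<le> B"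
    unfolding bounded_iff by fastforce
  have "\<bar>\<phi> x\<bar> \<le> max B 0" for x
    using B[of x] test1_outside[OF assms, of x] by (cases "x \<in> {a..b}") auto
  thus thesis by (rule that)
qed

lemma integrable_mult_bounded:
  fixes f g :: "'a \<Rightarrow> real"
  assumes "integrable M f" "g \<in> borel_measurable M" "\<And>x. x \<in> space M \<Longrightarrow> \<bar>g x\<bar> \<le> B"
  shows "integrable M (\<lambda>x. f x * g x)" "integrable M (\<lambda>x. g x * f x)"
proof -
  show *: "integrable M (\<lambda>x. f x * g x)"
  proof (rule Bochner_Integration.integrable_bound)
    show "integrable M (\<lambda>x. B * f x)" using assms by simp
    have "f \<in> borel_measurable M" using assms by auto
    thus "(\<lambda>x. f x * g x) \<in> borel_measurable M" using assms by measurable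
    have "norm (f x * g x) \<le> norm (B * f x)" if "x \<in> space M" for x
      using mult_right_mono[OF assms(3)[OF that], of "\<bar>f x\<bar>"] by (simp add: abs_mult mult.commute)
         (smt (verit) abs_ge_zero assms(3) mult_right_mono that)
    thus "AE x in M. norm (f x * g x) \<le> norm (B * f x)" by simp
  qed
  thus "integrable M (\<lambda>x. g x * f x)" by (simp add: mult.commute)
qed

lemma integrable_cont_compact:
  fixes c :: "real \<Rightarrow> real"
  assumes "continuous_on {a..b} c" "\<And>x. x \<notin> {a..b} \<Longrightarrow> c x = 0"
  shows "integrable lborel c"
proof -
  have "set_integrable lborel {a..b} c" using assms by (intro borel_integrable_atLeastAtMost')
  moreover have "indicator {a..b} x *\<^sub>R c x = c x" for x using assms(2)[of x] by (cases "x \<in> {a..b}") simp_all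
  ultimately show ?thesis by (simp only: set_integrable_def)
qed

lemma integrable_cont_test1:
  assumes "continuous_on {a..b} c" "test1 a b \<phi>"
  shows "integrable lborel (\<lambda>x. c x * \<phi> x)"
  using assms test1_continuous[OF assms(2)] test1_outside[OF assms(2)]
  by (intro integrable_cont_compact[of a b]) (auto intro!: continuous_intros)

lemma integrable_test1: "test1 a b \<phi> \<Longrightarrow> integrable lborel \<phi>"
  using integrable_cont_test1[of a b "\<lambda>_. 1" \<phi>] by simp

lemma integrable_L1_test1:
  assumes "integrable lborel h" "test1 a b \<phi>"
  shows "integrable lborel (\<lambda>x. h x * \<phi> x)"
proof -
  obtain B where "\<And>x. \<bar>\<phi> x\<bar> \<le> B" using test1_bounded[OF assms(2)] by blast
  thus ?thesis using assms test1_borel by (intro integrable_mult_bounded[where B=B]) auto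
qed

lemma bump_average:
  fixes c :: "real \<Rightarrow> real"
  assumes c: "continuous_on {p..q} c" and eta: "continuous_on {p..q} \<eta>" "\<And>x. \<eta> x \<ge> 0"
    "\<And>x. x \<notin> {p..q} \<Longrightarrow> \<eta> x = 0" "integral\<^sup>L lborel \<eta> = 1"
    and e: "\<And>x. x \<in> {p..q} \<Longrightarrow> \<bar>c x - k\<bar> \<le> e"
  shows "\<bar>(LBINT x. c x * \<eta> x) - k\<bar> \<le> e"
proof -
  have i: "integrable lborel (\<lambda>x. c x * \<eta> x)" "integrable lborel \<eta>"
    using c eta by (auto intro!: integrable_cont_compact[of p q] continuous_intros)
  have "(LBINT x. c x * \<eta> x) - k = (LBINT x. c x * \<eta> x - k * \<eta> x)"
    using i eta(4) by simp
  also have "\<bar>\<dots>\<bar> \<le> (LBINT x. \<bar>c x * \<eta> x - k * \<eta> x\<bar>)" by (rule integral_abs_bound)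
  also have "\<dots> \<le> (LBINT x. e * \<eta> x)"
  proof (rule integral_mono)
    fix x
    show "\<bar>c x * \<eta> x - k * \<eta> x\<bar> \<le> e * \<eta> x"
    proof (cases "x \<in> {p..q}")
      case True
      have "\<bar>c x * \<eta> x - k * \<eta> x\<bar> = \<bar>c x - k\<bar> * \<eta> x"
        using eta(2)[of x] by (simp add: abs_mult left_diff_distrib[symmetric])
      thus ?thesis using e[OF True] eta(2)[of x] by (simp add: mult_right_mono)
    qed (use eta(3) in auto)
  qed (use i in auto)
  also have "\<dots> = e" using eta(4) by simp
  finally show ?thesis .
qed

text \<open>Test with smooth trapezoids that tend to the indicator of \<open>{x1..x2}\<close>. Their
  derivatives are two unit bumps of opposite sign shrinking to \<open>x1\<close> and
  \<open>x2\<close>, so by continuity the left side tends to \<open>c x1 - c x2\<close>, while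
  dominated convergence handles the right side. Since \<open>c\<close> is continuous on the closed
  interval, the endpoints \<open>a\<close> and \<open>b\<close> are included.\<close>

lemma weak_derivative_imp_increment:
  assumes c: "continuous_on {a..b} c" and h: "integrable lborel h"
    and eq: "\<And>\<phi>. test1 a b \<phi> \<Longrightarrow> (LBINT x. c x * deriv \<phi> x) = - (LBINT x. h x * \<phi> x)"
    and x: "a \<le> x1" "x1 \<le> x2" "x2 \<le> b"
  shows "c x2 - c x1 = (LBINT x. indicator {x1..x2} x * h x)"
proof (cases "x1 = x2")
  case True
  have "(LBINT x. indicator {x1..x2} x * h x) = 0"
  proof (rule integral_eq_zero_AE)
    show "AE x in lborel. indicator {x1..x2} x * h x = 0"
      using AE_lborel_singleton[of x1] by eventually_elim (auto simp: True)
  qed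
  with True show ?thesis by simp
next
  case False
  with x have lt: "x1 < x2" by simp
  \<comment> \<open>The factor 8 keeps the rising ramp on
    \<open>{x1 + \<delta> n..x1 + 2 * \<delta> n}\<close> well to the left of the falling one on
    \<open>{x2 - 2 * \<delta> n..x2 - \<delta> n}\<close>.\<close>
  define \<delta> where "\<delta> n = (x2 - x1) / (8 * real (Suc n))" for n
  have \<delta>0: "\<delta> n > 0" for n using lt by (simp add: \<delta>_def)
  have \<delta>8: "8 * \<delta> n \<le> x2 - x1" for n
  proof -
    have "(x2 - x1) / real (Suc n) \<le> (x2 - x1) / 1"
      using lt by (intro divide_left_mono) auto
    moreover have "8 * \<delta> n = (x2 - x1) / real (Suc n)" by (simp only: \<delta>_def) (simp add: divide_simps algebra_simps)
    ultimately show ?thesis by simp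
  qed
  have \<delta>lim: "\<delta> \<longlonglongrightarrow> 0"
  proof -
    have "(\<lambda>n. (x2 - x1) / 8 * inverse (real (Suc n))) \<longlonglongrightarrow> (x2 - x1) / 8 * 0"
      by (intro tendsto_intros LIMSEQ_inverse_real_of_nat)
    thus ?thesis by (simp add: \<delta>_def[abs_def] field_simps)
  qed
  let ?P = "\<lambda>p q H \<eta>. smooth1 H \<and> smooth1 \<eta> \<and> (\<forall>x. (H has_real_derivative \<eta> x) (at x)) \<and> (\<forall>x. \<eta> x \<ge> 0) \<and>
     (\<forall>x. x \<notin> {p..q} \<longrightarrow> \<eta> x = 0) \<and> integral\<^sup>L lborel \<eta> = 1 \<and> (\<forall>x\<le>p. H x = 0) \<and> (\<forall>x\<ge>q. H x = 1) \<and>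
     (\<forall>x. 0 \<le> H x \<and> H x \<le> 1)"
  have ex: "\<exists>H \<eta>. ?P p q H \<eta>" if pq: "p < q" for p q :: real
    by (rule smooth_step_exists[OF pq]) blast
  have exs: "\<exists>H \<eta>. \<forall>n. ?P (p n) (q n) (H n) (\<eta> n)" if pq: "\<And>n. p n < q n" for p q :: "nat \<Rightarrow> real"
  proof -
    have "\<forall>n. \<exists>z. ?P (p n) (q n) (fst z) (snd z)"
    proof
      fix n
      obtain H \<eta> where "?P (p n) (q n) H \<eta>" using ex[OF pq] by blast
      thus "\<exists>z. ?P (p n) (q n) (fst z) (snd z)" by (intro exI[of _ "(H, \<eta>)"]) simp
    qed
    then obtain F where "\<forall>n. ?P (p n) (q n) (fst (F n)) (snd (F n))" by (rule choice[THEN exE])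
    thus ?thesis by (intro exI[of _ "\<lambda>n. fst (F n)"] exI[of _ "\<lambda>n. snd (F n)"])
  qed
  have "\<exists>H \<eta>. \<forall>n. ?P (x1 + \<delta> n) (x1 + 2 * \<delta> n) (H n) (\<eta> n)"
    by (rule exs) (use \<delta>0 in simp)
  then obtain H \<eta> where H: "\<And>n. ?P (x1 + \<delta> n) (x1 + 2 * \<delta> n) (H n) (\<eta> n)" by blast
  have "\<exists>K \<xi>. \<forall>n. ?P (x2 - 2 * \<delta> n) (x2 - \<delta> n) (K n) (\<xi> n)"
    by (rule exs) (use \<delta>0 in simp)
  then obtain K \<xi> where K: "\<And>n. ?P (x2 - 2 * \<delta> n) (x2 - \<delta> n) (K n) (\<xi> n)" by blast
  \<comment> \<open>The trapezoid: 1 between the two ramps and 0 outside a compact part of the open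
    interval from \<open>x1\<close> to \<open>x2\<close>.\<close>
  define \<phi> where "\<phi> n x = H n x - 1 * K n x" for n x
  have \<phi>z: "\<phi> n x = 0" if "x \<notin> {x1 + \<delta> n .. x2 - \<delta> n}" for n x
  proof -
    have "x \<le> x1 + \<delta> n \<or> x \<ge> x2 - \<delta> n" using that by auto
    thus ?thesis
    proof
      assume "x \<le> x1 + \<delta> n"
      moreover have "x \<le> x2 - 2 * \<delta> n" using calculation \<delta>8[of n] \<delta>0[of n] by argo
      ultimately show ?thesis using H[of n] K[of n] by (simp add: \<phi>_def)
    next
      assume "x \<ge> x2 - \<delta> n"
      moreover have "x \<ge> x1 + 2 * \<delta> n" using calculation \<delta>8[of n] \<delta>0[of n] by argo
      ultimately show ?thesis using H[of n] K[of n] by (simp add: \<phi>_def)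
    qed
  qed
  have sm: "smooth1 (\<phi> n)" for n
  proof -
    have "smooth1 (\<lambda>x. H n x + (-1) * K n x)"
      using H[of n] K[of n] by (intro smooth1_add smooth1_mult smooth1_const) auto
    thus ?thesis by (simp add: \<phi>_def[abs_def])
  qed
  have t: "test1 a b (\<phi> n)" for n
    unfolding test1_def
  proof (intro conjI exI allI impI)
    show "smooth1 (\<phi> n)" by (rule sm)
    show "a < x1 + \<delta> n" using x \<delta>0[of n] by simp
    show "x1 + \<delta> n \<le> x2 - \<delta> n" using \<delta>8[of n] \<delta>0[of n] by argo
    show "x2 - \<delta> n < b" using x \<delta>0[of n] by simp
  qed (use \<phi>z in auto)
  have d\<phi>: "deriv (\<phi> n) x = \<eta> n x - \<xi> n x" for n x
  proof -
    have "(H n has_real_derivative \<eta> n x) (at x)" "(K n has_real_derivative \<xi> n x) (at x)"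
      using H K by blast+
    hence "(\<phi> n has_real_derivative \<eta> n x - \<xi> n x) (at x)"
      unfolding \<phi>_def[abs_def] by (auto intro!: derivative_eq_intros)
    thus ?thesis by (rule DERIV_imp_deriv)
  qed
  have cs: "continuous_on {x1..x2} c" using c x by (auto elim: continuous_on_subset)
  \<comment> \<open>Unit masses concentrating at \<open>z\<close> from inside
    \<open>{x1..x2}\<close> average a continuous function to its value at \<open>z\<close>. Both
    endpoints are instances.\<close>
  have lim_avg: "(\<lambda>n. LBINT x. c x * \<zeta> n x) \<longlonglongrightarrow> c z"
    if z: "z \<in> {x1..x2}" and sub: "\<And>n. {p n..q n} \<subseteq> {x1..x2} \<inter> {z - 3 * \<delta> n .. z + 3 * \<delta> n}"
      and \<zeta>: "\<And>n. smooth1 (\<zeta> n)" "\<And>n x. \<zeta> n x \<ge> 0" "\<And>n x. x \<notin> {p n..q n} \<Longrightarrow> \<zeta> n x = 0"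
        "\<And>n. integral\<^sup>L lborel (\<zeta> n) = 1" for z p q \<zeta>
  proof (rule LIMSEQ_I)
    fix r :: real assume r: "r > 0"
    obtain d where d: "d > 0" "\<And>x. x \<in> {x1..x2} \<Longrightarrow> dist x z < d \<Longrightarrow> dist (c x) (c z) < r / 2"
      using cs z r unfolding continuous_on_iff by (metis half_gt_zero)
    have "eventually (\<lambda>n. \<delta> n < d / 3) sequentially"
      using \<delta>lim d(1) by (intro order_tendstoD) auto
    then obtain N where N: "\<And>n. n \<ge> N \<Longrightarrow> \<delta> n < d / 3" by (auto simp: eventually_sequentially)
    have "norm ((LBINT x. c x * \<zeta> n x) - c z) < r" if "n \<ge> N" for n
    proof -
      have "\<bar>(LBINT x. c x * \<zeta> n x) - c z\<bar> \<le> r / 2"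
      proof (rule bump_average[where p="p n" and q="q n"])
        show "continuous_on {p n..q n} c" using cs sub[of n] by (auto elim: continuous_on_subset)
        show "continuous_on {p n..q n} (\<zeta> n)" using \<zeta>(1) by (rule smooth1_continuous)
        fix x assume "x \<in> {p n..q n}"
        hence "x \<in> {x1..x2}" "x \<in> {z - 3 * \<delta> n .. z + 3 * \<delta> n}" using sub[of n] by blast+
        moreover have "\<bar>x - z\<bar> < d" using calculation(2) N[OF that] by (auto simp: abs_less_iff)
        ultimately show "\<bar>c x - c z\<bar> \<le> r / 2" using d(2)[of x] by (simp add: dist_real_def)
      qed (use \<zeta> in auto)
      thus ?thesis using r by simp
    qed
    thus "\<exists>N. \<forall>n\<ge>N. norm ((LBINT x. c x * \<zeta> n x) - c z) < r" by blast
  qed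
  have l1: "(\<lambda>n. LBINT x. c x * \<eta> n x) \<longlonglongrightarrow> c x1"
  proof (rule lim_avg[where p="\<lambda>n. x1 + \<delta> n" and q="\<lambda>n. x1 + 2 * \<delta> n"])
    show "{x1 + \<delta> n..x1 + 2 * \<delta> n} \<subseteq> {x1..x2} \<inter> {x1 - 3 * \<delta> n..x1 + 3 * \<delta> n}" for n
      using \<delta>0[of n] \<delta>8[of n] by auto
  qed (use H lt in auto)
  have l2: "(\<lambda>n. LBINT x. c x * \<xi> n x) \<longlonglongrightarrow> c x2"
  proof (rule lim_avg[where p="\<lambda>n. x2 - 2 * \<delta> n" and q="\<lambda>n. x2 - \<delta> n"])
    show "{x2 - 2 * \<delta> n..x2 - \<delta> n} \<subseteq> {x1..x2} \<inter> {x2 - 3 * \<delta> n..x2 + 3 * \<delta> n}" for n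
      using \<delta>0[of n] \<delta>8[of n] by auto
  qed (use K lt in auto)
  have ic: "integrable lborel (\<lambda>x. c x * \<zeta> x)"
    if "smooth1 \<zeta>" "\<And>x. x \<notin> {x1..x2} \<Longrightarrow> \<zeta> x = 0" for \<zeta>
    using that cs smooth1_continuous[OF that(1)]
    by (intro integrable_cont_compact[of x1 x2]) (auto intro!: continuous_intros)
  have i1: "integrable lborel (\<lambda>x. c x * \<eta> n x)" for n
  proof (rule ic)
    show "smooth1 (\<eta> n)" using H by blast
    fix x assume "x \<notin> {x1..x2}"
    hence "x \<notin> {x1 + \<delta> n..x1 + 2 * \<delta> n}" using \<delta>0[of n] \<delta>8[of n] by auto
    thus "\<eta> n x = 0" using H by blast
  qed
  have i2: "integrable lborel (\<lambda>x. c x * \<xi> n x)" for n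
  proof (rule ic)
    show "smooth1 (\<xi> n)" using K by blast
    fix x assume "x \<notin> {x1..x2}"
    hence "x \<notin> {x2 - 2 * \<delta> n..x2 - \<delta> n}" using \<delta>0[of n] \<delta>8[of n] by auto
    thus "\<xi> n x = 0" using K by blast
  qed
  have e: "(LBINT x. c x * \<eta> n x) - (LBINT x. c x * \<xi> n x) = - (LBINT x. h x * \<phi> n x)" for n
    using eq[OF t[of n]] i1[of n] i2[of n] by (simp add: d\<phi> right_diff_distrib)
  have "(\<lambda>n. LBINT x. h x * \<phi> n x) \<longlonglongrightarrow> (LBINT x. indicator {x1..x2} x * h x)"
  proof (rule integral_dominated_convergence[where w="\<lambda>x. norm (h x)"])
    show "integrable lborel (\<lambda>x. norm (h x))" using h by simp
    have hm: "h \<in> borel_measurable lborel" using h by auto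
    show "(\<lambda>x. indicator {x1..x2} x * h x) \<in> borel_measurable lborel" using hm by measurable
    show "(\<lambda>x. h x * \<phi> n x) \<in> borel_measurable lborel" for n
      using hm test1_borel[OF t[of n]] by measurable
    have "\<bar>\<phi> n x\<bar> \<le> 1" for n x
    proof -
      have "0 \<le> H n x" "H n x \<le> 1" "0 \<le> K n x" "K n x \<le> 1" using H[of n] K[of n] by blast+
      thus ?thesis by (simp add: \<phi>_def)
    qed
    thus "AE x in lborel. norm (h x * \<phi> n x) \<le> norm (h x)" for n
      by (simp add: abs_mult mult_left_le)
    \<comment> \<open>At \<open>x1\<close> and \<open>x2\<close> themselves the trapezoids are 0
      while the indicator is 1; these two points form a null set.\<close>
    have pw: "(\<lambda>n. h x * \<phi> n x) \<longlonglongrightarrow> indicator {x1..x2} x * h x" if xx: "x \<noteq> x1" "x \<noteq> x2" for x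
    proof (cases "x1 < x \<and> x < x2")
      case True
      have "eventually (\<lambda>n. \<delta> n < min (x - x1) (x2 - x) / 2) sequentially"
        using \<delta>lim True by (intro order_tendstoD) auto
      hence "eventually (\<lambda>n. h x * \<phi> n x = indicator {x1..x2} x * h x) sequentially"
      proof eventually_elim
        case (elim n)
        hence "x \<ge> x1 + 2 * \<delta> n" "x \<le> x2 - 2 * \<delta> n" by auto
        hence "H n x = 1" "K n x = 0" using H[of n] K[of n] by blast+
        thus ?case using True by (simp add: \<phi>_def)
      qed
      thus ?thesis by (rule tendsto_eventually)
    next
      case False
      have "x \<notin> {x1 + \<delta> n .. x2 - \<delta> n}" for n using False \<delta>0[of n] by auto
      hence "\<phi> n x = 0" for n using \<phi>z by blast
      moreover have "x \<notin> {x1..x2}" using False xx by auto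
      ultimately show ?thesis by simp
    qed
    show "AE x in lborel. (\<lambda>n. h x * \<phi> n x) \<longlonglongrightarrow> indicator {x1..x2} x * h x"
      using AE_lborel_singleton[of x1] AE_lborel_singleton[of x2] by eventually_elim (rule pw)
  qed
  moreover have "(\<lambda>n. LBINT x. h x * \<phi> n x) \<longlonglongrightarrow> c x2 - c x1"
  proof -
    have "(\<lambda>n. (LBINT x. c x * \<xi> n x) - (LBINT x. c x * \<eta> n x)) \<longlonglongrightarrow> c x2 - c x1"
      by (intro tendsto_intros l1 l2)
    moreover have "(LBINT x. c x * \<xi> n x) - (LBINT x. c x * \<eta> n x) = (LBINT x. h x * \<phi> n x)" for n
      using e[of n] by simp
    ultimately show ?thesis by simp
  qed
  ultimately show ?thesis using LIMSEQ_unique by blast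
qed

section \<open>Primitives, integration by parts and second-order weak derivatives on an
  interval\<close>

lemma indicator_atMost: "indicator {..x::real} s = (if s \<le> x then 1 else 0::real)"
  by (simp add: indicator_def)

lemma prim_bound:
  assumes "integrable lborel h" shows "\<bar>prim h x\<bar> \<le> (LBINT s. \<bar>h s\<bar>)"
proof -
  have "\<bar>prim h x\<bar> \<le> (LBINT s. \<bar>indicator {..x} s * h s\<bar>)"
    unfolding prim_def by (rule integral_abs_bound)
  also have "\<dots> \<le> (LBINT s. \<bar>h s\<bar>)"
  proof (rule integral_mono)
    show "integrable lborel (\<lambda>s. \<bar>indicator {..x} s * h s\<bar>)"
      using assms integrable_mult_indicator[of "{..x}" lborel h] by simp
  qed (use assms in \<open>auto simp: indicator_def\<close>)
  finally show ?thesis .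
qed

lemma prim_borel[measurable]:
  assumes [measurable]: "h \<in> borel_measurable borel" shows "prim h \<in> borel_measurable borel"
  unfolding prim_def[abs_def] indicator_atMost
  by (rule lborel.borel_measurable_lebesgue_integral) measurable

text \<open>Fubini on the region s <= x: integrating \<open>\<phi>'\<close> over x >= s gives
  \<open>- \<phi> s\<close>, because \<open>\<phi>\<close> vanishes from \<open>b\<close>
  on.\<close>

lemma prim_ibp:
  assumes h: "integrable lborel h" and d: "\<And>x. (\<phi> has_real_derivative \<phi>' x) (at x)"
    and c: "continuous_on UNIV \<phi>'" and z': "\<And>x. x \<notin> {a..b} \<Longrightarrow> \<phi>' x = 0" and z: "\<And>x. x \<ge> b \<Longrightarrow> \<phi> x = 0"
  shows "(LBINT x. prim h x * \<phi>' x) = - (LBINT s. h s * \<phi> s)"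
proof -

  have ip: "integrable lborel \<phi>'" using c z' by (intro integrable_cont_compact[of a b]) (auto elim: continuous_on_subset)
  have [measurable]: "h \<in> borel_measurable borel" "\<phi>' \<in> borel_measurable borel"
    using h ip borel_measurable_integrable by force+
  let ?f = "\<lambda>x s. indicator {..x} s * h s * \<phi>' x"

  have int: "integrable (lborel \<Otimes>\<^sub>M lborel) (case_prod ?f)"
  proof (rule lborel_pair.Fubini_integrable)
    show "case_prod ?f \<in> borel_measurable (lborel \<Otimes>\<^sub>M lborel)"
      unfolding indicator_atMost by measurable
    have ii: "integrable lborel (\<lambda>s. indicator {..x} s * h s)" for x
      using h integrable_mult_indicator[of "{..x}" lborel h] by simp
    have eqn: "(LBINT y. norm (case (x, y) of (x, s) \<Rightarrow> indicator {..x} s * h s * \<phi>' x))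
        = prim (\<lambda>s. \<bar>h s\<bar>) x * \<bar>\<phi>' x\<bar>" for x
      by (simp add: prim_def abs_mult)
    show "integrable lborel (\<lambda>x. LBINT y. norm (case (x, y) of (x, s) \<Rightarrow> indicator {..x} s * h s * \<phi>' x))"
      unfolding eqn
    proof (rule integrable_mult_bounded(2)[where B = "LBINT s. \<bar>h s\<bar>"])
      show "integrable lborel (\<lambda>x. \<bar>\<phi>' x\<bar>)" using ip by simp
      show "prim (\<lambda>s. \<bar>h s\<bar>) \<in> borel_measurable lborel" by simp
      show "\<bar>prim (\<lambda>s. \<bar>h s\<bar>) x\<bar> \<le> (LBINT s. \<bar>h s\<bar>)" for x
        using prim_bound[of "\<lambda>s. \<bar>h s\<bar>" x] h by simp
    qed
    show "AE x in lborel. integrable lborel (\<lambda>y. case (x, y) of (x, s) \<Rightarrow> indicator {..x} s * h s * \<phi>' x)"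
      using ii by simp
  qed
  have "(LBINT x. prim h x * \<phi>' x) = (LBINT x. LBINT s. ?f x s)"
    by (simp add: prim_def)
  also have "\<dots> = (LBINT s. LBINT x. ?f x s)"
    using lborel_pair.Fubini_integral[OF int] by simp
  also have "\<dots> = (LBINT s. - (h s * \<phi> s))"
  proof (rule Bochner_Integration.integral_cong)
    fix s :: real
    \<comment> \<open>An upper limit beyond both \<open>s\<close> and the support, so that the
      fundamental theorem applies even when \<open>s\<close> lies to the right of
      \<open>b\<close>.\<close>
    define b' where "b' = max s (b + 1)"
    have "(LBINT x. \<phi>' x * indicator {s..b'} x) = \<phi> b' - \<phi> s"
      using c d by (intro integral_FTC_Icc_real) (auto simp: b'_def continuous_on_eq_continuous_at)
    moreover have "\<phi> b' = 0" using z[of b'] by (simp add: b'_def)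
    moreover have "?f x s = h s * (\<phi>' x * indicator {s..b'} x)" for x
      using z'[of x] by (cases "x \<in> {a..b}") (auto simp: indicator_def b'_def)
    ultimately show "(LBINT x. ?f x s) = - (h s * \<phi> s)"
      by (simp only: integral_mult_right_zero) simp
  qed simp
  also have "\<dots> = - (LBINT s. h s * \<phi> s)" by simp
  finally show ?thesis .
qed

lemma test1_bump_exists:
  assumes "a < b"
  obtains \<eta> where "test1 a b \<eta>" "\<And>x. \<eta> x \<ge> 0" "integral\<^sup>L lborel \<eta> = 1"
proof -
  have "(2 * a + b) / 3 < (a + 2 * b) / 3" using assms by simp
  then obtain \<eta> where e: "smooth1 \<eta>" "\<And>x. \<eta> x \<ge> 0" "\<And>x. x \<notin> {(2 * a + b) / 3..(a + 2 * b) / 3} \<Longrightarrow> \<eta> x = 0"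
    "integral\<^sup>L lborel \<eta> = 1" by (rule bump_exists) blast
  have "test1 a b \<eta>" unfolding test1_def
    by (intro conjI exI[of _ "(2 * a + b) / 3"] exI[of _ "(a + 2 * b) / 3"]) (use e assms in auto)
  with e show thesis by (intro that)
qed

text \<open>Zero total mass is what brings the primitive back to 0 on the right of the support, so
  that it is again a test function.\<close>

lemma test1_primitive:
  assumes "test1 a b \<psi>" "integral\<^sup>L lborel \<psi> = 0"
  obtains \<Phi> where "test1 a b \<Phi>" "deriv \<Phi> = \<psi>"
proof -
  obtain c d where 1: "a < c" "c \<le> d" "d < b" "\<And>x. x \<notin> {c..d} \<Longrightarrow> \<psi> x = 0" "smooth1 \<psi>"
    using assms(1) by (auto simp: test1_def)
  obtain H where H: "smooth1 H" "\<And>x. (H has_real_derivative \<psi> x) (at x)" "\<And>x. x \<le> c \<Longrightarrow> H x = 0"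
    "\<And>x. x \<ge> d \<Longrightarrow> H x = integral\<^sup>L lborel \<psi>"
    using smooth1_primitive[OF 1(5,4,2)] by blast
  have "H x = 0" if "x \<notin> {c..d}" for x using that H assms(2) by (cases "x \<le> c") auto
  hence "test1 a b H" using H(1) 1 unfolding test1_def by blast
  moreover have "deriv H = \<psi>" using H(2) by (auto intro: DERIV_imp_deriv)
  ultimately show thesis by (rule that)
qed

text \<open>An argument of du Bois-Reymond type reduces this to first order. A test function minus
  the right multiple of a fixed bump is the derivative of another test function, to which the
  hypothesis applies. The correction by the bump accounts for the free slope
  \<open>C\<close>.\<close>

lemma second_weak_derivative_imp_increment:
  assumes "a < b" and m: "continuous_on {a..b} m" and h: "integrable lborel h"
    and eq: "\<And>\<phi>. test1 a b \<phi> \<Longrightarrow> (LBINT x. m x * deriv (deriv \<phi>) x) = (LBINT x. h x * \<phi> x)"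
  obtains C where "\<And>x1 x2. a \<le> x1 \<Longrightarrow> x1 \<le> x2 \<Longrightarrow> x2 \<le> b \<Longrightarrow>
     m x2 - m x1 = (LBINT x. indicator {x1..x2} x * (C + prim h x))"
proof -
  obtain \<eta> where \<eta>: "test1 a b \<eta>" "integral\<^sup>L lborel \<eta> = 1"
    using test1_bump_exists[OF assms(1)] by blast
  have [measurable]: "h \<in> borel_measurable borel" using h borel_measurable_integrable by force
  have ipt: "integrable lborel (\<lambda>x. prim h x * \<psi> x)" if "test1 a b \<psi>" for \<psi>
    using integrable_test1[OF that] prim_bound[OF h]
    by (intro integrable_mult_bounded(2)[where B = "LBINT s. \<bar>h s\<bar>"]) auto
  define A where "A = (LBINT x. m x * deriv \<eta> x)"
  define E where "E = (LBINT x. prim h x * \<eta> x)"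
  \<comment> \<open>Forced by the test function \<open>\<eta>\<close> itself: the integral of
    \<open>m * deriv \<eta>\<close> is \<open>A\<close>, and it has to equal
    \<open>- (C + E)\<close> as \<open>\<eta>\<close> has mass 1.\<close>
  define C where "C = - A - E"
  define h' where "h' x = indicator {a..b} x * (C + prim h x)" for x
  have h': "integrable lborel h'"
  proof -
    have "integrable lborel (\<lambda>x. indicator {a..b} x * (C + prim h x))"
      using prim_bound[OF h] by (intro integrable_mult_bounded(1)[where B = "\<bar>C\<bar> + (LBINT s. \<bar>h s\<bar>)"])
        (auto intro!: order_trans[OF abs_triangle_ineq] add_mono integrable_real_indicator simp: emeasure_lborel_Icc_eq)
    thus ?thesis by (simp add: h'_def[abs_def])
  qed
  have main: "(LBINT x. m x * deriv \<psi> x) = - (LBINT x. h' x * \<psi> x)" if \<psi>: "test1 a b \<psi>" for \<psi>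
  proof -
    \<comment> \<open>Subtracting \<open>k\<close> times the unit bump makes the mass zero, hence
      gives a derivative \<open>deriv \<Phi>\<close>.\<close>
    define k where "k = integral\<^sup>L lborel \<psi>"
    have t: "test1 a b (\<lambda>x. \<psi> x - k * \<eta> x)" by (intro test1_diff_mult \<psi> \<eta>)
    have "(LBINT x. \<psi> x - k * \<eta> x) = 0"
      using integrable_test1[OF \<psi>] integrable_test1[OF \<eta>(1)] \<eta>(2) by (simp add: k_def)
    then obtain \<Phi> where \<Phi>: "test1 a b \<Phi>" "deriv \<Phi> = (\<lambda>x. \<psi> x - k * \<eta> x)"
      using test1_primitive[OF t] by blast
    have sm: "smooth1 \<psi>" "smooth1 \<eta>" "smooth1 \<Phi>" using \<psi> \<eta> \<Phi> by (auto simp: test1_def)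
    have dd: "deriv (\<lambda>x. \<psi> x - k * \<eta> x) x = deriv \<psi> x - k * deriv \<eta> x" for x
      using smooth1_DERIV[OF sm(1)] smooth1_DERIV[OF sm(2)]
      by (intro DERIV_imp_deriv) (auto intro!: derivative_eq_intros)
    have i: "integrable lborel (\<lambda>x. m x * deriv \<psi> x)" "integrable lborel (\<lambda>x. m x * deriv \<eta> x)"
      by (intro integrable_cont_test1[OF m] test1_deriv \<psi> \<eta>)+
    have "(LBINT x. m x * deriv \<psi> x) - k * A = (LBINT x. m x * (deriv \<psi> x - k * deriv \<eta> x))"
      using i by (simp add: right_diff_distrib A_def mult.left_commute[of _ k])
    also have "\<dots> = (LBINT x. h x * \<Phi> x)"
      using eq[OF \<Phi>(1)] by (simp add: \<Phi>(2) dd)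
    also have "\<dots> = - (LBINT x. prim h x * (\<psi> x - k * \<eta> x))"
    proof -
      have "(LBINT x. prim h x * deriv \<Phi> x) = - (LBINT x. h x * \<Phi> x)"
        using test1_outside[OF \<Phi>(1)] test1_outside[OF test1_deriv[OF \<Phi>(1)]] smooth1_DERIV[OF sm(3)] smooth1_continuous[OF smooth1_deriv[OF sm(3)]]
        by (intro prim_ibp[where a=a and b=b] h) auto
      thus ?thesis by (simp add: \<Phi>(2))
    qed
    also have "\<dots> = k * E - (LBINT x. prim h x * \<psi> x)"
      using ipt[OF \<psi>] ipt[OF \<eta>(1)] by (simp add: right_diff_distrib E_def mult.left_commute[of _ k])
    finally have "(LBINT x. m x * deriv \<psi> x) = - (C * k + (LBINT x. prim h x * \<psi> x))"
      by (simp add: C_def algebra_simps)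
    also have "C * k + (LBINT x. prim h x * \<psi> x) = (LBINT x. C * \<psi> x + prim h x * \<psi> x)"
      using ipt[OF \<psi>] integrable_test1[OF \<psi>] by (simp add: k_def)
    also have "\<dots> = (LBINT x. h' x * \<psi> x)"
      using test1_outside[OF \<psi>] by (intro Bochner_Integration.integral_cong) (auto simp: h'_def indicator_def algebra_simps)
    finally show ?thesis .
  qed
  show thesis
  proof (rule that)
    fix x1 x2 assume x: "a \<le> x1" "x1 \<le> x2" "x2 \<le> b"
    have "m x2 - m x1 = (LBINT x. indicator {x1..x2} x * h' x)"
      using weak_derivative_imp_increment[OF m h' main x] .
    also have "\<dots> = (LBINT x. indicator {x1..x2} x * (C + prim h x))"
      using x by (intro Bochner_Integration.integral_cong) (auto simp: h'_def indicator_def)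
    finally show "m x2 - m x1 = (LBINT x. indicator {x1..x2} x * (C + prim h x))" .
  qed
qed

section \<open>Test functions and square integrable functions on the rectangle\<close>

lemma differentiable_slice_x:
  fixes f :: "real \<times> real \<Rightarrow> real"
  assumes "f differentiable_on UNIV"
  shows "((\<lambda>t. f (t, y)) has_real_derivative pdx f (x, y)) (at x)"
proof -
  have "f differentiable (at (x, y))" using assms by (auto simp: differentiable_on_def)
  then obtain f' where f': "(f has_derivative f') (at (x, y))" by (auto simp: differentiable_def)
  have "((\<lambda>t. f (t, y)) has_derivative (\<lambda>h. f' (h, 0))) (at x)"
    by (rule has_derivative_compose[of "\<lambda>t. (t, y)" "\<lambda>h. (h, 0)"]) (auto intro!: derivative_eq_intros f')
  hence "(\<lambda>t. f (t, y)) differentiable (at x)" by (auto simp: differentiable_def)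
  thus ?thesis by (simp add: pdx_def DERIV_deriv_iff_real_differentiable)
qed

lemma differentiable_slice_y:
  fixes f :: "real \<times> real \<Rightarrow> real"
  assumes "f differentiable_on UNIV"
  shows "((\<lambda>t. f (x, t)) has_real_derivative pdy f (x, y)) (at y)"
proof -
  have "f differentiable (at (x, y))" using assms by (auto simp: differentiable_on_def)
  then obtain f' where f': "(f has_derivative f') (at (x, y))" by (auto simp: differentiable_def)
  have "((\<lambda>t. f (x, t)) has_derivative (\<lambda>h. f' (0, h))) (at y)"
    by (rule has_derivative_compose[of "\<lambda>t. (x, t)" "\<lambda>h. (0, h)"]) (auto intro!: derivative_eq_intros f')
  hence "(\<lambda>t. f (x, t)) differentiable (at y)" by (auto simp: differentiable_def)
  thus ?thesis by (simp add: pdy_def DERIV_deriv_iff_real_differentiable)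
qed

lemma Dw_append: "Dw (bs @ cs) f = Dw bs (Dw cs f)"
  by (induction bs) auto

lemma test_fun_smooth2: "test_fun U \<phi> \<Longrightarrow> smooth2 \<phi>"
  by (simp add: test_fun_def)

lemma smooth2_Dw: "smooth2 f \<Longrightarrow> smooth2 (Dw cs f)"
  by (metis Dw_append smooth2_def)

lemma smooth2_differentiable: "smooth2 f \<Longrightarrow> f differentiable_on UNIV"
  using smooth2_def Dw.simps(1) by metis

lemma smooth2_continuous: "smooth2 f \<Longrightarrow> continuous_on S f"
  by (meson continuous_on_subset differentiable_imp_continuous_on smooth2_differentiable subset_UNIV)

lemma pd_zero_outside:
  assumes "closed K" "\<And>p. p \<notin> K \<Longrightarrow> f p = 0" "p \<notin> K"
  shows "pdx f p = 0" "pdy f p = 0"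
proof -
  obtain x y where p: "p = (x, y)" by force
  have "closed ((\<lambda>t. (t, y)) -` K)" "closed ((\<lambda>t. (x, t)) -` K)"
    using assms(1) by (auto intro!: continuous_closed_vimage continuous_intros)
  from deriv_zero_outside[OF _ this(1), of "\<lambda>t. f (t, y)" x] deriv_zero_outside[OF _ this(2), of "\<lambda>t. f (x, t)" y]
  show "pdx f p = 0" "pdy f p = 0"
    using assms(2,3) by (auto simp: pdx_def pdy_def p intro!: DERIV_imp_deriv)
qed

lemma test_fun_Dw: assumes "test_fun U \<phi>" shows "test_fun U (Dw ws \<phi>)"
proof -
  obtain K where K: "compact K" "K \<subseteq> U" "\<And>p. p \<notin> K \<Longrightarrow> \<phi> p = 0"
    using assms by (auto simp: test_fun_def)
  have "Dw ws \<phi> p = 0" if "p \<notin> K" for p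
    using that
  proof (induction ws arbitrary: p)
    case (Cons b bs)
    thus ?case using pd_zero_outside[OF compact_imp_closed[OF K(1)], of "Dw bs \<phi>" p] by auto
  qed (use K in auto)
  with K assms show ?thesis using smooth2_Dw by (auto simp: test_fun_def)
qed

lemma test_fun_pdx: "test_fun U \<phi> \<Longrightarrow> test_fun U (pdx \<phi>)"
  using test_fun_Dw[of U \<phi> "[True]"] by simp

lemma test_fun_pdy: "test_fun U \<phi> \<Longrightarrow> test_fun U (pdy \<phi>)"
  using test_fun_Dw[of U \<phi> "[False]"] by simp

lemma test_fun_outside: "test_fun U \<phi> \<Longrightarrow> p \<notin> U \<Longrightarrow> \<phi> p = 0"
  unfolding test_fun_def by blast

lemma test_fun_continuous: "test_fun U \<phi> \<Longrightarrow> continuous_on S \<phi>"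
  by (auto simp: test_fun_def intro: smooth2_continuous)

lemma test_fun_borel: "test_fun U \<phi> \<Longrightarrow> \<phi> \<in> borel_measurable borel"
  using test_fun_continuous by (intro borel_measurable_continuous_onI)

lemma test_fun_bounded:
  assumes "test_fun U \<phi>" obtains B where "\<And>x. \<bar>\<phi> x\<bar> \<le> B" "B \<ge> 0"
proof -
  obtain K where K: "compact K" "K \<subseteq> U" "\<And>p. p \<notin> K \<Longrightarrow> \<phi> p = 0"
    using assms by (auto simp: test_fun_def)
  have "compact (\<phi> ` K)" using K test_fun_continuous[OF assms] by (intro compact_continuous_image) auto
  hence "bounded (\<phi> ` K)" by (rule compact_imp_bounded)
  then obtain B where B: "\<And>x. x \<in> K \<Longrightarrow> \<bar>\<phi> x\<bar> \<le> B"
    unfolding bounded_iff by fastforce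
  have "\<bar>\<phi> x\<bar> \<le> max B 0" for x
    using B[of x] K(3)[of x] by (cases "x \<in> K") auto
  thus thesis by (rule that) simp
qed

text \<open>Partial derivatives preserve the product form, so smoothness in two variables reduces to
  one. Products are the only two-dimensional test functions built from scratch.\<close>

lemma tensor_Dw:
  assumes "smooth1 \<phi>" "smooth1 \<theta>"
  shows "\<exists>\<phi>' \<theta>'. smooth1 \<phi>' \<and> smooth1 \<theta>' \<and> Dw bs (\<lambda>p. \<phi> (fst p) * \<theta> (snd p)) = (\<lambda>p. \<phi>' (fst p) * \<theta>' (snd p))"
proof (induction bs)
  case (Cons b bs)
  then obtain \<phi>' \<theta>' where I: "smooth1 \<phi>'" "smooth1 \<theta>'"
    "Dw bs (\<lambda>p. \<phi> (fst p) * \<theta> (snd p)) = (\<lambda>p. \<phi>' (fst p) * \<theta>' (snd p))" by blast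
  have 1: "pdx (\<lambda>p. \<phi>' (fst p) * \<theta>' (snd p)) = (\<lambda>p. deriv \<phi>' (fst p) * \<theta>' (snd p))"
    using smooth1_DERIV[OF I(1)] by (auto simp: pdx_def fun_eq_iff intro!: DERIV_imp_deriv derivative_eq_intros)
  have 2: "pdy (\<lambda>p. \<phi>' (fst p) * \<theta>' (snd p)) = (\<lambda>p. \<phi>' (fst p) * deriv \<theta>' (snd p))"
    using smooth1_DERIV[OF I(2)] by (auto simp: pdy_def fun_eq_iff intro!: DERIV_imp_deriv derivative_eq_intros)
  show ?case
    using I 1 2 smooth1_deriv[OF I(1)] smooth1_deriv[OF I(2)] by (cases b) auto
qed (use assms in auto)

lemma smooth2_tensor:
  assumes "smooth1 \<phi>" "smooth1 \<theta>" shows "smooth2 (\<lambda>p. \<phi> (fst p) * \<theta> (snd p))"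
  unfolding smooth2_def
proof
  fix bs
  obtain \<phi>' \<theta>' where I: "smooth1 \<phi>'" "smooth1 \<theta>'"
    "Dw bs (\<lambda>p. \<phi> (fst p) * \<theta> (snd p)) = (\<lambda>p. \<phi>' (fst p) * \<theta>' (snd p))"
    using tensor_Dw[OF assms] by blast
  have "\<phi>' differentiable (at x)" "\<theta>' differentiable (at x)" for x
    using smooth1_DERIV[OF I(1), of x] smooth1_DERIV[OF I(2), of x]
    by (auto simp: real_differentiable_def)
  hence "(\<lambda>p. \<phi>' (fst p)) differentiable (at p)" "(\<lambda>p. \<theta>' (snd p)) differentiable (at p)" for p :: "real \<times> real"
    using differentiable_compose[of \<phi>' fst p UNIV] differentiable_compose[of \<theta>' snd p UNIV]
      bounded_linear_imp_differentiable[OF bounded_linear_fst] bounded_linear_imp_differentiable[OF bounded_linear_snd]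
    by auto
  thus "Dw bs (\<lambda>p. \<phi> (fst p) * \<theta> (snd p)) differentiable_on UNIV"
    unfolding I(3) by (auto simp: differentiable_on_def intro!: differentiable_mult)
qed

lemma tensor_pd:
  assumes "smooth1 \<phi>" "smooth1 \<theta>"
  shows "pdx (\<lambda>p. \<phi> (fst p) * \<theta> (snd p)) = (\<lambda>p. deriv \<phi> (fst p) * \<theta> (snd p))"
    and "pdy (\<lambda>p. \<phi> (fst p) * \<theta> (snd p)) = (\<lambda>p. \<phi> (fst p) * deriv \<theta> (snd p))"
  using smooth1_DERIV[OF assms(1)] smooth1_DERIV[OF assms(2)]
  by (auto simp: pdx_def pdy_def fun_eq_iff intro!: DERIV_imp_deriv derivative_eq_intros)

lemma test_fun_tensor:
  assumes "test1 0 pi \<phi>" "test1 (-l) l \<theta>"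
  shows "test_fun (Omega l) (\<lambda>p. \<phi> (fst p) * \<theta> (snd p))"
proof -
  obtain a b where 1: "smooth1 \<phi>" "0 < a" "b < pi" "\<forall>x. x \<notin> {a..b} \<longrightarrow> \<phi> x = 0"
    using assms(1) unfolding test1_def by blast
  obtain c d where 2: "smooth1 \<theta>" "-l < c" "d < l" "\<forall>x. x \<notin> {c..d} \<longrightarrow> \<theta> x = 0"
    using assms(2) unfolding test1_def by blast
  have "compact ({a..b} \<times> {c..d})" by (intro compact_Times compact_Icc)
  moreover have "{a..b} \<times> {c..d} \<subseteq> Omega l" using 1 2 by (auto simp: Omega_def)
  moreover have "\<forall>p. p \<notin> {a..b} \<times> {c..d} \<longrightarrow> \<phi> (fst p) * \<theta> (snd p) = 0"
    using 1 2 by (auto simp: mem_Times_iff)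
  ultimately show ?thesis using smooth2_tensor[OF 1(1) 2(1)] unfolding test_fun_def by blast
qed

section \<open>Measure theory on the rectangle and Borel representatives\<close>

lemma Omega_borel[measurable]: "Omega l \<in> sets borel" "Omegabar l \<in> sets borel"
  and Omega_lebesgue[measurable]: "Omega l \<in> sets lebesgue"
  and Omega_subset: "Omega l \<subseteq> Omegabar l" and compact_Omegabar: "compact (Omegabar l)"
proof -
  have "open (Omega l)" unfolding Omega_def by (intro open_Times) auto
  thus "Omega l \<in> sets borel" by simp
  thus "Omega l \<in> sets lebesgue" by simp
  show "compact (Omegabar l)" unfolding Omegabar_def by (intro compact_Times compact_Icc)
  thus "Omegabar l \<in> sets borel" by (simp add: borel_closed compact_imp_closed)
  show "Omega l \<subseteq> Omegabar l" by (auto simp: Omega_def Omegabar_def)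
qed

lemma finite_Omegabar: "emeasure lborel (Omegabar l) < \<infinity>" "emeasure lborel (Omega l) < \<infinity>"
  "emeasure lebesgue (Omega l) < \<infinity>"
proof -
  show 1: "emeasure lborel (Omegabar l) < \<infinity>"
    using emeasure_bounded_finite[OF compact_imp_bounded[OF compact_Omegabar]] by (simp add: top.not_eq_extremum)
  have "emeasure lborel (Omega l) \<le> emeasure lborel (Omegabar l)"
    using Omega_subset by (intro emeasure_mono) auto
  with 1 show "emeasure lborel (Omega l) < \<infinity>" by order
  thus "emeasure lebesgue (Omega l) < \<infinity>" by simp
qed

lemma finite_measure_Omega: "finite_measure (lebesgue_on (Omega l))"
  using finite_Omegabar(3)[of l] by (intro finite_measureI) (simp add: emeasure_restrict_space top.not_eq_extremum)

text \<open>Representatives of square integrable functions that are Borel and vanish off \<open>Omega\<close>, so that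
  all integrals can be taken with respect to \<open>lborel\<close>, which is a product measure.\<close>

definition sq :: "real \<Rightarrow> (real \<times> real \<Rightarrow> real) \<Rightarrow> bool" where
  "sq l g \<longleftrightarrow> g \<in> borel_measurable borel \<and> (\<forall>p. p \<notin> Omega l \<longrightarrow> g p = 0) \<and> integrable lborel (\<lambda>p. (g p)\<^sup>2)"

lemma integrable_indicator_Omegabar: "integrable lborel (indicator (Omegabar l) :: _ \<Rightarrow> real)"
  using finite_Omegabar by (intro integrable_real_indicator) auto

text \<open>On a set of finite measure the bound \<open>|t| <= 1 + t^2\<close> dominates the
  function by its square.\<close>

lemma sq_integrable: assumes "sq l g" shows "integrable lborel g"
proof (rule Bochner_Integration.integrable_bound)
  show "integrable lborel (\<lambda>p. indicator (Omegabar l) p + (g p)\<^sup>2)"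
    using assms integrable_indicator_Omegabar by (auto simp: sq_def)
  show "g \<in> borel_measurable lborel" using assms by (auto simp: sq_def)
  have "\<bar>t\<bar> \<le> 1 + t\<^sup>2" for t :: real
  proof -
    have "0 \<le> (\<bar>t\<bar> - 1)\<^sup>2" by simp
    also have "\<dots> = t\<^sup>2 - 2 * \<bar>t\<bar> + 1" by (simp add: power2_eq_square algebra_simps)
    finally show ?thesis using zero_le_power2[of t] by argo
  qed
  note ab = this
  have "norm (g p) \<le> norm (indicator (Omegabar l) p + (g p)\<^sup>2)" for p
  proof (cases "p \<in> Omega l")
    case True
    hence "p \<in> Omegabar l" using Omega_subset by blast
    thus ?thesis using ab[of "g p"] by simp
  next
    case False
    hence "g p = 0" using assms unfolding sq_def by blast
    thus ?thesis by simp
  qed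
  thus "AE p in lborel. norm (g p) \<le> norm (indicator (Omegabar l) p + (g p)\<^sup>2)" by simp
qed

lemma integral_lebesgue_on_Omega:
  fixes f :: "real \<times> real \<Rightarrow> real"
  assumes "f \<in> borel_measurable borel" "\<And>p. p \<notin> Omega l \<Longrightarrow> f p = 0"
  shows "integral\<^sup>L (lebesgue_on (Omega l)) f = integral\<^sup>L lborel f"
proof -
  have "integral\<^sup>L (lebesgue_on (Omega l)) f = integral\<^sup>L lebesgue (\<lambda>p. indicator (Omega l) p *\<^sub>R f p)"
    by (subst integral_restrict_space) auto
  also have "(\<lambda>p. indicator (Omega l) p *\<^sub>R f p) = f" using assms(2) by (auto simp: indicator_def fun_eq_iff)
  also have "integral\<^sup>L lebesgue f = integral\<^sup>L lborel f" using assms(1) by (intro integral_completion) simp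
  finally show ?thesis .
qed

lemma integrable_lebesgue_on_Omega:
  fixes f :: "real \<times> real \<Rightarrow> real"
  assumes "f \<in> borel_measurable borel" "\<And>p. p \<notin> Omega l \<Longrightarrow> f p = 0"
  shows "integrable (lebesgue_on (Omega l)) f \<longleftrightarrow> integrable lborel f"
proof -
  have "integrable (lebesgue_on (Omega l)) f = integrable lebesgue (\<lambda>p. indicator (Omega l) p *\<^sub>R f p)"
    by (subst integrable_restrict_space) auto
  also have "(\<lambda>p. indicator (Omega l) p *\<^sub>R f p) = f" using assms(2) by (auto simp: indicator_def fun_eq_iff)
  also have "integrable lebesgue f = integrable lborel f" using assms(1) by (intro integrable_completion) simp
  finally show ?thesis .
qed

lemma borel_measurable_lebesgue_on:
  "f \<in> borel_measurable borel \<Longrightarrow> f \<in> borel_measurable (lebesgue_on S)"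
  by (intro measurable_restrict_space1 measurable_completion) simp

lemma sq_L2: "sq l g \<Longrightarrow> L2 (Omega l) g"
  unfolding L2_def sq_def
  by (subst integrable_lebesgue_on_Omega) (auto intro: borel_measurable_lebesgue_on)

lemma L2_ex_sq:
  assumes "L2 (Omega l) g"
  obtains g' where "sq l g'" "AE p in lebesgue_on (Omega l). g p = g' p"
proof -
  have "g \<in> borel_measurable (lebesgue_on (Omega l))" using assms by (simp add: L2_def)
  hence "(\<lambda>p. indicator (Omega l) p *\<^sub>R g p) \<in> borel_measurable lebesgue"
    by (subst (asm) borel_measurable_restrict_space_iff) auto
  from completion_ex_borel_measurable_real[OF this] obtain h where
    h: "h \<in> borel_measurable lborel" "AE p in lborel. indicator (Omega l) p *\<^sub>R g p = h p" by auto
  \<comment> \<open>The Borel version agrees with the zero extension only almost everywhere; cutting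
    it off again makes it vanish exactly outside \<open>Omega l\<close>.\<close>
  define g' where "g' p = indicator (Omega l) p * h p" for p
  have m: "g' \<in> borel_measurable borel" using h unfolding g'_def by measurable
  have "AE p in lebesgue. indicator (Omega l) p *\<^sub>R g p = h p" using h(2) by (rule AE_completion)
  hence "AE p in lebesgue. p \<in> Omega l \<longrightarrow> g p = g' p"
    by eventually_elim (auto simp: g'_def)
  hence ae: "AE p in lebesgue_on (Omega l). g p = g' p"
    using AE_restrict_space_iff[of "Omega l" lebesgue "\<lambda>p. g p = g' p"] by simp
  have z: "\<And>p. p \<notin> Omega l \<Longrightarrow> g' p = 0" by (simp add: g'_def)
  have "integrable (lebesgue_on (Omega l)) (\<lambda>p. (g' p)\<^sup>2)"
  proof (rule integrable_cong_AE_imp)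
    show "integrable (lebesgue_on (Omega l)) (\<lambda>p. (g p)\<^sup>2)" using assms by (simp add: L2_def)
    show "(\<lambda>p. (g' p)\<^sup>2) \<in> borel_measurable (lebesgue_on (Omega l))"
      using m by (intro borel_measurable_lebesgue_on) measurable
    show "AE p in lebesgue_on (Omega l). (g p)\<^sup>2 = (g' p)\<^sup>2" using ae by eventually_elim simp
  qed
  hence "integrable lborel (\<lambda>p. (g' p)\<^sup>2)"
    using m z by (subst (asm) integrable_lebesgue_on_Omega) auto
  hence "sq l g'" using m z by (auto simp: sq_def)
  with ae show thesis by (intro that)
qed

lemma L2_integrable: "L2 (Omega l) g \<Longrightarrow> integrable (lebesgue_on (Omega l)) g"
  unfolding L2_def by (blast intro: finite_measure.square_integrable_imp_integrable[OF finite_measure_Omega[of l]])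

lemma L2_continuous:
  assumes "continuous_on (Omegabar l) u" shows "L2 (Omega l) u"
proof -
  have c: "continuous_on (Omega l) u" using assms Omega_subset continuous_on_subset by blast
  have m: "u \<in> borel_measurable (lebesgue_on (Omega l))"
    using c Omega_lebesgue by (rule continuous_imp_measurable_on_sets_lebesgue)
  have "bounded (u ` Omegabar l)"
    using assms compact_Omegabar by (intro compact_imp_bounded compact_continuous_image)
  then obtain B where B: "\<And>x. x \<in> Omegabar l \<Longrightarrow> \<bar>u x\<bar> \<le> B"
    unfolding bounded_iff by fastforce
  have "integrable (lebesgue_on (Omega l)) (\<lambda>p. (u p)\<^sup>2)"
  proof (rule finite_measure.integrable_const_bound[OF finite_measure_Omega])
    show "AE p in lebesgue_on (Omega l). norm ((u p)\<^sup>2) \<le> B\<^sup>2"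
    proof (rule AE_I2)
      fix p assume "p \<in> space (lebesgue_on (Omega l))"
      hence "\<bar>u p\<bar> \<le> B" using B[of p] Omega_subset[of l] by auto
      hence "\<bar>u p\<bar>\<^sup>2 \<le> B\<^sup>2" by (intro power_mono) auto
      thus "norm ((u p)\<^sup>2) \<le> B\<^sup>2" by simp
    qed
    show "(\<lambda>p. (u p)\<^sup>2) \<in> borel_measurable (lebesgue_on (Omega l))" using m by measurable
  qed
  with m show ?thesis by (simp add: L2_def)
qed

lemma weak_deriv_cong_AE:
  assumes "weak_deriv (Omega l) ws u g" "L2 (Omega l) g'" "AE p in lebesgue_on (Omega l). g p = g' p"
  shows "weak_deriv (Omega l) ws u g'"
proof -
  have "integral\<^sup>L (lebesgue_on (Omega l)) (\<lambda>p. g p * \<phi> p) = integral\<^sup>L (lebesgue_on (Omega l)) (\<lambda>p. g' p * \<phi> p)"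
    if "test_fun (Omega l) \<phi>" for \<phi>
  proof (rule integral_cong_AE)
    have [measurable]: "\<phi> \<in> borel_measurable (lebesgue_on (Omega l))"
      using test_fun_borel[OF that] by (rule borel_measurable_lebesgue_on)
    have [measurable]: "g \<in> borel_measurable (lebesgue_on (Omega l))" "g' \<in> borel_measurable (lebesgue_on (Omega l))"
      using assms by (auto simp: weak_deriv_def L2_def)
    show "(\<lambda>p. g p * \<phi> p) \<in> borel_measurable (lebesgue_on (Omega l))"
      "(\<lambda>p. g' p * \<phi> p) \<in> borel_measurable (lebesgue_on (Omega l))" by measurable
  qed (use assms(3) in eventually_elim, simp)
  thus ?thesis using assms(1,2) by (auto simp: weak_deriv_def)
qed

lemma weak_deriv_ex_sq:
  assumes "weak_deriv (Omega l) ws u g"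
  obtains g' where "sq l g'" "weak_deriv (Omega l) ws u g'" "AE p in lebesgue_on (Omega l). g p = g' p"
proof -
  have "L2 (Omega l) g" using assms by (simp add: weak_deriv_def)
  then obtain g' where "sq l g'" "AE p in lebesgue_on (Omega l). g p = g' p" by (rule L2_ex_sq)
  with weak_deriv_cong_AE[OF assms sq_L2] show thesis by (intro that)
qed

text \<open>Off \<open>Omegabar l\<close> the values of \<open>u\<close> are arbitrary and possibly
  non-measurable. The factor \<open>\<phi>\<close> hides them.\<close>

lemma borel_mult_test_fun:
  assumes "continuous_on (Omegabar l) u" "test_fun (Omega l) \<phi>"
  shows "(\<lambda>p. u p * \<phi> p) \<in> borel_measurable borel"
proof -
  have "(\<lambda>p. indicator (Omegabar l) p *\<^sub>R u p) \<in> borel_measurable borel"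
    using assms by (intro borel_measurable_continuous_on_indicator) auto
  hence "(\<lambda>p. indicator (Omegabar l) p *\<^sub>R u p * \<phi> p) \<in> borel_measurable borel"
    using test_fun_borel[OF assms(2)] by measurable
  moreover have "indicator (Omegabar l) p *\<^sub>R u p * \<phi> p = u p * \<phi> p" for p
    using test_fun_outside[OF assms(2), of p] Omega_subset[of l] by (auto simp: indicator_def)
  ultimately show ?thesis by (simp only:)
qed

lemma integrable_mult_test_fun:
  assumes "continuous_on (Omegabar l) u" "test_fun (Omega l) \<phi>"
  shows "integrable lborel (\<lambda>p. u p * \<phi> p)"
proof -
  obtain B where B: "\<And>x. \<bar>\<phi> x\<bar> \<le> B" using test_fun_bounded[OF assms(2)] by blast
  have "integrable (lebesgue_on (Omega l)) (\<lambda>p. u p * \<phi> p)"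
    using L2_integrable[OF L2_continuous[OF assms(1)]] B test_fun_borel[OF assms(2)]
    by (intro integrable_mult_bounded(1)[where B=B] borel_measurable_lebesgue_on) auto
  thus ?thesis
    using borel_mult_test_fun[OF assms] test_fun_outside[OF assms(2)]
    by (subst (asm) integrable_lebesgue_on_Omega) auto
qed

text \<open>Replaces the completed, restricted measure of the definition by \<open>lborel\<close>,
  so that Fubini can be used on both sides of the identity.\<close>

lemma weak_deriv_sq_iff:
  assumes "continuous_on (Omegabar l) u" "sq l g"
  shows "weak_deriv (Omega l) ws u g \<longleftrightarrow> (\<forall>\<phi>. test_fun (Omega l) \<phi> \<longrightarrow>
     (LBINT p. u p * Dw ws \<phi> p) = (-1) ^ length ws * (LBINT p. g p * \<phi> p))"
proof -
  have "integral\<^sup>L (lebesgue_on (Omega l)) (\<lambda>p. u p * Dw ws \<phi> p) = (LBINT p. u p * Dw ws \<phi> p)"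
    "integral\<^sup>L (lebesgue_on (Omega l)) (\<lambda>p. g p * \<phi> p) = (LBINT p. g p * \<phi> p)"
    if t: "test_fun (Omega l) \<phi>" for \<phi>
  proof -
    note t' = test_fun_Dw[OF t, of ws]
    show "integral\<^sup>L (lebesgue_on (Omega l)) (\<lambda>p. u p * Dw ws \<phi> p) = (LBINT p. u p * Dw ws \<phi> p)"
      using test_fun_outside[OF t'] by (intro integral_lebesgue_on_Omega borel_mult_test_fun[OF assms(1) t']) auto
    have [measurable]: "g \<in> borel_measurable borel" "\<phi> \<in> borel_measurable borel"
      using assms(2) test_fun_borel[OF t] by (auto simp: sq_def)
    show "integral\<^sup>L (lebesgue_on (Omega l)) (\<lambda>p. g p * \<phi> p) = (LBINT p. g p * \<phi> p)"
      using assms(2) by (intro integral_lebesgue_on_Omega) (auto simp: sq_def)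
  qed
  thus ?thesis using sq_L2[OF assms(2)] by (auto simp: weak_deriv_def)
qed

section \<open>Mixed weak derivatives and uniqueness\<close>

lemma
  fixes f :: "real \<times> real \<Rightarrow> real"
  assumes f: "integrable lborel f"
  shows integral_iter_xy: "(LBINT x. LBINT y. f (x, y)) = integral\<^sup>L lborel f"
    and integral_iter_yx: "(LBINT y. LBINT x. f (x, y)) = integral\<^sup>L lborel f"
    and integrable_iter_xy: "integrable lborel (\<lambda>x. LBINT y. f (x, y))"
    and integrable_iter_yx: "integrable lborel (\<lambda>y. LBINT x. f (x, y))"
    and AE_integrable_slice_x: "AE y in lborel. integrable lborel (\<lambda>x. f (x, y))"
    and AE_integrable_slice_y: "AE x in lborel. integrable lborel (\<lambda>y. f (x, y))"
proof -
  have f': "integrable (lborel \<Otimes>\<^sub>M lborel) f" using f by (simp add: lborel_prod)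
  hence f'': "integrable (lborel \<Otimes>\<^sub>M lborel) (case_prod (\<lambda>x y. f (x, y)))" by simp
  show "(LBINT x. LBINT y. f (x, y)) = integral\<^sup>L lborel f"
    using lborel_pair.integral_fst'[OF f'] by (simp add: lborel_prod)
  show "(LBINT y. LBINT x. f (x, y)) = integral\<^sup>L lborel f"
    using lborel_pair.integral_snd[OF f''] by (simp add: lborel_prod)
  show "integrable lborel (\<lambda>x. LBINT y. f (x, y))"
    using lborel_pair.integrable_fst'[OF f'] .
  show "integrable lborel (\<lambda>y. LBINT x. f (x, y))"
    using lborel_pair.integrable_snd[OF f''] .
  show "AE y in lborel. integrable lborel (\<lambda>x. f (x, y))"
    using lborel_pair.AE_integrable_snd[OF f''] .
  show "AE x in lborel. integrable lborel (\<lambda>y. f (x, y))"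
    using lborel_pair.AE_integrable_fst'[OF f'] .
qed

text \<open>Fubini over the half plane s <= x with a bounded weight in t. The weight will be a test
  function, the constant 1, or the kernel of the oscillation.\<close>

lemma prim_kernel_swap:
  fixes g :: "real \<times> real \<Rightarrow> real"
  assumes g: "integrable lborel g" and k[measurable]: "\<kappa> \<in> borel_measurable borel" and kb: "\<And>t. \<bar>\<kappa> t\<bar> \<le> B"
  shows "(LBINT t. prim (\<lambda>s. g (s, t)) x * \<kappa> t) = prim (\<lambda>s. LBINT t. g (s, t) * \<kappa> t) x"
    and "\<bar>prim (\<lambda>s. LBINT t. g (s, t) * \<kappa> t) x\<bar> \<le> B * (LBINT p. \<bar>g p\<bar>)"
    and "integrable lborel (\<lambda>t. prim (\<lambda>s. g (s, t)) x * \<kappa> t)"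
    and "integrable lborel (\<lambda>s. LBINT t. g (s, t) * \<kappa> t)"
proof -
  let ?f = "\<lambda>p. g p * (indicator ({..x} \<times> UNIV) p * \<kappa> (snd p))"
  have bd: "\<bar>indicator ({..x} \<times> UNIV) p * \<kappa> (snd p)\<bar> \<le> B" for p :: "real \<times> real"
    using kb[of "snd p"] abs_ge_zero[of "\<kappa> (snd p)"] by (auto simp: indicator_def)
  have m[measurable]: "(\<lambda>p. indicator ({..x} \<times> UNIV) p * \<kappa> (snd p)) \<in> borel_measurable (borel :: (real \<times> real) measure)"
  proof -
    have "{..x} \<times> (UNIV::real set) \<in> sets borel" by (intro borel_closed closed_Times) auto
    moreover have "snd \<in> borel_measurable (borel :: (real \<times> real) measure)"
      by (intro borel_measurable_continuous_onI continuous_intros)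
    ultimately show ?thesis by measurable
  qed
  have i: "integrable lborel ?f"
    using bd m by (intro integrable_mult_bounded(1)[OF g]) auto
  have i2: "integrable lborel (\<lambda>p. g p * \<kappa> (snd p))"
  proof -
    have "snd \<in> borel_measurable (borel :: (real \<times> real) measure)"
      by (intro borel_measurable_continuous_onI continuous_intros)
    thus ?thesis using kb by (intro integrable_mult_bounded(1)[OF g]) auto
  qed
  have 1: "(LBINT s. ?f (s, t)) = prim (\<lambda>s. g (s, t)) x * \<kappa> t" for t
  proof -
    have "?f (s, t) = indicator {..x} s * g (s, t) * \<kappa> t" for s by (simp add: indicator_def)
    thus ?thesis by (simp only: prim_def integral_mult_left_zero)
  qed
  have 2: "(LBINT t. ?f (s, t)) = indicator {..x} s * (LBINT t. g (s, t) * \<kappa> t)" for s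
  proof -
    have "?f (s, t) = indicator {..x} s * (g (s, t) * \<kappa> t)" for t by (simp add: indicator_def)
    thus ?thesis by (simp only: integral_mult_right_zero)
  qed
  show "(LBINT t. prim (\<lambda>s. g (s, t)) x * \<kappa> t) = prim (\<lambda>s. LBINT t. g (s, t) * \<kappa> t) x"
    using integral_iter_xy[OF i] integral_iter_yx[OF i] unfolding 1 2 by (simp add: prim_def)
  show "integrable lborel (\<lambda>t. prim (\<lambda>s. g (s, t)) x * \<kappa> t)"
    using integrable_iter_yx[OF i] unfolding 1 .
  show "integrable lborel (\<lambda>s. LBINT t. g (s, t) * \<kappa> t)"
    using integrable_iter_xy[OF i2] by simp
  have "prim (\<lambda>s. LBINT t. g (s, t) * \<kappa> t) x = (LBINT p. ?f p)"
    using integral_iter_xy[OF i] unfolding 2 by (simp add: prim_def)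
  also have "\<bar>\<dots>\<bar> \<le> (LBINT p. \<bar>?f p\<bar>)" by (rule integral_abs_bound)
  also have "\<dots> \<le> (LBINT p. B * \<bar>g p\<bar>)"
  proof (rule integral_mono)
    fix p show "\<bar>?f p\<bar> \<le> B * \<bar>g p\<bar>"
      using mult_right_mono[OF bd[of p], of "\<bar>g p\<bar>"] by (simp add: abs_mult mult_ac)
  qed (use i g in auto)
  finally show "\<bar>prim (\<lambda>s. LBINT t. g (s, t) * \<kappa> t) x\<bar> \<le> B * (LBINT p. \<bar>g p\<bar>)" by simp
qed

lemma integral_eq_HK:
  fixes f :: "real \<Rightarrow> real"
  assumes "continuous_on {a..b} f" "\<And>x. x \<notin> {a..b} \<Longrightarrow> f x = 0"
  shows "integral\<^sup>L lborel f = integral {a..b} f"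
proof -
  have "set_integrable lborel {a..b} f" using assms by (intro borel_integrable_atLeastAtMost')
  hence "(LINT x:{a..b}|lborel. f x) = integral {a..b} f" by (rule set_borel_integral_eq_integral)
  moreover have "indicator {a..b} x *\<^sub>R f x = f x" for x using assms(2)[of x] by (cases "x \<in> {a..b}") simp_all
  ultimately show ?thesis by (simp only: set_lebesgue_integral_def)
qed

lemma continuous_on_slice:
  assumes "continuous_on (Omegabar l) u"
  shows "x \<in> {0..pi} \<Longrightarrow> continuous_on {-l..l} (\<lambda>y. u (x, y))"
    and "y \<in> {-l..l} \<Longrightarrow> continuous_on {0..pi} (\<lambda>x. u (x, y))"
  by (rule continuous_on_compose2[OF assms], (auto simp: Omegabar_def intro!: continuous_intros)[2])+

text \<open>The one-dimensional increment lemmas ask for a continuous function; this supplies it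
  when \<open>u\<close> is tested in \<open>y\<close> only.\<close>

lemma continuous_on_partial_integral:
  assumes u: "continuous_on (Omegabar l) u" and t: "test1 (-l) l \<theta>"
  shows "continuous_on {0..pi} (\<lambda>x. LBINT y. u (x, y) * \<theta> y)"
proof -
  have "continuous_on {0..pi} (\<lambda>x. integral (cbox (-l) l) (\<lambda>y. u (x, y) * \<theta> y))"
  proof (rule integral_continuous_on_param)
    have "continuous_on ({0..pi} \<times> cbox (-l) l) (\<lambda>p. u p * \<theta> (snd p))"
      using u unfolding Omegabar_def
      by (intro continuous_intros continuous_on_compose2[OF test1_continuous[OF t, of UNIV]]) auto
    thus "continuous_on ({0..pi} \<times> cbox (-l) l) (\<lambda>(x, y). u (x, y) * \<theta> y)"
      by (simp add: case_prod_beta)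
  qed
  moreover have "(LBINT y. u (x, y) * \<theta> y) = integral (cbox (-l) l) (\<lambda>y. u (x, y) * \<theta> y)"
    if "x \<in> {0..pi}" for x
    using continuous_on_slice(1)[OF u that] test1_continuous[OF t] test1_outside[OF t]
    by (subst integral_eq_HK[of "-l" l]) (auto intro!: continuous_intros)
  ultimately show ?thesis by (subst continuous_on_cong[OF refl]) simp_all
qed

lemma sq_test1_integral:
  assumes "sq l g" "test1 0 pi \<phi>" "test1 (-l) l \<theta>"
  shows "(LBINT p. g p * (\<phi> (fst p) * \<theta> (snd p))) = (LBINT x. (LBINT y. g (x, y) * \<theta> y) * \<phi> x)"
    and "integrable lborel (\<lambda>x. LBINT y. g (x, y) * \<theta> y)"
proof -
  obtain B where B: "\<And>x. \<bar>\<phi> x * \<theta> y\<bar> \<le> B" for y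
  proof -
    obtain B1 B2 where "\<And>x. \<bar>\<phi> x\<bar> \<le> B1" "\<And>x. \<bar>\<theta> x\<bar> \<le> B2"
      by (rule test1_bounded[OF assms(2)], rule test1_bounded[OF assms(3)]) blast
    hence "\<bar>\<phi> x * \<theta> y\<bar> \<le> B1 * B2" for x y
      unfolding abs_mult by (meson abs_ge_zero mult_mono order_trans)
    thus thesis by (rule that)
  qed
  have "(\<lambda>p. \<phi> (fst p) * \<theta> (snd p)) \<in> borel_measurable borel"
    using test_fun_borel[OF test_fun_tensor[OF assms(2,3)]] .
  hence i: "integrable lborel (\<lambda>p. g p * (\<phi> (fst p) * \<theta> (snd p)))"
    using B by (intro integrable_mult_bounded(1)[OF sq_integrable[OF assms(1)], where B=B]) auto
  have "(LBINT y. g (x, y) * (\<phi> x * \<theta> y)) = (LBINT y. g (x, y) * \<theta> y) * \<phi> x" for x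
    by (simp add: mult.left_commute[of _ "\<phi> x"] mult.commute)
  thus "(LBINT p. g p * (\<phi> (fst p) * \<theta> (snd p))) = (LBINT x. (LBINT y. g (x, y) * \<theta> y) * \<phi> x)"
    using integral_iter_xy[OF i] by simp
  obtain B2 where "\<And>x. \<bar>\<theta> x\<bar> \<le> B2" using test1_bounded[OF assms(3)] by metis
  from prim_kernel_swap(4)[OF sq_integrable[OF assms(1)] test1_borel[OF assms(3)] this]
  show "integrable lborel (\<lambda>x. LBINT y. g (x, y) * \<theta> y)" .
qed

lemma cont_test1_integral:
  assumes "continuous_on (Omegabar l) u" "test1 0 pi \<phi>" "test1 (-l) l \<theta>"
  shows "(LBINT p. u p * (\<phi> (fst p) * \<theta> (snd p))) = (LBINT x. (LBINT y. u (x, y) * \<theta> y) * \<phi> x)"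
proof -
  have i: "integrable lborel (\<lambda>p. u p * (\<phi> (fst p) * \<theta> (snd p)))"
    by (intro integrable_mult_test_fun[OF assms(1)] assms test_fun_tensor)
  have "(LBINT y. u (x, y) * (\<phi> x * \<theta> y)) = (LBINT y. u (x, y) * \<theta> y) * \<phi> x" for x
    by (simp add: mult.left_commute[of _ "\<phi> x"] mult.commute)
  thus ?thesis using integral_iter_xy[OF i] by simp
qed

lemma prim_Icc:
  assumes "\<And>s. s \<le> a \<Longrightarrow> g s = 0"
  shows "(LBINT s. indicator {a..x} s * g s) = prim g x"
  unfolding prim_def by (rule Bochner_Integration.integral_cong) (use assms in \<open>auto simp: indicator_def\<close>)

text \<open>The one-dimensional increment lemma is used twice. With \<open>\<theta>\<close> fixed it
  turns the weak identity into an increment in \<open>x\<close>. As a statement about all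
  \<open>\<theta>\<close>, that increment is again a weak identity, now in \<open>y\<close>, for the
  function \<open>u (x, t) - u (0, t)\<close>.\<close>

lemma mixed_increment:
  assumes l: "l > 0" and u: "continuous_on (Omegabar l) u" and g: "sq l g"
    and T: "\<And>\<phi> \<theta>. test1 0 pi \<phi> \<Longrightarrow> test1 (-l) l \<theta> \<Longrightarrow>
      (LBINT p. u p * (deriv \<phi> (fst p) * deriv \<theta> (snd p))) = (LBINT p. g p * (\<phi> (fst p) * \<theta> (snd p)))"
    and x: "x \<in> {0..pi}" and y: "y \<in> {-l..l}"
  shows "u (x, y) - u (0, y) - (u (x, -l) - u (0, -l)) = prim (\<lambda>t. prim (\<lambda>s. g (s, t)) x) y"
proof -
  have gz: "g (s, t) = 0" if "s \<le> 0 \<or> t \<le> -l" for s t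
  proof -
    have "(s, t) \<notin> Omega l" using that by (auto simp: Omega_def)
    thus ?thesis using g unfolding sq_def by blast
  qed
  define k where "k t = prim (\<lambda>s. g (s, t)) x" for t
  have kz: "k t = 0" if "t \<le> -l" for t using gz that by (simp add: k_def prim_def)
  have ki: "integrable lborel k"
    using prim_kernel_swap(3)[OF sq_integrable[OF g], of "\<lambda>_. 1" 1 x] by (simp add: k_def[abs_def])
  have main: "(LBINT t. (u (x, t) - u (0, t)) * deriv \<theta> t) = - (LBINT t. k t * \<theta> t)"
    if \<theta>: "test1 (-l) l \<theta>" for \<theta>
  proof -
    define c where "c x = (LBINT y. u (x, y) * deriv \<theta> y)" for x
    \<comment> \<open>The weak derivative of \<open>c\<close>; the minus sign arises since both
      integrations by parts are already contained in the hypothesis on \<open>g\<close>.\<close>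
    define h where "h x = - (LBINT y. g (x, y) * \<theta> y)" for x
    have \<theta>': "test1 (-l) l (deriv \<theta>)" by (rule test1_deriv[OF \<theta>])
    have "test1 0 pi \<phi> \<Longrightarrow> (LBINT x. c x * deriv \<phi> x) = - (LBINT x. h x * \<phi> x)" for \<phi>
      using T[of \<phi> \<theta>] \<theta> cont_test1_integral[OF u test1_deriv \<theta>', of \<phi>] sq_test1_integral(1)[OF g _ \<theta>, of \<phi>]
      by (simp add: c_def h_def)
    moreover have "continuous_on {0..pi} c"
      unfolding c_def by (rule continuous_on_partial_integral[OF u \<theta>'])
    moreover obtain \<phi>0 where "test1 0 pi \<phi>0" using test1_bump_exists[of 0 pi] pi_gt_zero by blast
    hence "integrable lborel h"
      unfolding h_def using sq_test1_integral(2)[OF g _ \<theta>] by simp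
    ultimately have "c x - c 0 = (LBINT s. indicator {0..x} s * h s)"
      using x by (intro weak_derivative_imp_increment[of 0 pi]) auto
    also have "\<dots> = prim h x" using gz by (intro prim_Icc) (simp add: h_def)
    also have "\<dots> = - prim (\<lambda>s. LBINT t. g (s, t) * \<theta> t) x" by (simp add: h_def prim_def)
    also have "\<dots> = - (LBINT t. k t * \<theta> t)"
    proof -
      obtain B where "\<And>x. \<bar>\<theta> x\<bar> \<le> B" using test1_bounded[OF \<theta>] by metis
      from prim_kernel_swap(1)[OF sq_integrable[OF g] test1_borel[OF \<theta>] this] show ?thesis by (simp add: k_def)
    qed
    finally have "c x - c 0 = - (LBINT t. k t * \<theta> t)" .
    moreover have "integrable lborel (\<lambda>t. u (x', t) * deriv \<theta> t)" if "x' \<in> {0..pi}" for x'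
      using integrable_cont_test1[OF continuous_on_slice(1)[OF u that] \<theta>'] .
    from this[of x] this[of 0] have "c x - c 0 = (LBINT t. (u (x, t) - u (0, t)) * deriv \<theta> t)"
      using x by (simp add: c_def left_diff_distrib)
    ultimately show ?thesis by simp
  qed
  have "(u (x, y) - u (0, y)) - (u (x, -l) - u (0, -l)) = (LBINT t. indicator {-l..y} t * k t)"
    using y x continuous_on_slice(1)[OF u, of x] continuous_on_slice(1)[OF u, of 0]
    by (intro weak_derivative_imp_increment[OF _ ki main]) (auto intro!: continuous_intros)
  also have "\<dots> = prim k y" by (intro prim_Icc) (rule kz)
  finally show ?thesis by (simp add: k_def[abs_def])
qed

lemma atMost_prod: "{..(x, y)} = {..x} \<times> {..y::real}" for x :: real
  by (auto simp: less_eq_prod_def)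

text \<open>With \<open>u = 0\<close> the increment formula says that \<open>g\<close> has integral
  zero over every lower left quadrant. Quadrants are stable under intersection and generate the
  Borel sets, so all Borel sets have integral zero and \<open>g\<close> vanishes almost
  everywhere.\<close>

lemma sq_AE_zero:
  assumes l: "l > 0" and g: "sq l g"
    and T: "\<And>\<phi> \<theta>. test1 0 pi \<phi> \<Longrightarrow> test1 (-l) l \<theta> \<Longrightarrow> (LBINT p. g p * (\<phi> (fst p) * \<theta> (snd p))) = 0"
  shows "AE p in lborel. g p = 0"
proof -
  have gz: "g (s, t) = 0" if "s \<le> 0 \<or> t \<le> -l \<or> s \<ge> pi \<or> t \<ge> l" for s t
  proof -
    have "(s, t) \<notin> Omega l" using that by (auto simp: Omega_def)
    thus ?thesis using g unfolding sq_def by blast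
  qed
  note gi = sq_integrable[OF g]
  have [measurable]: "g \<in> borel_measurable borel" using g by (simp add: sq_def)
  have pp: "prim (\<lambda>t. prim (\<lambda>s. g (s, t)) x) y = 0" for x y
  proof -
    \<comment> \<open>\<open>mixed_increment\<close> covers points of the closed rectangle only.
      Clamping the corner to it leaves the integral unchanged, as \<open>g\<close> vanishes
      outside.\<close>
    define x' where "x' = max 0 (min pi x)"
    define y' where "y' = max (-l) (min l y)"
    have px: "prim (\<lambda>s. g (s, t)) x = prim (\<lambda>s. g (s, t)) x'" for t
    proof -
      have "indicator {..x} s * g (s, t) = indicator {..x'} s * g (s, t)" for s
      proof (cases "s \<le> 0 \<or> s \<ge> pi")
        case False
        hence "s \<le> x \<longleftrightarrow> s \<le> x'" by (auto simp: x'_def)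
        thus ?thesis by (simp add: indicator_def)
      qed (use gz in auto)
      thus ?thesis by (simp only: prim_def)
    qed
    have pz: "prim (\<lambda>s. g (s, t)) x' = 0" if "t \<le> -l \<or> t \<ge> l" for t
    proof -
      have "g (s, t) = 0" for s using gz that by blast
      thus ?thesis by (simp add: prim_def)
    qed
    have "prim (\<lambda>t. prim (\<lambda>s. g (s, t)) x') y = prim (\<lambda>t. prim (\<lambda>s. g (s, t)) x') y'"
    proof -
      have "indicator {..y} t * prim (\<lambda>s. g (s, t)) x' = indicator {..y'} t * prim (\<lambda>s. g (s, t)) x'" for t
      proof (cases "t \<le> -l \<or> t \<ge> l")
        case False
        hence "t \<le> y \<longleftrightarrow> t \<le> y'" by (auto simp: y'_def)
        thus ?thesis by (simp add: indicator_def)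
      qed (use pz in auto)
      thus ?thesis by (simp only: prim_def[of _ y] prim_def[of _ y'])
    qed
    also have "\<dots> = 0"
      using mixed_increment[OF l _ g, of "\<lambda>_. 0" x' y'] T l by (auto simp: x'_def y'_def)
    finally show ?thesis by (simp add: px)
  qed
  have atm: "(LBINT p. indicator {..z} p * g p) = 0" for z
  proof -
    obtain x y where z: "z = (x, y)" by force
    have i: "integrable lborel (\<lambda>p. indicator {..z} p * g p)"
      using integrable_mult_indicator[OF _ gi, of "{..z}"] by simp
    have "(LBINT s. indicator {..z} (s, t) * g (s, t)) = indicator {..y} t * prim (\<lambda>s. g (s, t)) x" for t
    proof -
      have "indicator {..z} (s, t) * g (s, t) = indicator {..y} t * (indicator {..x} s * g (s, t))" for s
        by (auto simp: z atMost_prod indicator_def)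
      thus ?thesis by (simp only: prim_def integral_mult_right_zero)
    qed
    thus ?thesis using integral_iter_yx[OF i] pp[of x y] by (simp add: prim_def)
  qed
  define P where "P A \<longleftrightarrow> A \<in> sets borel \<and> (LBINT p. indicator A p * g p) = 0" for A :: "(real \<times> real) set"
  have bor: "sets borel = sigma_sets UNIV (range (\<lambda>a::real \<times> real. {..a}))"
    by (subst borel_eq_atMost) simp
  have Pall: "P A" if "A \<in> sigma_sets UNIV (range (\<lambda>a::real \<times> real. {..a}))" for A
  proof (rule sigma_sets_induct_disjoint[OF _ _ that])
    show "Int_stable (range (\<lambda>a::real \<times> real. {..a}))"
    proof (rule Int_stableI_image)
      fix a b :: "real \<times> real"
      have "{..a} \<inter> {..b} = {..inf a b}" by auto
      thus "\<exists>c\<in>UNIV. {..a} \<inter> {..b} = {..c}" by blast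
    qed
    show "P A" if "A \<in> range (\<lambda>a::real \<times> real. {..a})" for A
      using that atm by (auto simp: P_def)
    show "P {}" by (simp add: P_def)
    show "P (UNIV - A)" if "A \<in> sigma_sets UNIV (range (\<lambda>a::real \<times> real. {..a}))" "P A" for A
    proof -
      have A: "A \<in> sets borel" "(LBINT p. indicator A p * g p) = 0" using that by (auto simp: P_def)
      have i: "integrable lborel (\<lambda>p. indicator A p * g p)"
        using integrable_mult_indicator[OF _ gi, of A] A by simp
      \<comment> \<open>Complements require the total integral, which is the quadrant at the upper
        right corner of the rectangle.\<close>
      have all: "(LBINT p. g p) = 0"
      proof -
        have "indicator {..(pi, l)} p * g p = g p" for p
        proof (cases "p \<in> {..(pi, l)}")
          case False
          hence "fst p \<ge> pi \<or> snd p \<ge> l" by (cases p) auto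
          thus ?thesis using gz[of "fst p" "snd p"] by auto
        qed simp
        thus ?thesis using atm[of "(pi, l)"] by (simp only:)
      qed
      have "indicator (UNIV - A) p * g p = g p - indicator A p * g p" for p by (simp add: indicator_def)
      hence "(LBINT p. indicator (UNIV - A) p * g p) = (LBINT p. g p) - (LBINT p. indicator A p * g p)"
        using i gi by simp
      with A all show ?thesis by (auto simp: P_def)
    qed
    show "P (\<Union>i. A i)" if d: "disjoint_family A" and "range A \<subseteq> sigma_sets UNIV (range (\<lambda>a::real \<times> real. {..a}))"
      and PA: "\<And>i. P (A i)" for A :: "nat \<Rightarrow> _"
    proof -
      have m: "A i \<in> sets borel" for i using PA by (simp add: P_def)
      hence mU: "(\<Union>i. A i) \<in> sets borel" by auto
      have "(LINT p:(\<Union>i. A i)|lborel. g p) = (\<Sum>i. (LINT p:(A i)|lborel. g p))"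
        using d m integrable_mult_indicator[OF _ gi, of "\<Union>i. A i"] mU
        by (intro lebesgue_integral_countable_add) (auto simp: disjoint_family_on_def set_integrable_def)
      with PA mU show ?thesis by (auto simp: P_def set_lebesgue_integral_def)
    qed
  qed auto
  show ?thesis
  proof (rule sigma_finite_measure.density_zero[OF sigma_finite_lborel gi])
    fix A :: "(real \<times> real) set" assume "A \<in> sets lborel"
    hence "P A" using Pall bor by auto
    thus "set_lebesgue_integral lborel A g = 0" by (simp add: P_def set_lebesgue_integral_def)
  qed
qed

text \<open>Makes the Hilbert choice in \<open>wd\<close> harmless: integrals such as
  \<open>inner_H2star\<close> depend only on the class modulo null sets. Two candidates have the
  same pairing with every test function, hence their difference falls under
  \<open>sq_AE_zero\<close>.\<close>

lemma weak_deriv_unique: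
  assumes l: "l > 0" and g: "weak_deriv (Omega l) ws u g" and h: "weak_deriv (Omega l) ws u h"
  shows "AE p in lebesgue_on (Omega l). g p = h p"
proof -
  obtain g' where g': "sq l g'" "weak_deriv (Omega l) ws u g'" "AE p in lebesgue_on (Omega l). g p = g' p"
    using weak_deriv_ex_sq[OF g] .
  obtain h' where h': "sq l h'" "weak_deriv (Omega l) ws u h'" "AE p in lebesgue_on (Omega l). h p = h' p"
    using weak_deriv_ex_sq[OF h] .
  have [measurable]: "g' \<in> borel_measurable borel" "h' \<in> borel_measurable borel" using g' h' by (auto simp: sq_def)
  have d: "sq l (\<lambda>p. g' p - h' p)"
    unfolding sq_def
  proof (intro conjI allI impI)
    show "integrable lborel (\<lambda>p. (g' p - h' p)\<^sup>2)"
    proof (rule Bochner_Integration.integrable_bound)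
      show "integrable lborel (\<lambda>p. 2 * (g' p)\<^sup>2 + 2 * (h' p)\<^sup>2)" using g' h' by (auto simp: sq_def)
      have "(a - b)\<^sup>2 \<le> 2 * a\<^sup>2 + 2 * b\<^sup>2" for a b :: real
      proof -
        have "0 \<le> (a + b)\<^sup>2" by simp
        thus ?thesis by (simp add: power2_eq_square algebra_simps)
      qed
      thus "AE p in lborel. norm ((g' p - h' p)\<^sup>2) \<le> norm (2 * (g' p)\<^sup>2 + 2 * (h' p)\<^sup>2)" by simp
    qed measurable
  qed (use g' h' in \<open>auto simp: sq_def\<close>)
  have "AE p in lborel. g' p - h' p = 0"
  proof (rule sq_AE_zero[OF l d])
    fix \<phi> \<theta> assume t: "test1 0 pi \<phi>" "test1 (-l) l \<theta>"
    let ?t = "\<lambda>p. \<phi> (fst p) * \<theta> (snd p)"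
    have tf: "test_fun (Omega l) ?t" by (rule test_fun_tensor[OF t])
    have e: "integral\<^sup>L (lebesgue_on (Omega l)) (\<lambda>p. g' p * ?t p) = integral\<^sup>L (lebesgue_on (Omega l)) (\<lambda>p. h' p * ?t p)"
    proof -
      have "(-1) ^ length ws * integral\<^sup>L (lebesgue_on (Omega l)) (\<lambda>p. g' p * ?t p)
        = (-1) ^ length ws * integral\<^sup>L (lebesgue_on (Omega l)) (\<lambda>p. h' p * ?t p)"
        using g'(2) h'(2) tf unfolding weak_deriv_def by presburger
      thus ?thesis by simp
    qed
    have [measurable]: "?t \<in> borel_measurable borel" by (rule test_fun_borel[OF tf])
    obtain B where B: "\<And>x. \<bar>?t x\<bar> \<le> B" using test_fun_bounded[OF tf] by blast
    have "integrable lborel (\<lambda>p. g' p * ?t p)" "integrable lborel (\<lambda>p. h' p * ?t p)"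
      using B g' h' by (auto intro!: integrable_mult_bounded(1)[OF sq_integrable])
    moreover have "(LBINT p. g' p * ?t p) = (LBINT p. h' p * ?t p)"
    proof -
      have z: "g' p * ?t p = 0" "h' p * ?t p = 0" if "p \<notin> Omega l" for p
        using that test_fun_outside[OF tf] by simp_all
      have m: "(\<lambda>p. g' p * ?t p) \<in> borel_measurable borel" "(\<lambda>p. h' p * ?t p) \<in> borel_measurable borel"
        by measurable
      show ?thesis
        using e integral_lebesgue_on_Omega[OF m(1) z(1)] integral_lebesgue_on_Omega[OF m(2) z(2)] by simp
    qed
    ultimately show "(LBINT p. (g' p - h' p) * ?t p) = 0" by (simp add: left_diff_distrib)
  qed
  hence "AE p in lebesgue. g' p - h' p = 0" by (rule AE_completion)
  hence "AE p in lebesgue_on (Omega l). g' p = h' p"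
    using AE_restrict_space_iff[of "Omega l" lebesgue "\<lambda>p. g' p = h' p"] by auto
  with g'(3) h'(3) show ?thesis by eventually_elim simp
qed

section \<open>Recovering a function from its weak second derivatives\<close>

text \<open>Integration by parts along a line for a function that is a constant plus a primitive.
  The constant drops out because \<open>\<phi>'\<close> has integral zero.\<close>

lemma slice_ibp:
  assumes h: "integrable lborel h" and d: "\<And>x. (\<phi> has_real_derivative \<phi>' x) (at x)"
    and c: "continuous_on UNIV \<phi>'" and z: "\<And>x. x \<notin> {a<..<b} \<Longrightarrow> \<phi> x = 0" "\<And>x. x \<notin> {a<..<b} \<Longrightarrow> \<phi>' x = 0"
    and w: "\<And>x. x \<in> {a..b} \<Longrightarrow> w x = k + prim h x" and ab: "a \<le> b"
  shows "(LBINT x. w x * \<phi>' x) = - (LBINT x. h x * \<phi> x)"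
proof -
  have i: "integrable lborel \<phi>'"
    using c z by (intro integrable_cont_compact[of a b]) (auto elim: continuous_on_subset)
  have [measurable]: "h \<in> borel_measurable borel" using h borel_measurable_integrable by force
  have i2: "integrable lborel (\<lambda>x. prim h x * \<phi>' x)"
    using prim_bound[OF h] by (intro integrable_mult_bounded(2)[OF i]) auto
  have "(LBINT x. \<phi>' x * indicator {a..b} x) = \<phi> b - \<phi> a"
    using ab d c by (intro integral_FTC_Icc_real) (simp_all add: continuous_on_eq_continuous_at)
  moreover have "\<phi>' x * indicator {a..b} x = \<phi>' x" for x using z(2)[of x] by (cases "x \<in> {a..b}") auto
  ultimately have 0: "integral\<^sup>L lborel \<phi>' = 0" using z(1)[of a] z(1)[of b] by simp
  have "w x * \<phi>' x = k * \<phi>' x + prim h x * \<phi>' x" for x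
    using w[of x] z(2)[of x] by (cases "x \<in> {a..b}") (auto simp: distrib_right)
  hence "(LBINT x. w x * \<phi>' x) = (LBINT x. prim h x * \<phi>' x)"
    using i i2 0 by simp
  also have "\<dots> = - (LBINT x. h x * \<phi> x)"
    by (rule prim_ibp[OF h d c, of a b]) (use z in auto)
  finally show ?thesis .
qed

lemma test_fun_slice_y:
  assumes "test_fun (Omega l) \<phi>"
  shows "((\<lambda>y. \<phi> (x, y)) has_real_derivative pdy \<phi> (x, y)) (at y)"
    and "continuous_on UNIV (\<lambda>y. pdy \<phi> (x, y))"
    and "y \<notin> {-l<..<l} \<Longrightarrow> \<phi> (x, y) = 0" "y \<notin> {-l<..<l} \<Longrightarrow> pdy \<phi> (x, y) = 0"
proof -
  show "((\<lambda>y. \<phi> (x, y)) has_real_derivative pdy \<phi> (x, y)) (at y)"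
    by (intro differentiable_slice_y smooth2_differentiable test_fun_smooth2[OF assms])
  show "continuous_on UNIV (\<lambda>y. pdy \<phi> (x, y))"
    by (rule continuous_on_compose2[OF test_fun_continuous[OF test_fun_pdy[OF assms], of UNIV]])
      (auto intro!: continuous_intros)
  assume "y \<notin> {-l<..<l}"
  hence "(x, y) \<notin> Omega l" by (auto simp: Omega_def)
  thus "\<phi> (x, y) = 0" "pdy \<phi> (x, y) = 0"
    using test_fun_outside[OF assms] test_fun_outside[OF test_fun_pdy[OF assms]] by blast+
qed

lemma test_fun_slice_x:
  assumes "test_fun (Omega l) \<phi>"
  shows "((\<lambda>x. \<phi> (x, y)) has_real_derivative pdx \<phi> (x, y)) (at x)"
    and "continuous_on UNIV (\<lambda>x. pdx \<phi> (x, y))"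
    and "x \<notin> {0<..<pi} \<Longrightarrow> \<phi> (x, y) = 0" "x \<notin> {0<..<pi} \<Longrightarrow> pdx \<phi> (x, y) = 0"
proof -
  show "((\<lambda>x. \<phi> (x, y)) has_real_derivative pdx \<phi> (x, y)) (at x)"
    by (intro differentiable_slice_x smooth2_differentiable test_fun_smooth2[OF assms])
  show "continuous_on UNIV (\<lambda>x. pdx \<phi> (x, y))"
    by (rule continuous_on_compose2[OF test_fun_continuous[OF test_fun_pdx[OF assms], of UNIV]])
      (auto intro!: continuous_intros)
  assume "x \<notin> {0<..<pi}"
  hence "(x, y) \<notin> Omega l" by (auto simp: Omega_def)
  thus "\<phi> (x, y) = 0" "pdx \<phi> (x, y) = 0"
    using test_fun_outside[OF assms] test_fun_outside[OF test_fun_pdx[OF assms]] by blast+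
qed

lemma sq_mult_test_fun:
  assumes "sq l g" "test_fun (Omega l) \<phi>" shows "integrable lborel (\<lambda>p. g p * \<phi> p)"
proof -
  obtain B where "\<And>x. \<bar>\<phi> x\<bar> \<le> B" using test_fun_bounded[OF assms(2)] by blast
  thus ?thesis using test_fun_borel[OF assms(2)]
    by (intro integrable_mult_bounded(1)[OF sq_integrable[OF assms(1)]]) auto
qed

section \<open>Square integrability of functions built from slices\<close>

lemma borel_pair_comp:
  fixes g :: "real \<times> real \<Rightarrow> real"
  assumes "g \<in> borel_measurable borel" "f1 \<in> borel_measurable M" "f2 \<in> borel_measurable M"
  shows "(\<lambda>x. g (f1 x, f2 x)) \<in> borel_measurable M"
proof -
  have "g \<in> borel_measurable (borel \<Otimes>\<^sub>M borel)" using assms(1) by (simp add: borel_prod)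
  with assms(2,3) show ?thesis by measurable
qed

lemma sq_outside: "sq l g \<Longrightarrow> p \<notin> Omega l \<Longrightarrow> g p = 0"
  unfolding sq_def by blast

text \<open>Also true for non-integrable \<open>f\<close>, whose Bochner integral is 0. Bounds on
  slices therefore hold on every slice and not just on almost every one.\<close>

lemma ennreal_abs_integral_le: "ennreal \<bar>integral\<^sup>L M f\<bar> \<le> (\<integral>\<^sup>+x. ennreal \<bar>f x\<bar> \<partial>M)"
proof (cases "integrable M f")
  case True
  thus ?thesis using integral_norm_bound_ennreal[OF True] by simp
qed (simp add: not_integrable_integral_eq)

lemma nn_integral_iter:
  fixes f :: "real \<times> real \<Rightarrow> ennreal"
  assumes "f \<in> borel_measurable borel"
  shows "(\<integral>\<^sup>+x. \<integral>\<^sup>+y. f (x, y) \<partial>lborel \<partial>lborel) = (\<integral>\<^sup>+p. f p \<partial>lborel)"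
    and "(\<integral>\<^sup>+y. \<integral>\<^sup>+x. f (x, y) \<partial>lborel \<partial>lborel) = (\<integral>\<^sup>+p. f p \<partial>lborel)"
proof -
  have f: "f \<in> borel_measurable (lborel \<Otimes>\<^sub>M lborel)" using assms by (simp add: lborel_prod)
  show "(\<integral>\<^sup>+x. \<integral>\<^sup>+y. f (x, y) \<partial>lborel \<partial>lborel) = (\<integral>\<^sup>+p. f p \<partial>lborel)"
    using lborel.nn_integral_fst[OF f] by (simp add: lborel_prod)
  show "(\<integral>\<^sup>+y. \<integral>\<^sup>+x. f (x, y) \<partial>lborel \<partial>lborel) = (\<integral>\<^sup>+p. f p \<partial>lborel)"
    using lborel_pair.nn_integral_snd[OF f] by (simp add: lborel_prod)
qed

lemma sq_I_nn:
  assumes "g \<in> borel_measurable borel" "\<And>p. p \<notin> Omega l \<Longrightarrow> g p = 0" "(\<integral>\<^sup>+p. ennreal ((g p)\<^sup>2) \<partial>lborel) < \<infinity>"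
  shows "sq l g"
  unfolding sq_def using assms by (auto intro!: integrableI_bounded)

lemma sq_nn_finite: "sq l g \<Longrightarrow> (\<integral>\<^sup>+p. ennreal ((g p)\<^sup>2) \<partial>lborel) < \<infinity>"
  unfolding sq_def integrable_iff_bounded by simp

lemma nn_L1_le_L2:
  fixes f :: "real \<Rightarrow> real"
  assumes [measurable]: "f \<in> borel_measurable borel" and z: "\<And>x. x \<notin> {a..b} \<Longrightarrow> f x = 0" and ab: "a \<le> b"
  shows "(\<integral>\<^sup>+x. ennreal \<bar>f x\<bar> \<partial>lborel)\<^sup>2 \<le> ennreal (b - a) * (\<integral>\<^sup>+x. ennreal ((f x)\<^sup>2) \<partial>lborel)"
proof -
  have "(\<integral>\<^sup>+x. indicator {a..b} x * ennreal \<bar>f x\<bar> \<partial>lborel)\<^sup>2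
    \<le> (\<integral>\<^sup>+x. indicator {a..b} x ^ 2 \<partial>lborel) * (\<integral>\<^sup>+x. ennreal \<bar>f x\<bar> ^ 2 \<partial>lborel)"
    by (rule Cauchy_Schwarz_nn_integral) measurable
  moreover have "indicator {a..b} x * ennreal \<bar>f x\<bar> = ennreal \<bar>f x\<bar>" for x
    using z[of x] by (cases "x \<in> {a..b}") auto
  moreover have "(indicator {a..b} x :: ennreal) ^ 2 = indicator {a..b} x" for x
    by (simp add: indicator_def)
  moreover have "ennreal \<bar>f x\<bar> ^ 2 = ennreal ((f x)\<^sup>2)" for x by (simp add: ennreal_power)
  ultimately show ?thesis using ab by simp
qed

text \<open>Cauchy-Schwarz on each horizontal line bounds \<open>G^2\<close> by \<open>pi\<close>
  times the integral of \<open>g^2\<close> over that line. Integrating over the rectangle costs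
  another factor \<open>pi\<close>. This, with its vertical analogue, puts the recovered first
  derivatives into L2.\<close>

lemma sq_slice_x:
  assumes g: "sq l g" and G[measurable]: "G \<in> borel_measurable borel"
    and b: "\<And>x y. (x, y) \<in> Omega l \<Longrightarrow> ennreal \<bar>G (x, y)\<bar> \<le> (\<integral>\<^sup>+s. ennreal \<bar>g (s, y)\<bar> \<partial>lborel)"
  shows "sq l (\<lambda>p. indicator (Omega l) p * G p)"
proof (rule sq_I_nn)
  have gm: "g \<in> borel_measurable borel" using g by (simp add: sq_def)
  show m: "(\<lambda>p. indicator (Omega l) p * G p) \<in> borel_measurable borel" by measurable
  have "(\<integral>\<^sup>+p. ennreal ((indicator (Omega l) p * G p)\<^sup>2) \<partial>lborel)
      = (\<integral>\<^sup>+y. \<integral>\<^sup>+x. ennreal ((indicator (Omega l) (x, y) * G (x, y))\<^sup>2) \<partial>lborel \<partial>lborel)"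
    by (subst nn_integral_iter(2)) (use m in measurable)
  also have "\<dots> \<le> (\<integral>\<^sup>+y. \<integral>\<^sup>+x. indicator {0..pi} x * (ennreal pi * (\<integral>\<^sup>+s. ennreal ((g (s, y))\<^sup>2) \<partial>lborel)) \<partial>lborel \<partial>lborel)"
  proof (intro nn_integral_mono)
    fix x y :: real
    show "ennreal ((indicator (Omega l) (x, y) * G (x, y))\<^sup>2)
       \<le> indicator {0..pi} x * (ennreal pi * (\<integral>\<^sup>+s. ennreal ((g (s, y))\<^sup>2) \<partial>lborel))"
    proof (cases "(x, y) \<in> Omega l")
      case True
      have "ennreal ((G (x, y))\<^sup>2) = (ennreal \<bar>G (x, y)\<bar>)\<^sup>2" by (simp add: ennreal_power)
      also have "\<dots> \<le> (\<integral>\<^sup>+s. ennreal \<bar>g (s, y)\<bar> \<partial>lborel)\<^sup>2" using b[OF True] by (intro power_mono) auto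
      also have "\<dots> \<le> ennreal (pi - 0) * (\<integral>\<^sup>+s. ennreal ((g (s, y))\<^sup>2) \<partial>lborel)"
      proof (rule nn_L1_le_L2)
        show "(\<lambda>s. g (s, y)) \<in> borel_measurable borel" by (rule borel_pair_comp[OF gm]) auto
        show "x \<notin> {0..pi} \<Longrightarrow> g (x, y) = 0" for x by (rule sq_outside[OF g]) (auto simp: Omega_def)
      qed simp
      finally show ?thesis using True by (auto simp: Omega_def)
    qed simp
  qed
  also have "\<dots> = (\<integral>\<^sup>+y. ennreal pi * (ennreal pi * (\<integral>\<^sup>+s. ennreal ((g (s, y))\<^sup>2) \<partial>lborel)) \<partial>lborel)"
    by (simp add: nn_integral_multc)
  also have "\<dots> = ennreal pi * (ennreal pi * (\<integral>\<^sup>+y. \<integral>\<^sup>+s. ennreal ((g (s, y))\<^sup>2) \<partial>lborel \<partial>lborel))"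
  proof -
    have "(\<lambda>(y, s). ennreal ((g (s, y))\<^sup>2)) \<in> borel_measurable (lborel \<Otimes>\<^sub>M lborel)"
      unfolding case_prod_beta by (intro measurable_compose[OF _ measurable_ennreal] borel_measurable_power borel_pair_comp[OF gm]) auto
    from lborel.borel_measurable_nn_integral_fst[OF this]
    have "(\<lambda>y. \<integral>\<^sup>+s. ennreal ((g (s, y))\<^sup>2) \<partial>lborel) \<in> borel_measurable lborel" by simp
    thus ?thesis by (simp add: nn_integral_cmult)
  qed
  also have "(\<integral>\<^sup>+y. \<integral>\<^sup>+s. ennreal ((g (s, y))\<^sup>2) \<partial>lborel \<partial>lborel) = (\<integral>\<^sup>+p. ennreal ((g p)\<^sup>2) \<partial>lborel)"
    by (subst nn_integral_iter(2)) (use gm in measurable)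
  finally show "(\<integral>\<^sup>+p. ennreal ((indicator (Omega l) p * G p)\<^sup>2) \<partial>lborel) < \<infinity>"
    using sq_nn_finite[OF g] by (auto simp: ennreal_mult_less_top intro: order_le_less_trans)
qed auto

lemma sq_slice_y:
  assumes g: "sq l g" and G[measurable]: "G \<in> borel_measurable borel" and l: "l > 0"
    and b: "\<And>x y. (x, y) \<in> Omega l \<Longrightarrow> ennreal \<bar>G (x, y)\<bar> \<le> (\<integral>\<^sup>+t. ennreal \<bar>g (x, t)\<bar> \<partial>lborel)"
  shows "sq l (\<lambda>p. indicator (Omega l) p * G p)"
proof (rule sq_I_nn)
  have gm: "g \<in> borel_measurable borel" using g by (simp add: sq_def)
  show m: "(\<lambda>p. indicator (Omega l) p * G p) \<in> borel_measurable borel" by measurable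
  have "(\<integral>\<^sup>+p. ennreal ((indicator (Omega l) p * G p)\<^sup>2) \<partial>lborel)
      = (\<integral>\<^sup>+x. \<integral>\<^sup>+y. ennreal ((indicator (Omega l) (x, y) * G (x, y))\<^sup>2) \<partial>lborel \<partial>lborel)"
    by (subst nn_integral_iter(1)) (use m in measurable)
  also have "\<dots> \<le> (\<integral>\<^sup>+x. \<integral>\<^sup>+y. indicator {-l..l} y * (ennreal (l - -l) * (\<integral>\<^sup>+t. ennreal ((g (x, t))\<^sup>2) \<partial>lborel)) \<partial>lborel \<partial>lborel)"
  proof (intro nn_integral_mono)
    fix x y :: real
    show "ennreal ((indicator (Omega l) (x, y) * G (x, y))\<^sup>2)
       \<le> indicator {-l..l} y * (ennreal (l - -l) * (\<integral>\<^sup>+t. ennreal ((g (x, t))\<^sup>2) \<partial>lborel))"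
    proof (cases "(x, y) \<in> Omega l")
      case True
      have "ennreal ((G (x, y))\<^sup>2) = (ennreal \<bar>G (x, y)\<bar>)\<^sup>2" by (simp add: ennreal_power)
      also have "\<dots> \<le> (\<integral>\<^sup>+t. ennreal \<bar>g (x, t)\<bar> \<partial>lborel)\<^sup>2" using b[OF True] by (intro power_mono) auto
      also have "\<dots> \<le> ennreal (l - -l) * (\<integral>\<^sup>+t. ennreal ((g (x, t))\<^sup>2) \<partial>lborel)"
      proof (rule nn_L1_le_L2)
        show "(\<lambda>t. g (x, t)) \<in> borel_measurable borel" by (rule borel_pair_comp[OF gm]) auto
        show "t \<notin> {-l..l} \<Longrightarrow> g (x, t) = 0" for t by (rule sq_outside[OF g]) (auto simp: Omega_def)
      qed (use l in simp)
      finally show ?thesis using True by (auto simp: Omega_def)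
    qed simp
  qed
  also have "\<dots> = (\<integral>\<^sup>+x. ennreal (l - -l) * (ennreal (l - -l) * (\<integral>\<^sup>+t. ennreal ((g (x, t))\<^sup>2) \<partial>lborel)) \<partial>lborel)"
    using l by (simp add: nn_integral_multc)
  also have "\<dots> = ennreal (l - -l) * (ennreal (l - -l) * (\<integral>\<^sup>+x. \<integral>\<^sup>+t. ennreal ((g (x, t))\<^sup>2) \<partial>lborel \<partial>lborel))"
  proof -
    have "(\<lambda>(x, t). ennreal ((g (x, t))\<^sup>2)) \<in> borel_measurable (lborel \<Otimes>\<^sub>M lborel)"
      unfolding case_prod_beta by (intro measurable_compose[OF _ measurable_ennreal] borel_measurable_power borel_pair_comp[OF gm]) auto
    from lborel.borel_measurable_nn_integral_fst[OF this]
    have "(\<lambda>x. \<integral>\<^sup>+t. ennreal ((g (x, t))\<^sup>2) \<partial>lborel) \<in> borel_measurable lborel" by simp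
    thus ?thesis by (simp add: nn_integral_cmult)
  qed
  also have "(\<integral>\<^sup>+x. \<integral>\<^sup>+t. ennreal ((g (x, t))\<^sup>2) \<partial>lborel \<partial>lborel) = (\<integral>\<^sup>+p. ennreal ((g p)\<^sup>2) \<partial>lborel)"
    by (subst nn_integral_iter(1)) (use gm in measurable)
  finally show "(\<integral>\<^sup>+p. ennreal ((indicator (Omega l) p * G p)\<^sup>2) \<partial>lborel) < \<infinity>"
    using sq_nn_finite[OF g] by (auto simp: ennreal_mult_less_top intro: order_le_less_trans)
qed auto

text \<open>The coefficient makes differences the instance \<open>c = -1\<close>, and multiples the
  instance \<open>g = 0\<close>.\<close>

lemma sq_add: assumes "sq l g" "sq l h" shows "sq l (\<lambda>p. g p + c * h p)"
  unfolding sq_def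
proof (intro conjI allI impI)
  have [measurable]: "g \<in> borel_measurable borel" "h \<in> borel_measurable borel" using assms by (auto simp: sq_def)
  show "(\<lambda>p. g p + c * h p) \<in> borel_measurable borel" by measurable
  show "integrable lborel (\<lambda>p. (g p + c * h p)\<^sup>2)"
  proof (rule Bochner_Integration.integrable_bound)
    show "integrable lborel (\<lambda>p. 2 * (g p)\<^sup>2 + 2 * c\<^sup>2 * (h p)\<^sup>2)" using assms by (auto simp: sq_def)
    have "(a + c * b)\<^sup>2 \<le> 2 * a\<^sup>2 + 2 * c\<^sup>2 * b\<^sup>2" for a b :: real
    proof -
      have "0 \<le> (a - c * b)\<^sup>2" by simp
      thus ?thesis by (simp add: power2_eq_square algebra_simps)
    qed
    thus "AE p in lborel. norm ((g p + c * h p)\<^sup>2) \<le> norm (2 * (g p)\<^sup>2 + 2 * c\<^sup>2 * (h p)\<^sup>2)" by simp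
  qed measurable
  show "g p + c * h p = 0" if "p \<notin> Omega l" for p using sq_outside[OF assms(1) that] sq_outside[OF assms(2) that] by simp
qed

lemma prim_slice_borel:
  fixes g :: "real \<times> real \<Rightarrow> real"
  assumes g: "g \<in> borel_measurable borel"
  shows "(\<lambda>p. prim (\<lambda>s. g (s, snd p)) (fst p)) \<in> borel_measurable borel"
proof -
  have "(\<lambda>z. (if snd z \<le> fst (fst z) then 1 else 0) * g (snd z, snd (fst z))) \<in> borel_measurable ((borel \<Otimes>\<^sub>M borel) \<Otimes>\<^sub>M (lborel :: real measure))"
    by (intro borel_measurable_times borel_pair_comp[OF g] measurable_If) measurable
  hence "(\<lambda>(p, s). indicator {..fst p} s * g (s, snd p)) \<in> borel_measurable ((borel :: (real \<times> real) measure) \<Otimes>\<^sub>M (lborel :: real measure))"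
    by (simp add: borel_prod case_prod_beta indicator_atMost)
  from lborel.borel_measurable_lebesgue_integral[OF this] show ?thesis
    by (simp add: prim_def)
qed

section \<open>The weighted vertical mean and the representation of \<open>u\<close>\<close>

locale vertical_mean =
  fixes l :: real and H \<eta> :: "real \<Rightarrow> real" and B :: real
  assumes l: "l > 0"
    and H: "smooth1 H" "\<And>y. (H has_real_derivative \<eta> y) (at y)" "\<And>y. y \<ge> l \<Longrightarrow> H y = 1" "\<And>y. 0 \<le> H y" "\<And>y. H y \<le> 1"
    and \<eta>: "test1 (-l) l \<eta>" "\<And>y. \<eta> y \<ge> 0" "integral\<^sup>L lborel \<eta> = 1" and B: "\<And>y. \<bar>\<eta> y\<bar> \<le> B"

lemma vertical_mean_exists:
  assumes "l > 0" obtains H \<eta> B where "vertical_mean l H \<eta> B"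
proof -
  have "-(l/2) < l/2" using assms by simp
  then obtain H \<eta> where *: "smooth1 H" "smooth1 \<eta>" "\<And>x. (H has_real_derivative \<eta> x) (at x)"
    "\<And>x. \<eta> x \<ge> 0" "\<And>x. x \<notin> {-(l/2)..l/2} \<Longrightarrow> \<eta> x = 0" "integral\<^sup>L lborel \<eta> = 1"
    "\<And>x. x \<ge> l/2 \<Longrightarrow> H x = 1" "\<And>x. 0 \<le> H x" "\<And>x. H x \<le> 1"
    by (rule smooth_step_exists) blast
  have t: "test1 (-l) l \<eta>"
    unfolding test1_def by (intro conjI exI[of _ "-(l/2)"] exI[of _ "l/2"]) (use * assms in auto)
  obtain B where "\<And>y. \<bar>\<eta> y\<bar> \<le> B" using test1_bounded[OF t] by blast
  hence "vertical_mean l H \<eta> B" using * t assms by unfold_locales auto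
  thus thesis by (rule that)
qed

context vertical_mean
begin

text \<open>The kernel of the deviation from the weighted mean: for a primitive \<open>f\<close> on
  \<open>{-l..l}\<close>, the value \<open>f y\<close> minus the integral of
  \<open>f * \<eta>\<close> is the integral of \<open>f' t * kernel y t\<close>. The term
  \<open>1 - H t\<close> is the mass of \<open>\<eta>\<close> to the right of
  \<open>t\<close>.\<close>

definition kernel :: "real \<Rightarrow> real \<Rightarrow> real" where
  "kernel y t = indicator {..y} t - (1 - H t)"

lemma kernel_bound: "\<bar>kernel y t\<bar> \<le> 1"
  using H(4)[of t] H(5)[of t] by (auto simp: kernel_def indicator_def)

lemma H_borel[measurable]: "H \<in> borel_measurable borel"
  using smooth1_continuous[OF H(1)] by (intro borel_measurable_continuous_onI)

lemma kernel_borel[measurable]: "kernel y \<in> borel_measurable borel"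
  unfolding kernel_def[abs_def] by measurable

end

text \<open>The sup norm and the first derivatives of \<open>u\<close> are recovered from \<open>g11 = u_xx\<close> and \<open>g12 = u_xy\<close>
  by writing \<open>u\<close> as its weighted mean \<open>m\<close> in the vertical direction plus an oscillation: \<open>m\<close> solves
  \<open>m'' = h\<close> with zero boundary values, and the oscillation is an integral of \<open>g12\<close>.\<close>

locale plate = vertical_mean +
  fixes u g11 g12 :: "real \<times> real \<Rightarrow> real"
  assumes cont: "continuous_on (Omegabar l) u"
    and bc: "\<And>y. y \<in> {-l..l} \<Longrightarrow> u (0, y) = 0" "\<And>y. y \<in> {-l..l} \<Longrightarrow> u (pi, y) = 0"
    and g11: "sq l g11" "weak_deriv (Omega l) [True, True] u g11"
    and g12: "sq l g12" "weak_deriv (Omega l) [True, False] u g12"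
begin

definition m :: "real \<Rightarrow> real" where "m x = (LBINT y. u (x, y) * \<eta> y)"

definition h :: "real \<Rightarrow> real" where "h x = (LBINT y. g11 (x, y) * \<eta> y)"

text \<open>The \<open>x\<close>-derivative of the oscillation \<open>u - m\<close>; see
  \<open>u_repr_R\<close>.\<close>

definition R :: "real \<Rightarrow> real \<Rightarrow> real" where "R s y = (LBINT t. g12 (s, t) * kernel y t)"

text \<open>The \<open>y\<close>-derivative of \<open>u\<close>, obtained by integrating
  \<open>u_xy\<close> from the left edge, where \<open>u\<close> vanishes identically.\<close>

definition P :: "real \<Rightarrow> real \<Rightarrow> real" where "P x t = prim (\<lambda>s. g12 (s, t)) x"

lemma h_integrable: "integrable lborel h"
  unfolding h_def[abs_def]
  using prim_kernel_swap(4)[OF sq_integrable[OF g11(1)] test1_borel[OF \<eta>(1)] B] .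

lemma h_L1: "(LBINT x. \<bar>h x\<bar>) \<le> B * (LBINT p. \<bar>g11 p\<bar>)"
proof -
  have i: "integrable lborel (\<lambda>p. \<bar>g11 p\<bar>)" using sq_integrable[OF g11(1)] by simp
  have "(LBINT x. \<bar>h x\<bar>) \<le> (LBINT x. B * (LBINT y. \<bar>g11 (x, y)\<bar>))"
  proof (rule integral_mono_AE)
    show "integrable lborel (\<lambda>x. \<bar>h x\<bar>)" using h_integrable by simp
    show "integrable lborel (\<lambda>x. B * (LBINT y. \<bar>g11 (x, y)\<bar>))" using integrable_iter_xy[OF i] by simp
    show "AE x in lborel. \<bar>h x\<bar> \<le> B * (LBINT y. \<bar>g11 (x, y)\<bar>)"
      using AE_integrable_slice_y[OF sq_integrable[OF g11(1)]]
    proof eventually_elim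
      case (elim x)
      have "\<bar>h x\<bar> \<le> (LBINT y. \<bar>g11 (x, y) * \<eta> y\<bar>)" unfolding h_def by (rule integral_abs_bound)
      also have "\<dots> \<le> (LBINT y. B * \<bar>g11 (x, y)\<bar>)"
      proof (rule integral_mono)
        show "integrable lborel (\<lambda>y. \<bar>g11 (x, y) * \<eta> y\<bar>)"
          using integrable_L1_test1[OF elim \<eta>(1)] by simp
        show "integrable lborel (\<lambda>y. B * \<bar>g11 (x, y)\<bar>)" using elim by simp
        fix y show "\<bar>g11 (x, y) * \<eta> y\<bar> \<le> B * \<bar>g11 (x, y)\<bar>"
          using mult_right_mono[OF B[of y], of "\<bar>g11 (x, y)\<bar>"] by (simp add: abs_mult mult.commute)
      qed
      finally show ?case by simp
    qed
  qed
  also have "\<dots> = B * (LBINT p. \<bar>g11 p\<bar>)" using integral_iter_xy[OF i] by simp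
  finally show ?thesis .
qed

text \<open>\<open>\<eta>\<close> has compact support in the open vertical interval, so
  \<open>\<phi> x * \<eta> y\<close> is an admissible test function and both derivatives fall on
  \<open>\<phi>\<close>. The horizontal edges contribute nothing.\<close>

lemma m_second: 
  assumes "test1 0 pi \<phi>"
  shows "(LBINT x. m x * deriv (deriv \<phi>) x) = (LBINT x. h x * \<phi> x)"
proof -
  have sm: "smooth1 \<phi>" "smooth1 \<eta>" using assms \<eta>(1) by (auto simp: test1_def)
  have "Dw [True, True] (\<lambda>p. \<phi> (fst p) * \<eta> (snd p)) = (\<lambda>p. deriv (deriv \<phi>) (fst p) * \<eta> (snd p))"
    using tensor_pd(1)[OF sm] tensor_pd(1)[OF smooth1_deriv[OF sm(1)] sm(2)] by simp
  hence "(LBINT p. u p * (deriv (deriv \<phi>) (fst p) * \<eta> (snd p))) = (LBINT p. g11 p * (\<phi> (fst p) * \<eta> (snd p)))"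
    using g11 weak_deriv_sq_iff[OF cont g11(1), of "[True, True]"] test_fun_tensor[OF assms \<eta>(1)] by fastforce
  thus ?thesis
    using cont_test1_integral[OF cont test1_deriv[OF test1_deriv[OF assms]] \<eta>(1)] sq_test1_integral(1)[OF g11(1) assms \<eta>(1)]
    by (simp add: m_def h_def)
qed

text \<open>The weak equation \<open>m'' = h\<close> determines \<open>m'\<close> up to the initial
  slope \<open>C\<close>, and the zero values of \<open>m\<close> at 0 and \<open>pi\<close> then
  bound \<open>C\<close> by the L1 norm of \<open>h\<close>. So \<open>|m'|\<close> is at most twice
  that norm, which gives the factor \<open>2 * pi\<close>.\<close>

lemma m_repr:
  obtains C where "\<And>x. x \<in> {0..pi} \<Longrightarrow> m x = prim (\<lambda>s. indicator {0..pi} s * (C + prim h s)) x"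
    "\<And>x. x \<in> {0..pi} \<Longrightarrow> \<bar>m x\<bar> \<le> 2 * pi * (LBINT x. \<bar>h x\<bar>)"
    "integrable lborel (\<lambda>s. indicator {0..pi} s * (C + prim h s))"
proof -
  have mc: "continuous_on {0..pi} m" unfolding m_def by (rule continuous_on_partial_integral[OF cont \<eta>(1)])
  obtain C where C: "\<And>x1 x2. 0 \<le> x1 \<Longrightarrow> x1 \<le> x2 \<Longrightarrow> x2 \<le> pi \<Longrightarrow>
     m x2 - m x1 = (LBINT x. indicator {x1..x2} x * (C + prim h x))"
    using second_weak_derivative_imp_increment[OF pi_gt_zero mc h_integrable m_second] by blast
  define I where "I = (LBINT x. \<bar>h x\<bar>)"
  have bI: "\<bar>prim h x\<bar> \<le> I" for x using prim_bound[OF h_integrable] by (simp add: I_def)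
  have m0: "m 0 = 0" "m pi = 0"
  proof -
    have "u (0, y) * \<eta> y = 0" "u (pi, y) * \<eta> y = 0" for y
      using bc[of y] test1_outside[OF \<eta>(1), of y] by (cases "y \<in> {-l..l}"; auto)+
    thus "m 0 = 0" "m pi = 0" by (simp_all only: m_def Bochner_Integration.integral_zero)
  qed
  have [measurable]: "h \<in> borel_measurable borel" using h_integrable borel_measurable_integrable by force
  have ind: "integrable lborel (indicator {x..y} :: real \<Rightarrow> real)" for x y
    by (intro integrable_real_indicator) (simp_all add: emeasure_lborel_Icc_eq)
  have i: "integrable lborel (\<lambda>s. indicator {0..pi} s * prim h s)"
    using bI by (intro integrable_mult_bounded(1)[OF ind]) auto
  have i': "integrable lborel (\<lambda>s. indicator {0..x} s * (C + prim h s))" for x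
    using bI by (intro integrable_mult_bounded(1)[OF ind, where B="\<bar>C\<bar> + I"]) (auto intro!: order_trans[OF abs_triangle_ineq] add_mono)
  \<comment> \<open>The total increment of \<open>m\<close> over \<open>{0..pi}\<close> is zero;
    this is the equation for \<open>C\<close>.\<close>
  have "0 = (LBINT x. C * indicator {0..pi} x + indicator {0..pi} x * prim h x)"
    using C[of 0 pi] m0 by (simp add: algebra_simps)
  also have "\<dots> = C * pi + (LBINT x. indicator {0..pi} x * prim h x)"
    using ind i by simp
  finally have "C * pi = - (LBINT x. indicator {0..pi} x * prim h x)"
    by simp
  moreover have "\<bar>C * pi\<bar> = \<bar>C\<bar> * pi" by (simp add: abs_mult)
  ultimately have "\<bar>C\<bar> * pi = \<bar>LBINT x. indicator {0..pi} x * prim h x\<bar>"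
    by simp
  also have "\<dots> \<le> (LBINT x. \<bar>indicator {0..pi} x * prim h x\<bar>)" by (rule integral_abs_bound)
  also have "\<dots> \<le> (LBINT x. I * indicator {0..pi} x)"
  proof (rule integral_mono)
    fix s show "\<bar>indicator {0..pi} s * prim h s\<bar> \<le> I * indicator {0..pi} s"
      using bI[of s] by (simp add: indicator_def)
  qed (use i ind in auto)
  also have "\<dots> = I * pi" using ind by simp
  finally have CI: "\<bar>C\<bar> \<le> I" by simp
  have I0: "I \<ge> 0" by (simp add: I_def)
  show thesis
  proof (rule that[of C])
    fix x assume x: "x \<in> {0..pi}"
    have mx: "m x = (LBINT s. indicator {0..x} s * (C + prim h s))" using C[of 0 x] x m0 by simp
    also have "\<dots> = prim (\<lambda>s. indicator {0..pi} s * (C + prim h s)) x"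
      unfolding prim_def by (rule Bochner_Integration.integral_cong) (use x in \<open>auto simp: indicator_def\<close>)
    finally show "m x = prim (\<lambda>s. indicator {0..pi} s * (C + prim h s)) x" .
    have "\<bar>m x\<bar> \<le> (LBINT s. \<bar>indicator {0..x} s * (C + prim h s)\<bar>)" unfolding mx by (rule integral_abs_bound)
    also have "\<dots> \<le> (LBINT s. 2 * I * indicator {0..x} s)"
    proof (rule integral_mono)
      fix s show "\<bar>indicator {0..x} s * (C + prim h s)\<bar> \<le> 2 * I * indicator {0..x} s"
        using CI bI[of s] by (auto simp: indicator_def abs_le_iff)
    qed (use i' ind in auto)
    also have "\<dots> = 2 * I * x" using ind x by simp
    also have "\<dots> \<le> 2 * I * pi" using x I0 by (intro mult_left_mono) auto
    finally show "\<bar>m x\<bar> \<le> 2 * pi * (LBINT x. \<bar>h x\<bar>)" by (simp add: I_def mult_ac)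
  qed (rule i')
qed

text \<open>Of the four corner values in the double increment, the two on the left edge
  vanish.\<close>

lemma u_repr_P:
  assumes "x \<in> {0..pi}" "y \<in> {-l..l}"
  shows "u (x, y) = u (x, -l) + prim (P x) y"
proof -
  have "(LBINT p. u p * (deriv \<phi> (fst p) * deriv \<theta> (snd p))) = (LBINT p. g12 p * (\<phi> (fst p) * \<theta> (snd p)))"
    if t: "test1 0 pi \<phi>" "test1 (-l) l \<theta>" for \<phi> \<theta>
  proof -
    have sm: "smooth1 \<phi>" "smooth1 \<theta>" using t by (auto simp: test1_def)
    have "Dw [True, False] (\<lambda>p. \<phi> (fst p) * \<theta> (snd p)) = (\<lambda>p. deriv \<phi> (fst p) * deriv \<theta> (snd p))"
      using tensor_pd(2)[OF sm] tensor_pd(1)[OF sm(1) smooth1_deriv[OF sm(2)]] by simp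
    thus ?thesis
      using g12 weak_deriv_sq_iff[OF cont g12(1), of "[True, False]"] test_fun_tensor[OF t] by fastforce
  qed
  from mixed_increment[OF l cont g12(1) this assms] bc(1)[of y] bc(1)[of "-l"] assms(2) l
  show ?thesis by (simp add: P_def[abs_def])
qed

lemma P_integrable: "integrable lborel (P x)"
  using prim_kernel_swap(3)[OF sq_integrable[OF g12(1)], of "\<lambda>_. 1" 1 x] by (simp add: P_def[abs_def])

text \<open>Averaging \<open>u_repr_P\<close> against \<open>\<eta>\<close> and integrating by parts
  expresses \<open>m x\<close> by the same edge value \<open>u (x, -l)\<close>. On subtraction this
  unknown value cancels and only an integral of \<open>g12\<close> against the kernel
  remains.\<close>

lemma u_repr_R:
  assumes x: "x \<in> {0..pi}" and y: "y \<in> {-l..l}"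
  shows "u (x, y) = m x + prim (\<lambda>s. R s y) x"
proof -
  have Pm[measurable]: "P x \<in> borel_measurable borel" using P_integrable[of x] borel_measurable_integrable by force
  have i1: "integrable lborel (\<lambda>t. prim (P x) t * \<eta> t)"
    using prim_bound[OF P_integrable[of x]] by (intro integrable_mult_bounded(2)[OF integrable_test1[OF \<eta>(1)]]) auto
  have H1: "\<bar>1 - H t\<bar> \<le> 1" for t using H(4,5)[of t] by simp
  have i2: "integrable lborel (\<lambda>t. P x t * (1 - H t))"
    using H1 by (intro integrable_mult_bounded(1)[OF P_integrable]) auto
  have i3: "integrable lborel (\<lambda>t. indicator {..y} t * P x t)"
    using integrable_mult_indicator[OF _ P_integrable, of "{..y}" x] by simp
  have "u (x, t) * \<eta> t = u (x, -l) * \<eta> t + prim (P x) t * \<eta> t" for t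
    using u_repr_P[OF x, of t] test1_outside[OF \<eta>(1), of t] by (cases "t \<in> {-l..l}") (auto simp: distrib_right)
  hence "m x = u (x, -l) + (LBINT t. prim (P x) t * \<eta> t)"
    using i1 integrable_test1[OF \<eta>(1)] \<eta>(3) by (simp add: m_def)
  \<comment> \<open>The primitive \<open>H - 1\<close> of \<open>\<eta>\<close> is chosen because it
    vanishes above \<open>l\<close>, as \<open>prim_ibp\<close> demands.\<close>
  also have "(LBINT t. prim (P x) t * \<eta> t) = - (LBINT t. P x t * (H t - 1))"
  proof (rule prim_ibp[OF P_integrable, where a="-l" and b=l])
    show "((\<lambda>t. H t - 1) has_real_derivative \<eta> t) (at t)" for t using H(2) by (auto intro!: derivative_eq_intros)
    show "continuous_on UNIV \<eta>" by (rule test1_continuous[OF \<eta>(1)])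
    show "t \<notin> {-l..l} \<Longrightarrow> \<eta> t = 0" for t using test1_outside[OF \<eta>(1)] by auto
    show "t \<ge> l \<Longrightarrow> H t - 1 = 0" for t using H(3) by simp
  qed
  also have "\<dots> = (LBINT t. P x t * (1 - H t))"
  proof -
    have "P x t * (H t - 1) = - (P x t * (1 - H t))" for t by (simp add: algebra_simps)
    thus ?thesis by simp
  qed
  finally have "u (x, y) - m x = prim (P x) y - (LBINT t. P x t * (1 - H t))"
    using u_repr_P[OF x y] by simp
  also have "\<dots> = (LBINT t. indicator {..y} t * P x t - P x t * (1 - H t))"
    using i2 i3 by (simp add: prim_def)
  also have "\<dots> = (LBINT t. P x t * kernel y t)"
    by (rule Bochner_Integration.integral_cong) (simp_all add: kernel_def algebra_simps)
  also have "\<dots> = prim (\<lambda>s. R s y) x"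
    unfolding P_def R_def using prim_kernel_swap(1)[OF sq_integrable[OF g12(1)] kernel_borel kernel_bound] .
  finally show ?thesis by simp
qed

lemma sup_bound:
  assumes "p \<in> Omegabar l"
  shows "\<bar>u p\<bar> \<le> 2 * pi * B * (LBINT p. \<bar>g11 p\<bar>) + (LBINT p. \<bar>g12 p\<bar>)"
proof -
  obtain x y where p: "p = (x, y)" "x \<in> {0..pi}" "y \<in> {-l..l}" using assms by (auto simp: Omegabar_def)
  obtain C where "\<And>x. x \<in> {0..pi} \<Longrightarrow> \<bar>m x\<bar> \<le> 2 * pi * (LBINT x. \<bar>h x\<bar>)" by (rule m_repr) blast
  hence "\<bar>m x\<bar> \<le> 2 * pi * (LBINT x. \<bar>h x\<bar>)" using p(2) by blast
  also have "\<dots> \<le> 2 * pi * (B * (LBINT p. \<bar>g11 p\<bar>))" by (intro mult_left_mono h_L1) simp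
  finally have 1: "\<bar>m x\<bar> \<le> 2 * pi * B * (LBINT p. \<bar>g11 p\<bar>)" by (simp add: mult_ac)
  have "\<bar>prim (\<lambda>s. R s y) x\<bar> \<le> 1 * (LBINT p. \<bar>g12 p\<bar>)"
    unfolding R_def by (rule prim_kernel_swap(2)[OF sq_integrable[OF g12(1)] kernel_borel kernel_bound])
  thus ?thesis using 1 u_repr_R[OF p(2,3)] p(1) by simp
qed

text \<open>By \<open>u_repr_P\<close> each vertical slice of \<open>u\<close> is a constant plus a
  primitive of \<open>P x\<close>, so parts can be taken slice by slice. The indicator cuts off
  \<open>P\<close>, which becomes constant in \<open>x\<close>, in general nonzero, to the right of
  the rectangle.\<close>

lemma weak_deriv_y:
  shows "sq l (\<lambda>p. indicator (Omega l) p * P (fst p) (snd p))" (is "sq l ?p")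
    and "weak_deriv (Omega l) [False] u (\<lambda>p. indicator (Omega l) p * P (fst p) (snd p))"
proof -
  have gm: "g12 \<in> borel_measurable borel" using g12 by (simp add: sq_def)
  show s: "sq l ?p"
  proof (rule sq_slice_x[OF g12(1)])
    show "(\<lambda>p. P (fst p) (snd p)) \<in> borel_measurable borel"
      unfolding P_def by (rule prim_slice_borel[OF gm])
    fix x y
    have "ennreal \<bar>P x y\<bar> \<le> (\<integral>\<^sup>+s. ennreal \<bar>indicator {..x} s * g12 (s, y)\<bar> \<partial>lborel)"
      unfolding P_def prim_def by (rule ennreal_abs_integral_le)
    also have "\<dots> \<le> (\<integral>\<^sup>+s. ennreal \<bar>g12 (s, y)\<bar> \<partial>lborel)"
      by (intro nn_integral_mono ennreal_leI) (auto simp: indicator_def)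
    finally show "ennreal \<bar>P (fst (x, y)) (snd (x, y))\<bar> \<le> (\<integral>\<^sup>+s. ennreal \<bar>g12 (s, y)\<bar> \<partial>lborel)" by simp
  qed
  have "(LBINT p. u p * pdy \<phi> p) = - (LBINT p. ?p p * \<phi> p)" if t: "test_fun (Omega l) \<phi>" for \<phi>
  proof -
    have "(LBINT y. u (x, y) * pdy \<phi> (x, y)) = - (LBINT y. ?p (x, y) * \<phi> (x, y))" for x
    proof (cases "x \<in> {0<..<pi}")
      case True
      have "(LBINT y. u (x, y) * pdy \<phi> (x, y)) = - (LBINT y. P x y * \<phi> (x, y))"
        using test_fun_slice_y(1,2)[OF t, of x] test_fun_slice_y(3,4)[OF t, where x=x] l True
        by (intro slice_ibp[OF P_integrable, of _ _ "-l" l _ "u (x, -l)"] u_repr_P) auto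
      moreover have "?p (x, y) * \<phi> (x, y) = P x y * \<phi> (x, y)" for y
        using test_fun_outside[OF t, of "(x, y)"]
        by (cases "(x, y) \<in> Omega l") auto
      ultimately show ?thesis by (simp only:)
    next
      case False
      hence "(x, y) \<notin> Omega l" for y by (auto simp: Omega_def)
      thus ?thesis using test_fun_outside[OF t] test_fun_outside[OF test_fun_pdy[OF t]] by simp
    qed
    thus ?thesis
      using integral_iter_xy[OF integrable_mult_test_fun[OF cont test_fun_pdy[OF t]]]
        integral_iter_xy[OF sq_mult_test_fun[OF s t]] by simp
  qed
  thus "weak_deriv (Omega l) [False] u ?p"
    by (subst weak_deriv_sq_iff[OF cont s]) simp
qed

text \<open>First the \<open>y\<close>-derivative is moved onto \<open>u\<close>, giving
  \<open>P\<close>; then the \<open>x\<close>-derivative is moved onto \<open>P\<close>, which is by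
  construction a primitive of \<open>g12\<close> in \<open>x\<close>.\<close>

lemma weak_deriv_yx: "weak_deriv (Omega l) [False, True] u g12"
proof -
  let ?p = "\<lambda>p. indicator (Omega l) p * P (fst p) (snd p)"
  note s = weak_deriv_y(1)
  have "(LBINT p. u p * pdy (pdx \<phi>) p) = (LBINT p. g12 p * \<phi> p)" if t: "test_fun (Omega l) \<phi>" for \<phi>
  proof -
    note t' = test_fun_pdx[OF t]
    have "(LBINT p. u p * pdy (pdx \<phi>) p) = - (LBINT p. ?p p * pdx \<phi> p)"
      using weak_deriv_y(2) t' by (subst (asm) weak_deriv_sq_iff[OF cont s]) auto
    also have "(LBINT p. ?p p * pdx \<phi> p) = (LBINT y. LBINT x. ?p (x, y) * pdx \<phi> (x, y))"
      using integral_iter_yx[OF sq_mult_test_fun[OF s t']] by simp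
    also have "\<dots> = (LBINT y. - (LBINT x. g12 (x, y) * \<phi> (x, y)))"
    proof (rule integral_cong_AE)
      show "(\<lambda>y. LBINT x. ?p (x, y) * pdx \<phi> (x, y)) \<in> borel_measurable lborel"
        using integrable_iter_yx[OF sq_mult_test_fun[OF s t']] by simp
      show "(\<lambda>y. - (LBINT x. g12 (x, y) * \<phi> (x, y))) \<in> borel_measurable lborel"
        using integrable_iter_yx[OF sq_mult_test_fun[OF g12(1) t]] by simp
      \<comment> \<open>The slice \<open>g12 (x, y)\<close> is integrable in \<open>x\<close> only
        for almost every \<open>y\<close>.\<close>
      show "AE y in lborel. (LBINT x. ?p (x, y) * pdx \<phi> (x, y)) = - (LBINT x. g12 (x, y) * \<phi> (x, y))"
        using AE_integrable_slice_x[OF sq_integrable[OF g12(1)]]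
      proof eventually_elim
        case (elim y)
        have "(LBINT x. P x y * pdx \<phi> (x, y)) = - (LBINT x. g12 (x, y) * \<phi> (x, y))"
          using test_fun_slice_x[OF t, where y=y]
          by (intro slice_ibp[OF elim, of _ _ 0 pi _ 0]) (auto simp: P_def)
        moreover have "?p (x, y) * pdx \<phi> (x, y) = P x y * pdx \<phi> (x, y)" for x
          using test_fun_outside[OF t', of "(x, y)"] by (cases "(x, y) \<in> Omega l") auto
        ultimately show ?case by (simp only:)
      qed
    qed
    also have "\<dots> = - (LBINT p. g12 p * \<phi> p)"
      using integral_iter_yx[OF sq_mult_test_fun[OF g12(1) t]] by simp
    finally show ?thesis by simp
  qed
  thus ?thesis by (subst weak_deriv_sq_iff[OF cont g12(1)]) simp
qed

text \<open>On horizontal lines \<open>u\<close> is the primitive of \<open>Q = M + R\<close>, where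
  \<open>M\<close> is the derivative of the mean and is bounded, while \<open>R\<close> is dominated
  by the L1 norm of \<open>g12\<close> on vertical slices. So \<open>Q\<close> is square
  integrable.\<close>

lemma weak_deriv_x: "\<exists>q. weak_deriv (Omega l) [True] u q"
proof -
  have gm: "g12 \<in> borel_measurable borel" using g12 by (simp add: sq_def)
  obtain C where C: "\<And>x. x \<in> {0..pi} \<Longrightarrow> m x = prim (\<lambda>s. indicator {0..pi} s * (C + prim h s)) x"
    "integrable lborel (\<lambda>s. indicator {0..pi} s * (C + prim h s))"
    by (rule m_repr) blast
  define M where "M s = indicator {0..pi} s * (C + prim h s)" for s :: real
  define Q where "Q s y = M s + R s y" for s y
  have Ri: "integrable lborel (\<lambda>s. R s y)" for y
    unfolding R_def using prim_kernel_swap(4)[OF sq_integrable[OF g12(1)] kernel_borel kernel_bound] .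
  have Mi: "integrable lborel M" using C(2) by (simp add: M_def[abs_def])
  have Qi: "integrable lborel (\<lambda>s. Q s y)" for y unfolding Q_def using Mi Ri by simp
  have uQ: "u (x, y) = 0 + prim (\<lambda>s. Q s y) x" if "x \<in> {0..pi}" "y \<in> {-l..l}" for x y
  proof -
    have "prim (\<lambda>s. Q s y) x = prim M x + prim (\<lambda>s. R s y) x"
      using integrable_mult_indicator[OF _ Mi, of "{..x}"] integrable_mult_indicator[OF _ Ri, of "{..x}" y]
      by (simp add: prim_def Q_def distrib_left)
    thus ?thesis using u_repr_R[OF that] C(1)[OF that(1)] by (simp add: M_def[abs_def])
  qed
  define I where "I = \<bar>C\<bar> + (LBINT s. \<bar>h s\<bar>)"
  have Mb: "\<bar>M s\<bar> \<le> I" for s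
    using prim_bound[OF h_integrable, of s] abs_triangle_ineq[of C "prim h s"] by (auto simp: M_def I_def indicator_def)
  have [measurable]: "h \<in> borel_measurable borel" using h_integrable borel_measurable_integrable by force
  have Mm[measurable]: "M \<in> borel_measurable borel" unfolding M_def[abs_def] by measurable
  have fm: "fst \<in> borel_measurable (borel :: (real \<times> real) measure)" "snd \<in> borel_measurable (borel :: (real \<times> real) measure)"
    by (intro borel_measurable_continuous_onI continuous_intros)+
  have sM: "sq l (\<lambda>p. indicator (Omega l) p * M (fst p))"
    unfolding sq_def
  proof (intro conjI allI impI)
    show "(\<lambda>p. indicator (Omega l) p * M (fst p)) \<in> borel_measurable borel"
      using fm by measurable
    show "integrable lborel (\<lambda>p. (indicator (Omega l) p * M (fst p))\<^sup>2)"
    proof (rule Bochner_Integration.integrable_bound)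
      show "integrable lborel (\<lambda>p. I\<^sup>2 * indicator (Omegabar l) p)" using integrable_indicator_Omegabar by simp
      show "(\<lambda>p. (indicator (Omega l) p * M (fst p))\<^sup>2) \<in> borel_measurable lborel"
        using fm by measurable
      have "norm ((indicator (Omega l) p * M (fst p))\<^sup>2) \<le> norm (I\<^sup>2 * indicator (Omegabar l) p)" for p
      proof (cases "p \<in> Omega l")
        case True
        hence "p \<in> Omegabar l" using Omega_subset by blast
        moreover have "\<bar>M (fst p)\<bar>\<^sup>2 \<le> I\<^sup>2" using Mb by (intro power_mono) auto
        ultimately show ?thesis using True by simp
      qed simp
      thus "AE p in lborel. norm ((indicator (Omega l) p * M (fst p))\<^sup>2) \<le> norm (I\<^sup>2 * indicator (Omegabar l) p)" by simp
    qed
  qed auto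
  have sR: "sq l (\<lambda>p. indicator (Omega l) p * R (fst p) (snd p))"
  proof (rule sq_slice_y[OF g12(1) _ l])
    have "(\<lambda>z. g12 (fst (fst z), snd z) * ((if snd z \<le> snd (fst z) then 1 else 0) - (1 - H (snd z)))) \<in> borel_measurable ((borel \<Otimes>\<^sub>M borel) \<Otimes>\<^sub>M (lborel :: real measure))"
      by (intro borel_measurable_times borel_pair_comp[OF gm] borel_measurable_diff measurable_If) measurable
    hence "(\<lambda>(p, t). g12 (fst p, t) * kernel (snd p) t) \<in> borel_measurable ((borel :: (real \<times> real) measure) \<Otimes>\<^sub>M (lborel :: real measure))"
      by (simp add: borel_prod case_prod_beta indicator_atMost kernel_def)
    from lborel.borel_measurable_lebesgue_integral[OF this]
    show "(\<lambda>p. R (fst p) (snd p)) \<in> borel_measurable borel" by (simp add: R_def)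
    fix x y
    have "ennreal \<bar>R x y\<bar> \<le> (\<integral>\<^sup>+t. ennreal \<bar>g12 (x, t) * kernel y t\<bar> \<partial>lborel)"
      unfolding R_def by (rule ennreal_abs_integral_le)
    also have "\<dots> \<le> (\<integral>\<^sup>+t. ennreal \<bar>g12 (x, t)\<bar> \<partial>lborel)"
      using kernel_bound by (intro nn_integral_mono ennreal_leI) (auto simp: abs_mult intro: mult_left_le)
    finally show "ennreal \<bar>R (fst (x, y)) (snd (x, y))\<bar> \<le> (\<integral>\<^sup>+t. ennreal \<bar>g12 (x, t)\<bar> \<partial>lborel)" by simp
  qed
  let ?q = "\<lambda>p. indicator (Omega l) p * Q (fst p) (snd p)"
  have s: "sq l ?q" using sq_add[OF sM sR, of 1] by (simp add: Q_def distrib_left)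
  have "(LBINT p. u p * pdx \<phi> p) = - (LBINT p. ?q p * \<phi> p)" if t: "test_fun (Omega l) \<phi>" for \<phi>
  proof -
    have "(LBINT x. u (x, y) * pdx \<phi> (x, y)) = - (LBINT x. ?q (x, y) * \<phi> (x, y))" for y
    proof (cases "y \<in> {-l<..<l}")
      case True
      have "(LBINT x. u (x, y) * pdx \<phi> (x, y)) = - (LBINT x. Q x y * \<phi> (x, y))"
        using test_fun_slice_x[OF t, where y=y] True
        by (intro slice_ibp[OF Qi, of _ _ 0 pi _ 0] uQ) auto
      moreover have "?q (x, y) * \<phi> (x, y) = Q x y * \<phi> (x, y)" for x
        using test_fun_outside[OF t, of "(x, y)"]
        by (cases "(x, y) \<in> Omega l") auto
      ultimately show ?thesis by (simp only:)
    next
      case False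
      hence "(x, y) \<notin> Omega l" for x by (auto simp: Omega_def)
      thus ?thesis using test_fun_outside[OF t] test_fun_outside[OF test_fun_pdx[OF t]] by simp
    qed
    thus ?thesis
      using integral_iter_yx[OF integrable_mult_test_fun[OF cont test_fun_pdx[OF t]]]
        integral_iter_yx[OF sq_mult_test_fun[OF s t]] by simp
  qed
  hence "weak_deriv (Omega l) [True] u ?q"
    by (subst weak_deriv_sq_iff[OF cont s]) simp
  thus ?thesis by blast
qed

end

section \<open>The energy space is complete\<close>

lemma sq_integrable_mult:
  assumes "sq l g" "sq l h" shows "integrable lborel (\<lambda>p. g p * h p)"
proof (rule Bochner_Integration.integrable_bound)
  have [measurable]: "g \<in> borel_measurable borel" "h \<in> borel_measurable borel" using assms by (auto simp: sq_def)
  show "integrable lborel (\<lambda>p. (g p)\<^sup>2 + (h p)\<^sup>2)" using assms by (auto simp: sq_def)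
  show "(\<lambda>p. g p * h p) \<in> borel_measurable lborel" by measurable
  have "\<bar>a * b\<bar> \<le> a\<^sup>2 + b\<^sup>2" for a b :: real
  proof -
    have "0 \<le> (\<bar>a\<bar> - \<bar>b\<bar>)\<^sup>2" by simp
    also have "\<dots> = a\<^sup>2 + b\<^sup>2 - 2 * \<bar>a * b\<bar>" by (simp add: power2_eq_square algebra_simps abs_mult)
    finally show ?thesis using abs_ge_zero[of "a * b"] by linarith
  qed
  thus "AE p in lborel. norm (g p * h p) \<le> norm ((g p)\<^sup>2 + (h p)\<^sup>2)" by simp
qed

text \<open>The discriminant criterion. When \<open>C = 0\<close> the parabola has no vertex, and a
  nonnegative affine function must be constant.\<close>

lemma quadratic_nonneg_imp:
  fixes A B C :: real
  assumes "\<And>t. A + 2 * t * B + t\<^sup>2 * C \<ge> 0" "C \<ge> 0"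
  shows "B\<^sup>2 \<le> A * C"
proof (cases "C = 0")
  case True
  have "B = 0"
  proof (rule ccontr)
    assume "B \<noteq> 0"
    \<comment> \<open>The point at which the affine function takes the value -1.\<close>
    hence "A + 2 * (- (A + 1) / (2 * B)) * B + (- (A + 1) / (2 * B))\<^sup>2 * C = -1" using True by (simp add: field_simps)
    with assms(1)[of "- (A + 1) / (2 * B)"] show False by simp
  qed
  with True show ?thesis by simp
next
  case False
  with assms(2) have "C > 0" by simp
  have "0 \<le> A + 2 * (- B / C) * B + (- B / C)\<^sup>2 * C" by (rule assms(1))
  also have "\<dots> = A - B\<^sup>2 / C" using \<open>C > 0\<close> by (simp add: power2_eq_square field_simps)
  finally show ?thesis using \<open>C > 0\<close> by (simp add: field_simps)
qed

definition area :: "real \<Rightarrow> real" where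
  "area l = (LBINT p. indicator (Omegabar l) (p :: real \<times> real))"

lemma area_nonneg: "area l \<ge> 0"
  unfolding area_def by (rule Bochner_Integration.integral_nonneg) simp

text \<open>Cauchy-Schwarz, read off from the nonnegative quadratic polynomial in \<open>t\<close>
  given by the integral of \<open>(|g| + t)^2\<close> over the rectangle.\<close>

lemma sq_L1_le_L2:
  assumes g: "sq l g"
  shows "(LBINT p. \<bar>g p\<bar>)\<^sup>2 \<le> area l * (LBINT p. (g p)\<^sup>2)"
proof -
  have i: "integrable lborel (\<lambda>p. (g p)\<^sup>2)" "integrable lborel (\<lambda>p. \<bar>g p\<bar>)"
    using g sq_integrable[OF g] by (auto simp: sq_def)
  have "0 \<le> (LBINT p. (g p)\<^sup>2) + 2 * t * (LBINT p. \<bar>g p\<bar>) + t\<^sup>2 * area l" for t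
  proof -
    have "(LBINT p. (g p)\<^sup>2) + 2 * t * (LBINT p. \<bar>g p\<bar>) + t\<^sup>2 * area l
      = (LBINT p. (g p)\<^sup>2 + 2 * t * \<bar>g p\<bar> + t\<^sup>2 * indicator (Omegabar l) p)"
      using i integrable_indicator_Omegabar[of l] by (simp add: area_def)
    also have "\<dots> \<ge> 0"
    proof (rule Bochner_Integration.integral_nonneg)
      fix p
      show "0 \<le> (g p)\<^sup>2 + 2 * t * \<bar>g p\<bar> + t\<^sup>2 * indicator (Omegabar l) p"
      proof (cases "p \<in> Omegabar l")
        case True
        have "0 \<le> (\<bar>g p\<bar> + t)\<^sup>2" by simp
        thus ?thesis using True by (simp add: power2_eq_square algebra_simps)
      next
        case False
        hence "g p = 0" using Omega_subset sq_outside[OF g] by blast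
        thus ?thesis by simp
      qed
    qed
    finally show ?thesis .
  qed
  from quadratic_nonneg_imp[OF this area_nonneg] show ?thesis by (simp add: mult.commute)
qed

lemma geometric_increments:
  fixes x :: "nat \<Rightarrow> real"
  assumes s: "\<And>k. \<bar>x (Suc k) - x k\<bar> \<le> s / 2 ^ k"
  shows "convergent x" "\<bar>lim x - x n\<bar> \<le> 2 * s / 2 ^ n"
proof -
  have s0: "s \<ge> 0" using s[of 0] by simp
  \<comment> \<open>The subtracted tail of the geometric series makes the induction close; it is
    dropped afterwards.\<close>
  have b: "\<bar>x (n + j) - x n\<bar> \<le> 2 * s / 2 ^ n - 2 * s / 2 ^ (n + j)" for n j
  proof (induction j)
    case (Suc j)
    have "\<bar>x (n + Suc j) - x n\<bar> \<le> \<bar>x (Suc (n + j)) - x (n + j)\<bar> + \<bar>x (n + j) - x n\<bar>" by simp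
    also have "\<dots> \<le> s / 2 ^ (n + j) + (2 * s / 2 ^ n - 2 * s / 2 ^ (n + j))" using s Suc by (intro add_mono)
    also have "\<dots> = 2 * s / 2 ^ n - 2 * s / 2 ^ (n + Suc j)" by (simp add: field_simps)
    finally show ?case .
  qed simp
  have b': "\<bar>x (n + j) - x n\<bar> \<le> 2 * s / 2 ^ n" for n j
  proof -
    have "2 * s / 2 ^ (n + j) \<ge> 0" using s0 by simp
    thus ?thesis using b[of n j] by linarith
  qed
  show c: "convergent x"
  proof (rule Cauchy_convergent, rule metric_CauchyI)
    fix e :: real assume e: "e > 0"
    have "(\<lambda>n. 2 * s * (1/2) ^ n) \<longlonglongrightarrow> 2 * s * 0" by (intro tendsto_intros LIMSEQ_power_zero) simp
    hence "eventually (\<lambda>n. 2 * s * (1/2) ^ n < e / 2) sequentially" using e by (intro order_tendstoD) auto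
    then obtain N where N: "2 * s * (1/2) ^ N < e / 2" by (auto simp: eventually_sequentially)
    hence N: "2 * s / 2 ^ N < e / 2" by (simp add: power_divide)
    show "\<exists>M. \<forall>m\<ge>M. \<forall>n\<ge>M. dist (x m) (x n) < e"
    proof (intro exI[of _ N] allI impI)
      fix m n assume "m \<ge> N" "n \<ge> N"
      then obtain i j where "m = N + i" "n = N + j" by (metis le_iff_add)
      thus "dist (x m) (x n) < e" using b'[of N i] b'[of N j] N by (auto simp: dist_real_def)
    qed
  qed
  have "(\<lambda>j. \<bar>x (n + j) - x n\<bar>) \<longlonglongrightarrow> \<bar>lim x - x n\<bar>"
    using LIMSEQ_ignore_initial_segment[OF c[unfolded convergent_LIMSEQ_iff], of n]
    by (intro tendsto_intros) (simp add: add.commute)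
  thus "\<bar>lim x - x n\<bar> \<le> 2 * s / 2 ^ n" by (rule LIMSEQ_le_const2) (use b' in auto)
qed

text \<open>A quantitative Riesz-Fischer argument: the fast rate gives pointwise convergence almost
  everywhere with an integrable bound on the squared error, and integrating that bound gives
  convergence in L2.\<close>

lemma L2_complete:
  assumes g: "\<And>n. sq l (g n)" and K: "\<And>n. (LBINT p. (g (Suc n) p - g n p)\<^sup>2) \<le> K * (1/8) ^ n"
  obtains g' where "sq l g'" "(\<lambda>n. LBINT p. (g n p - g' p)\<^sup>2) \<longlonglongrightarrow> 0"
proof -
  have gm[measurable]: "g n \<in> borel_measurable borel" for n using g by (auto simp: sq_def)
  have sd: "sq l (\<lambda>p. g (Suc n) p - g n p)" for n using sq_add[OF g[of "Suc n"] g[of n], of "-1"] by simp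
  \<comment> \<open>The weights 4^k still leave a summable series, as (4/8)^k = 2^(-k). Where
    \<open>W\<close> is finite, the k-th increment is at most \<open>sqrt W / 2^k\<close>.\<close>
  define W where "W p = (\<Sum>k. ennreal (4 ^ k * (g (Suc k) p - g k p)\<^sup>2))" for p
  have Wm[measurable]: "W \<in> borel_measurable borel" unfolding W_def by measurable
  have "(\<integral>\<^sup>+p. W p \<partial>lborel) = (\<Sum>k. \<integral>\<^sup>+p. ennreal (4 ^ k * (g (Suc k) p - g k p)\<^sup>2) \<partial>lborel)"
    unfolding W_def by (rule nn_integral_suminf) simp
  also have "\<dots> \<le> (\<Sum>k. ennreal (\<bar>K\<bar> * (1/2) ^ k))"
  proof (rule suminf_le)
    fix k
    have i: "integrable lborel (\<lambda>p. 4 ^ k * (g (Suc k) p - g k p)\<^sup>2)" using sd[of k] by (simp add: sq_def)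
    have "(LBINT p. 4 ^ k * (g (Suc k) p - g k p)\<^sup>2) \<le> 4 ^ k * (\<bar>K\<bar> * (1/8) ^ k)"
    proof -
      have "K * (1/8) ^ k \<le> \<bar>K\<bar> * (1/8) ^ k" by (intro mult_right_mono) auto
      with K[of k] have "(LBINT p. (g (Suc k) p - g k p)\<^sup>2) \<le> \<bar>K\<bar> * (1/8) ^ k" by (rule order_trans)
      thus ?thesis by simp
    qed
    also have "\<dots> = \<bar>K\<bar> * (1/2) ^ k" by (simp add: power_mult_distrib[symmetric] mult.left_commute)
    finally show "(\<integral>\<^sup>+p. ennreal (4 ^ k * (g (Suc k) p - g k p)\<^sup>2) \<partial>lborel) \<le> ennreal (\<bar>K\<bar> * (1/2) ^ k)"
      by (subst nn_integral_eq_integral[OF i]) (auto intro: ennreal_leI)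
  qed auto
  also have "\<dots> = ennreal (\<Sum>k. \<bar>K\<bar> * (1/2) ^ k)"
    by (rule suminf_ennreal2) (auto intro!: summable_mult summable_geometric)
  also have "\<dots> < \<infinity>" by simp
  finally have Wfin: "(\<integral>\<^sup>+p. W p \<partial>lborel) < \<infinity>" .
  hence aeW: "AE p in lborel. W p \<noteq> \<infinity>" by (intro nn_integral_PInf_AE) auto
  \<comment> \<open>Where the sequence diverges \<open>lim\<close> has a default value, but that set
    is null. Off \<open>Omega l\<close> the sequence is constantly 0, so \<open>g'\<close> vanishes
    there exactly.\<close>
  define g' where "g' p = lim (\<lambda>n. g n p)" for p
  have [measurable]: "g' \<in> borel_measurable borel" unfolding g'_def by measurable
  have z: "g' p = 0" if "p \<notin> Omega l" for p
    using sq_outside[OF g that] by (simp add: g'_def)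
  have p4: "((2::real) ^ k)\<^sup>2 = 4 ^ k" for k
    by (simp add: power2_eq_square flip: power_mult_distrib)
  have pw: "(g n p - g' p)\<^sup>2 \<le> 4 * enn2real (W p) / 4 ^ n" if "W p \<noteq> \<infinity>" for p n
  proof -
    define w where "w = enn2real (W p)"
    have w: "W p = ennreal w" "w \<ge> 0" using that by (auto simp: w_def less_top)
    have "\<bar>g (Suc k) p - g k p\<bar> \<le> sqrt w / 2 ^ k" for k
    proof -
      have "ennreal (4 ^ k * (g (Suc k) p - g k p)\<^sup>2) \<le> W p"
      proof -
        have "sum (\<lambda>k. ennreal (4 ^ k * (g (Suc k) p - g k p)\<^sup>2)) {k} \<le> W p"
          unfolding W_def by (rule sum_le_suminf) auto
        thus ?thesis by simp
      qed
      hence "4 ^ k * (g (Suc k) p - g k p)\<^sup>2 \<le> w" using w by simp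
      hence "(2 ^ k * \<bar>g (Suc k) p - g k p\<bar>)\<^sup>2 \<le> w"
        by (simp add: power_mult_distrib p4)
      hence "2 ^ k * \<bar>g (Suc k) p - g k p\<bar> \<le> sqrt w" by (rule real_le_rsqrt)
      thus ?thesis by (simp add: field_simps)
    qed
    from geometric_increments(2)[OF this, of n] have "\<bar>g' p - g n p\<bar> \<le> 2 * sqrt w / 2 ^ n" by (simp add: g'_def)
    hence "\<bar>g' p - g n p\<bar>\<^sup>2 \<le> (2 * sqrt w / 2 ^ n)\<^sup>2" by (intro power_mono) auto
    also have "\<dots> = 4 * w / 4 ^ n"
      using w(2) by (simp add: power_divide power_mult_distrib p4)
    finally show ?thesis by (simp add: w_def power2_commute)
  qed
  define I where "I = enn2real (\<integral>\<^sup>+p. W p \<partial>lborel)"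
  have bd: "(\<integral>\<^sup>+p. ennreal ((g n p - g' p)\<^sup>2) \<partial>lborel) \<le> ennreal (4 * I / 4 ^ n)" for n
  proof -
    have "(\<integral>\<^sup>+p. ennreal ((g n p - g' p)\<^sup>2) \<partial>lborel) \<le> (\<integral>\<^sup>+p. ennreal (4 / 4 ^ n) * W p \<partial>lborel)"
    proof (rule nn_integral_mono_AE)
      show "AE p in lborel. ennreal ((g n p - g' p)\<^sup>2) \<le> ennreal (4 / 4 ^ n) * W p"
        using aeW
      proof eventually_elim
        case (elim p)
        have "ennreal ((g n p - g' p)\<^sup>2) \<le> ennreal (4 / 4 ^ n * enn2real (W p))"
          using pw[OF elim, of n] by (intro ennreal_leI) simp
        also have "\<dots> = ennreal (4 / 4 ^ n) * ennreal (enn2real (W p))" by (rule ennreal_mult) auto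
        also have "\<dots> = ennreal (4 / 4 ^ n) * W p" using elim by (simp add: less_top)
        finally show ?case .
      qed
    qed
    also have "\<dots> = ennreal (4 / 4 ^ n) * ennreal I" using Wfin by (simp add: nn_integral_cmult I_def)
    also have "\<dots> = ennreal (4 * I / 4 ^ n)" by (simp add: ennreal_mult[symmetric] I_def)
    finally show ?thesis .
  qed
  have sdiff: "sq l (\<lambda>p. g n p - g' p)" for n
  proof (rule sq_I_nn)
    show "(\<integral>\<^sup>+p. ennreal ((g n p - g' p)\<^sup>2) \<partial>lborel) < \<infinity>" using bd[of n] by (rule order_le_less_trans) simp
  qed (use z sq_outside[OF g] in auto)
  have s': "sq l g'" using sq_add[OF g[of 0] sdiff[of 0], of "-1"] by simp
  have "(LBINT p. (g n p - g' p)\<^sup>2) \<le> 4 * I / 4 ^ n" for n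
  proof -
    have "integrable lborel (\<lambda>p. (g n p - g' p)\<^sup>2)" using sdiff[of n] by (simp add: sq_def)
    hence "ennreal (LBINT p. (g n p - g' p)\<^sup>2) = (\<integral>\<^sup>+p. ennreal ((g n p - g' p)\<^sup>2) \<partial>lborel)"
      by (simp add: nn_integral_eq_integral)
    also note bd[of n]
    finally show ?thesis by (simp add: I_def)
  qed
  moreover have "(\<lambda>n. 4 * I / 4 ^ n) \<longlonglongrightarrow> 0"
  proof -
    have "(\<lambda>n. 4 * I * (1/4) ^ n) \<longlonglongrightarrow> 4 * I * 0" by (intro tendsto_intros LIMSEQ_power_zero) simp
    thus ?thesis by (simp add: power_divide)
  qed
  ultimately have "(\<lambda>n. LBINT p. (g n p - g' p)\<^sup>2) \<longlonglongrightarrow> 0"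
    by (rule_tac Lim_null_comparison[where g="\<lambda>n. 4 * I / 4 ^ n"]) (simp_all add: always_eventually)
  with s' show thesis by (rule that)
qed

section \<open>Linear structure of \<open>H2star\<close> and a membership criterion\<close>

lemma weak_deriv_add:
  assumes u: "continuous_on (Omegabar l) u" and v: "continuous_on (Omegabar l) v"
    and g: "sq l g" "weak_deriv (Omega l) ws u g" and h: "sq l h" "weak_deriv (Omega l) ws v h"
  shows "weak_deriv (Omega l) ws (\<lambda>p. u p + c * v p) (\<lambda>p. g p + c * h p)"
proof -
  have uv: "continuous_on (Omegabar l) (\<lambda>p. u p + c * v p)" using u v by (intro continuous_intros)
  show ?thesis
    unfolding weak_deriv_sq_iff[OF uv sq_add[OF g(1) h(1)]]
  proof (intro allI impI)
    fix \<phi> assume t: "test_fun (Omega l) \<phi>"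
    note t' = test_fun_Dw[OF t, of ws]
    have "(LBINT p. (u p + c * v p) * Dw ws \<phi> p)
      = (LBINT p. u p * Dw ws \<phi> p) + c * (LBINT p. v p * Dw ws \<phi> p)"
      using integrable_mult_test_fun[OF u t'] integrable_mult_test_fun[OF v t']
      by (simp add: distrib_right mult.assoc)
    also have "\<dots> = (-1) ^ length ws * ((LBINT p. g p * \<phi> p) + c * (LBINT p. h p * \<phi> p))"
      using g(2) h(2) t unfolding weak_deriv_sq_iff[OF u g(1)] weak_deriv_sq_iff[OF v h(1)]
      by (simp add: distrib_left mult.left_commute)
    also have "(LBINT p. g p * \<phi> p) + c * (LBINT p. h p * \<phi> p) = (LBINT p. (g p + c * h p) * \<phi> p)"
      using sq_mult_test_fun[OF g(1) t] sq_mult_test_fun[OF h(1) t]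
      by (simp add: distrib_right mult.assoc)
    finally show "(LBINT p. (u p + c * v p) * Dw ws \<phi> p) = (-1) ^ length ws * (LBINT p. (g p + c * h p) * \<phi> p)" .
  qed
qed

text \<open>A counterpart of \<open>wd\<close> that picks Borel representatives vanishing off the
  rectangle; by \<open>inner_rep\<close> they yield the same energy.\<close>

definition rep :: "real \<Rightarrow> bool list \<Rightarrow> (real \<times> real \<Rightarrow> real) \<Rightarrow> real \<times> real \<Rightarrow> real" where
  "rep l ws u = (SOME g. sq l g \<and> weak_deriv (Omega l) ws u g)"

lemma rep_props:
  assumes "H2star l u" "length ws \<in> {1, 2}"
  shows "sq l (rep l ws u)" "weak_deriv (Omega l) ws u (rep l ws u)"
proof -
  obtain g where "weak_deriv (Omega l) ws u g" using assms by (auto simp: H2star_def H2_def)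
  then obtain g' where "sq l g' \<and> weak_deriv (Omega l) ws u g'" using weak_deriv_ex_sq by metis
  hence "sq l (rep l ws u) \<and> weak_deriv (Omega l) ws u (rep l ws u)"     unfolding rep_def using someI[of "\<lambda>g. sq l g \<and> weak_deriv (Omega l) ws u g" g'] by blast
  thus "sq l (rep l ws u)" "weak_deriv (Omega l) ws u (rep l ws u)" by auto
qed

lemma H2star_continuous: "H2star l u \<Longrightarrow> continuous_on (Omegabar l) u"
  by (simp add: H2star_def)

text \<open>The definition prescribes zero on the open vertical sides. The corners follow by
  continuity; they matter later, as the gap is measured up to them.\<close>

lemma H2star_boundary:
  assumes "H2star l u" "l > 0" "x \<in> {0, pi}" "y \<in> {-l..l}"
  shows "u (x, y) = 0"
proof -
  have c: "continuous_on {-l..l} (\<lambda>y. u (x, y))"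
    using continuous_on_slice(1)[OF H2star_continuous[OF assms(1)], of x] assms(3) by auto
  have "closure {-l<..<l} = {-l..l}" using assms(2) by simp
  thus ?thesis
    using continuous_constant_on_closure[of "{-l<..<l}" "\<lambda>y. u (x, y)" 0 y] c assms by (auto simp: H2star_def)
qed

text \<open>Reduces membership to the three second derivatives that the energy controls. The first
  derivatives and \<open>u_yx\<close> come from the locale \<open>plate\<close>.\<close>

lemma H2starI:
  assumes l: "l > 0" and u: "continuous_on (Omegabar l) u"
    and bc: "\<And>x y. x \<in> {0, pi} \<Longrightarrow> y \<in> {-l..l} \<Longrightarrow> u (x, y) = 0"
    and g: "sq l g11" "weak_deriv (Omega l) [True, True] u g11"
      "sq l g12" "weak_deriv (Omega l) [True, False] u g12" "weak_deriv (Omega l) [False, False] u g22"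
  shows "H2star l u"
proof -
  obtain H \<eta> B where "vertical_mean l H \<eta> B" using vertical_mean_exists[OF l] .
  then interpret plate l H \<eta> B u g11 g12
    using u g bc by (intro plate.intro plate_axioms.intro) auto
  have "\<exists>g. weak_deriv (Omega l) ws u g" if ws: "length ws \<in> {1, 2}" for ws
  proof -
    have "ws \<in> {[True], [False], [True, True], [True, False], [False, True], [False, False]}"
      using ws by (auto simp: length_Suc_conv numeral_2_eq_2)
    thus ?thesis using weak_deriv_x weak_deriv_y(2) g weak_deriv_yx by blast
  qed
  thus ?thesis using L2_continuous[OF u] u bc by (auto simp: H2star_def H2_def)
qed

lemma H2star_add:
  assumes l: "l > 0" and u: "H2star l u" and v: "H2star l v"
  shows "H2star l (\<lambda>p. u p + c * v p)"
proof (rule H2starI[OF l])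
  note rp = rep_props[OF u] rep_props[OF v] H2star_continuous[OF u] H2star_continuous[OF v]
  show "continuous_on (Omegabar l) (\<lambda>p. u p + c * v p)" using rp by (intro continuous_intros)
  show "u (x, y) + c * v (x, y) = 0" if "x \<in> {0, pi}" "y \<in> {-l..l}" for x y
    using H2star_boundary[OF u l that] H2star_boundary[OF v l that] by simp
  show "weak_deriv (Omega l) [True, True] (\<lambda>p. u p + c * v p) (\<lambda>p. rep l [True, True] u p + c * rep l [True, True] v p)"
    "weak_deriv (Omega l) [True, False] (\<lambda>p. u p + c * v p) (\<lambda>p. rep l [True, False] u p + c * rep l [True, False] v p)"
    "weak_deriv (Omega l) [False, False] (\<lambda>p. u p + c * v p) (\<lambda>p. rep l [False, False] u p + c * rep l [False, False] v p)"
    by (rule weak_deriv_add; simp add: rp)+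
  show "sq l (\<lambda>p. rep l [True, True] u p + c * rep l [True, True] v p)"
    "sq l (\<lambda>p. rep l [True, False] u p + c * rep l [True, False] v p)" by (rule sq_add; simp add: rp)+
qed

lemma H2star_zero: assumes "l > 0" shows "H2star l (\<lambda>_. 0)"
proof (rule H2starI[OF assms])
  have s: "sq l (\<lambda>_. 0)" by (simp add: sq_def)
  thus "sq l (\<lambda>_. 0)" "sq l (\<lambda>_. 0)" by auto
  show "weak_deriv (Omega l) [True, True] (\<lambda>_. 0) (\<lambda>_. 0)" "weak_deriv (Omega l) [True, False] (\<lambda>_. 0) (\<lambda>_. 0)"
    "weak_deriv (Omega l) [False, False] (\<lambda>_. 0) (\<lambda>_. 0)"
    by (subst weak_deriv_sq_iff; simp add: s)+
qed auto

text \<open>The integrand of the plate energy as a bilinear form in two Hessians, with entries in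
  the order xx, xy, yy.\<close>

definition form :: "real \<Rightarrow> real \<Rightarrow> real \<Rightarrow> real \<Rightarrow> real \<Rightarrow> real \<Rightarrow> real \<Rightarrow> real" where
  "form \<sigma> a b c a' b' c' = (a + c) * (a' + c') + (1 - \<sigma>) * (2 * b * b' - a * c' - c * a')"

lemma form_expand: "form \<sigma> a b c a' b' c' = a * a' + c * c' + \<sigma> * (a * c') + \<sigma> * (c * a') + 2 * (1 - \<sigma>) * (b * b')"
  by (simp add: form_def algebra_simps)

lemma form_integrable:
  assumes "sq l a" "sq l b" "sq l c" "sq l a'" "sq l b'" "sq l c'"
  shows "integrable lborel (\<lambda>p. form \<sigma> (a p) (b p) (c p) (a' p) (b' p) (c' p))"
  unfolding form_expand using assms
  by (intro Bochner_Integration.integrable_add integrable_mult_right sq_integrable_mult)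

text \<open>By uniqueness almost everywhere the inner product can be computed from any
  representatives. Thus for sums, limits and reflections the obvious derivatives may be
  inserted.\<close>

lemma inner_rep:
  assumes l: "l > 0"
    and a: "sq l a" "weak_deriv (Omega l) [True, True] u a" and b: "sq l b" "weak_deriv (Omega l) [True, False] u b"
    and c: "sq l c" "weak_deriv (Omega l) [False, False] u c"
    and a': "sq l a'" "weak_deriv (Omega l) [True, True] v a'" and b': "sq l b'" "weak_deriv (Omega l) [True, False] v b'"
    and c': "sq l c'" "weak_deriv (Omega l) [False, False] v c'"
  shows "inner_H2star l \<sigma> u v = (LBINT p. form \<sigma> (a p) (b p) (c p) (a' p) (b' p) (c' p))"
proof -
  have wd: "weak_deriv (Omega l) ws w (wd (Omega l) ws w)" "AE p in lebesgue_on (Omega l). wd (Omega l) ws w p = g p"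
    "wd (Omega l) ws w \<in> borel_measurable (lebesgue_on (Omega l))"
    if "weak_deriv (Omega l) ws w g" for ws w g
  proof -
    show 1: "weak_deriv (Omega l) ws w (wd (Omega l) ws w)"
      unfolding wd_def using someI[of "weak_deriv (Omega l) ws w", OF that] .
    show "AE p in lebesgue_on (Omega l). wd (Omega l) ws w p = g p" by (rule weak_deriv_unique[OF l 1 that])
    show "wd (Omega l) ws w \<in> borel_measurable (lebesgue_on (Omega l))" using 1 by (simp add: weak_deriv_def L2_def)
  qed
  note m = wd(3)[OF a(2)] wd(3)[OF b(2)] wd(3)[OF c(2)] wd(3)[OF a'(2)] wd(3)[OF b'(2)] wd(3)[OF c'(2)]
  have bm: "a \<in> borel_measurable borel" "b \<in> borel_measurable borel" "c \<in> borel_measurable borel"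
    "a' \<in> borel_measurable borel" "b' \<in> borel_measurable borel" "c' \<in> borel_measurable borel"
    using assms by (auto simp: sq_def)
  have fm: "(\<lambda>p. form \<sigma> (a p) (b p) (c p) (a' p) (b' p) (c' p)) \<in> borel_measurable borel"
    unfolding form_def using bm by measurable
  have "inner_H2star l \<sigma> u v = integral\<^sup>L (lebesgue_on (Omega l)) (\<lambda>p. form \<sigma> (a p) (b p) (c p) (a' p) (b' p) (c' p))"
    unfolding inner_H2star_def Let_def
  proof (rule integral_cong_AE)
    show "AE p in lebesgue_on (Omega l). (wd (Omega l) [True, True] u p + wd (Omega l) [False, False] u p) *
        (wd (Omega l) [True, True] v p + wd (Omega l) [False, False] v p) +
        (1 - \<sigma>) * (2 * wd (Omega l) [True, False] u p * wd (Omega l) [True, False] v p -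
         wd (Omega l) [True, True] u p * wd (Omega l) [False, False] v p -
         wd (Omega l) [False, False] u p * wd (Omega l) [True, True] v p) = form \<sigma> (a p) (b p) (c p) (a' p) (b' p) (c' p)"
      using wd(2)[OF a(2)] wd(2)[OF b(2)] wd(2)[OF c(2)] wd(2)[OF a'(2)] wd(2)[OF b'(2)] wd(2)[OF c'(2)]
      by eventually_elim (simp add: form_def)
    show "(\<lambda>p. form \<sigma> (a p) (b p) (c p) (a' p) (b' p) (c' p)) \<in> borel_measurable (lebesgue_on (Omega l))"
      by (rule borel_measurable_lebesgue_on[OF fm])
  qed (use m in measurable)
  also have "\<dots> = (LBINT p. form \<sigma> (a p) (b p) (c p) (a' p) (b' p) (c' p))"
  proof (rule integral_lebesgue_on_Omega[OF fm])
    fix p assume "p \<notin> Omega l"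
    thus "form \<sigma> (a p) (b p) (c p) (a' p) (b' p) (c' p) = 0"
      using sq_outside[OF a(1)] sq_outside[OF b(1)] sq_outside[OF c(1)] by (simp add: form_def)
  qed
  finally show ?thesis .
qed

lemma inner_rep_std:
  assumes "l > 0" "H2star l u" "H2star l v"
  shows "inner_H2star l \<sigma> u v = (LBINT p. form \<sigma> (rep l [True,True] u p) (rep l [True,False] u p) (rep l [False,False] u p)
     (rep l [True,True] v p) (rep l [True,False] v p) (rep l [False,False] v p))"
  using rep_props[OF assms(2)] rep_props[OF assms(3)] by (intro inner_rep assms(1)) auto

lemma inner_sym: "inner_H2star l \<sigma> u v = inner_H2star l \<sigma> v u"
  unfolding inner_H2star_def Let_def by (intro Bochner_Integration.integral_cong) (auto simp: algebra_simps)

lemma inner_add_left: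
  assumes l: "l > 0" and u: "H2star l u" and v: "H2star l v" and w: "H2star l w"
  shows "inner_H2star l \<sigma> (\<lambda>p. u p + c * v p) w = inner_H2star l \<sigma> u w + c * inner_H2star l \<sigma> v w"
proof -
  note ru = rep_props[OF u] and rv = rep_props[OF v] and rw = rep_props[OF w]
  note wa = weak_deriv_add[OF H2star_continuous[OF u] H2star_continuous[OF v] ru rv]
  have "inner_H2star l \<sigma> (\<lambda>p. u p + c * v p) w = (LBINT p. form \<sigma>
      (rep l [True,True] u p + c * rep l [True,True] v p) (rep l [True,False] u p + c * rep l [True,False] v p)
      (rep l [False,False] u p + c * rep l [False,False] v p)
     (rep l [True,True] w p) (rep l [True,False] w p) (rep l [False,False] w p))"
    by (intro inner_rep l sq_add wa ru rv rw) auto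
  also have "\<dots> = (LBINT p. form \<sigma> (rep l [True,True] u p) (rep l [True,False] u p) (rep l [False,False] u p)
     (rep l [True,True] w p) (rep l [True,False] w p) (rep l [False,False] w p)
     + c * form \<sigma> (rep l [True,True] v p) (rep l [True,False] v p) (rep l [False,False] v p)
     (rep l [True,True] w p) (rep l [True,False] w p) (rep l [False,False] w p))"
    by (intro Bochner_Integration.integral_cong) (auto simp: form_def algebra_simps)
  also have "\<dots> = inner_H2star l \<sigma> u w + c * inner_H2star l \<sigma> v w"
    unfolding inner_rep_std[OF l u w] inner_rep_std[OF l v w]
  proof -
    have "integrable lborel (\<lambda>p. form \<sigma> (rep l [True,True] z p) (rep l [True,False] z p) (rep l [False,False] z p)
     (rep l [True,True] w p) (rep l [True,False] w p) (rep l [False,False] w p))" if "H2star l z" for z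
      using rep_props(1)[OF that] rw(1) by (intro form_integrable[of l]) auto
    from this[OF u] this[OF v] show "(LBINT p. form \<sigma> (rep l [True,True] u p) (rep l [True,False] u p) (rep l [False,False] u p)
     (rep l [True,True] w p) (rep l [True,False] w p) (rep l [False,False] w p)
     + c * form \<sigma> (rep l [True,True] v p) (rep l [True,False] v p) (rep l [False,False] v p)
     (rep l [True,True] w p) (rep l [True,False] w p) (rep l [False,False] w p)) =
     (LBINT p. form \<sigma> (rep l [True,True] u p) (rep l [True,False] u p) (rep l [False,False] u p)
     (rep l [True,True] w p) (rep l [True,False] w p) (rep l [False,False] w p))
     + c * (LBINT p. form \<sigma> (rep l [True,True] v p) (rep l [True,False] v p) (rep l [False,False] v p)
     (rep l [True,True] w p) (rep l [True,False] w p) (rep l [False,False] w p))"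
      by simp
  qed
  finally show ?thesis .
qed

text \<open>The difference of the two sides is the sum of squares
  \<open>\<sigma> * (a + c)^2 + (1 - \<sigma>) * b^2\<close>.\<close>

lemma form_lower:
  assumes "0 < \<sigma>" "\<sigma> < 1"
  shows "form \<sigma> a b c a b c \<ge> (1 - \<sigma>) * (a\<^sup>2 + b\<^sup>2 + c\<^sup>2)"
proof -
  have "form \<sigma> a b c a b c - (1 - \<sigma>) * (a\<^sup>2 + b\<^sup>2 + c\<^sup>2) = \<sigma> * (a + c)\<^sup>2 + (1 - \<sigma>) * b\<^sup>2"
    by (simp add: form_def power2_eq_square algebra_simps)
  also have "\<dots> \<ge> 0" using assms by (intro add_nonneg_nonneg mult_nonneg_nonneg) auto
  finally show ?thesis by simp
qed

lemma form_upper: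
  assumes "0 < \<sigma>" "\<sigma> < 1"
  shows "form \<sigma> a b c a b c \<le> 2 * (a\<^sup>2 + b\<^sup>2 + c\<^sup>2)"
proof -
  have "2 * (a\<^sup>2 + b\<^sup>2 + c\<^sup>2) - form \<sigma> a b c a b c = \<sigma> * (a - c)\<^sup>2 + (1 - \<sigma>) * (a\<^sup>2 + c\<^sup>2) + 2 * \<sigma> * b\<^sup>2"
    by (simp add: form_def power2_eq_square algebra_simps)
  also have "\<dots> \<ge> 0" using assms by (intro add_nonneg_nonneg mult_nonneg_nonneg) auto
  finally show ?thesis by simp
qed

section \<open>Coercivity, the sup bound and completeness of the energy space\<close>

locale plate_form =
  fixes l \<sigma> :: real
  assumes l: "l > 0" and \<sigma>: "0 < \<sigma>" "\<sigma> < 1"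
begin

abbreviation V where "V \<equiv> H2star l"
abbreviation bil where "bil \<equiv> inner_H2star l \<sigma>"

lemma coercive:
  assumes u: "V u" and ws: "ws \<in> {[True,True], [True,False], [False,False]}" and g: "sq l g" "weak_deriv (Omega l) ws u g"
  shows "(1 - \<sigma>) * (LBINT p. (g p)\<^sup>2) \<le> bil u u"
proof -
  note r = rep_props[OF u]
  \<comment> \<open>The given representative \<open>g\<close> takes its own slot in the Hessian, the
    other two slots are filled by \<open>rep\<close>; so \<open>g^2\<close> is one of the three
    squares pointwise.\<close>
  define a where "a = (if ws = [True,True] then g else rep l [True,True] u)"
  define b where "b = (if ws = [True,False] then g else rep l [True,False] u)"
  define c where "c = (if ws = [False,False] then g else rep l [False,False] u)"
  have abc: "sq l a" "weak_deriv (Omega l) [True,True] u a" "sq l b" "weak_deriv (Omega l) [True,False] u b"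
    "sq l c" "weak_deriv (Omega l) [False,False] u c"
    using r g by (auto simp: a_def b_def c_def)
  have gabc: "(g p)\<^sup>2 \<le> (a p)\<^sup>2 + (b p)\<^sup>2 + (c p)\<^sup>2" for p
    using ws by (auto simp: a_def b_def c_def)
  have "(1 - \<sigma>) * (LBINT p. (g p)\<^sup>2) = (LBINT p. (1 - \<sigma>) * (g p)\<^sup>2)" by simp
  also have "\<dots> \<le> (LBINT p. form \<sigma> (a p) (b p) (c p) (a p) (b p) (c p))"
  proof (rule integral_mono)
    show "integrable lborel (\<lambda>p. (1 - \<sigma>) * (g p)\<^sup>2)" using g by (simp add: sq_def)
    show "integrable lborel (\<lambda>p. form \<sigma> (a p) (b p) (c p) (a p) (b p) (c p))" by (rule form_integrable) (rule abc)+
    fix p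
    have "(1 - \<sigma>) * (g p)\<^sup>2 \<le> (1 - \<sigma>) * ((a p)\<^sup>2 + (b p)\<^sup>2 + (c p)\<^sup>2)" using gabc \<sigma> by (intro mult_left_mono) auto
    also have "\<dots> \<le> form \<sigma> (a p) (b p) (c p) (a p) (b p) (c p)" by (rule form_lower[OF \<sigma>])
    finally show "(1 - \<sigma>) * (g p)\<^sup>2 \<le> form \<sigma> (a p) (b p) (c p) (a p) (b p) (c p)" .
  qed
  also have "\<dots> = bil u u" using inner_rep[OF l abc abc] by simp
  finally show ?thesis .
qed

lemma bil_nonneg: assumes "V u" shows "bil u u \<ge> 0"
proof -
  have "0 \<le> (1 - \<sigma>) * (LBINT p. (rep l [True,True] u p)\<^sup>2)" using \<sigma> by simp
  also have "\<dots> \<le> bil u u" using rep_props[OF assms, of "[True,True]"] by (intro coercive[OF assms]) auto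
  finally show ?thesis .
qed

lemma sup_le_energy:
  obtains C where "C \<ge> 0" "\<And>u p. V u \<Longrightarrow> p \<in> Omegabar l \<Longrightarrow> \<bar>u p\<bar> \<le> C * sqrt (bil u u)"
proof -
  obtain H \<eta> B where vm: "vertical_mean l H \<eta> B" using vertical_mean_exists[OF l] .
  have B0: "B \<ge> 0" using vertical_mean.B[OF vm, of 0] abs_ge_zero[of "\<eta> 0"] by linarith
  \<comment> \<open>\<open>2 * pi * B\<close> and 1 are the coefficients in
    \<open>sup_bound\<close>; the square root comes from passing from L1 to L2 and from L2 to the
    energy.\<close>
  define C where "C = (2 * pi * B + 1) * sqrt (area l / (1 - \<sigma>))"
  show thesis
  proof (rule that[of C])
    show "C \<ge> 0" using B0 area_nonneg \<sigma> by (simp add: C_def)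
    fix u p assume u: "V u" and p: "p \<in> Omegabar l"
    note r = rep_props[OF u]
    have L1: "(LBINT p. \<bar>rep l ws u p\<bar>) \<le> sqrt (area l / (1 - \<sigma>)) * sqrt (bil u u)"
      if ws: "ws \<in> {[True,True], [True,False], [False,False]}" for ws
    proof -
      have s: "sq l (rep l ws u)" "weak_deriv (Omega l) ws u (rep l ws u)" using r ws by auto
      have "(LBINT p. \<bar>rep l ws u p\<bar>)\<^sup>2 \<le> area l * (LBINT p. (rep l ws u p)\<^sup>2)"
        by (rule sq_L1_le_L2[OF s(1)])
      also have "\<dots> \<le> area l * (bil u u / (1 - \<sigma>))"
        using coercive[OF u ws s] \<sigma> area_nonneg by (intro mult_left_mono) (auto simp: field_simps)
      finally have "(LBINT p. \<bar>rep l ws u p\<bar>) \<le> sqrt (area l * (bil u u / (1 - \<sigma>)))" by (rule real_le_rsqrt)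
      thus ?thesis by (simp add: real_sqrt_mult[symmetric])
    qed
    interpret plate l H \<eta> B u "rep l [True,True] u" "rep l [True,False] u"
      using vm u r H2star_boundary[OF u l] H2star_continuous[OF u]
      by (intro plate.intro) (auto simp: plate_axioms_def)
    have "\<bar>u p\<bar> \<le> 2 * pi * B * (LBINT p. \<bar>rep l [True,True] u p\<bar>) + (LBINT p. \<bar>rep l [True,False] u p\<bar>)"
      by (rule sup_bound[OF p])
    also have "\<dots> \<le> 2 * pi * B * (sqrt (area l / (1 - \<sigma>)) * sqrt (bil u u)) + sqrt (area l / (1 - \<sigma>)) * sqrt (bil u u)"
      using B0 L1 by (intro add_mono mult_left_mono) auto
    also have "\<dots> = C * sqrt (bil u u)" by (simp add: C_def algebra_simps)
    finally show "\<bar>u p\<bar> \<le> C * sqrt (bil u u)" .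
  qed
qed

text \<open>The geometric rate serves twice: through the sup bound the functions converge uniformly,
  and through coercivity their second derivatives fall under \<open>L2_complete\<close>. The weak
  identities pass to the limit, so the two limits belong together.\<close>

lemma complete:
  assumes v: "\<And>n. V (v n)" and d: "\<And>n. bil (\<lambda>p. v (Suc n) p - v n p) (\<lambda>p. v (Suc n) p - v n p) \<le> (1/8) ^ n"
  obtains w where "V w" "\<And>p. p \<in> Omegabar l \<Longrightarrow> (\<lambda>n. v n p) \<longlonglongrightarrow> w p"
    "(\<lambda>n. bil (\<lambda>p. v n p - w p) (\<lambda>p. v n p - w p)) \<longlonglongrightarrow> 0"
proof -
  have Vd: "V (\<lambda>p. x p - y p)" if "V x" "V y" for x y
    using H2star_add[OF l that, of "-1"] by simp
  obtain C where C: "C \<ge> 0" "\<And>u p. V u \<Longrightarrow> p \<in> Omegabar l \<Longrightarrow> \<bar>u p\<bar> \<le> C * sqrt (bil u u)" by (rule sup_le_energy) blast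
  define w where "w p = lim (\<lambda>n. v n p)" for p
  have inc: "\<bar>v (Suc n) p - v n p\<bar> \<le> C / 2 ^ n" if p: "p \<in> Omegabar l" for n p
  proof -
    have "\<bar>v (Suc n) p - v n p\<bar> \<le> C * sqrt (bil (\<lambda>p. v (Suc n) p - v n p) (\<lambda>p. v (Suc n) p - v n p))"
      by (rule C(2)[OF Vd[OF v v] p])
    also have "\<dots> \<le> C * (1/2) ^ n"
    proof (intro mult_left_mono C)
      \<comment> \<open>The sup bound involves the square root of the energy, so 8^(-n) is weakened
        to the perfect square 4^(-n).\<close>
      have "(1/8 :: real) ^ n \<le> (1/4) ^ n" by (rule power_mono) auto
      also have "(1/4 :: real) ^ n = ((1/2) ^ n)\<^sup>2" by (simp add: power2_eq_square power_mult_distrib[symmetric])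
      finally show "sqrt (bil (\<lambda>p. v (Suc n) p - v n p) (\<lambda>p. v (Suc n) p - v n p)) \<le> (1/2) ^ n"
        using d[of n] by (intro real_le_lsqrt) (auto intro: order_trans)
    qed
    finally show ?thesis by (simp add: power_divide)
  qed
  have lim: "(\<lambda>n. v n p) \<longlonglongrightarrow> w p" and unif: "\<bar>w p - v n p\<bar> \<le> 2 * C / 2 ^ n" if p: "p \<in> Omegabar l" for p n
    using geometric_increments[of "\<lambda>n. v n p", OF inc[OF p]] by (auto simp: w_def convergent_LIMSEQ_iff)
  have small: "(\<lambda>n. 2 * C / 2 ^ n) \<longlonglongrightarrow> 0"
  proof -
    have "(\<lambda>n. 2 * C * (1/2) ^ n) \<longlonglongrightarrow> 2 * C * 0" by (intro tendsto_intros LIMSEQ_power_zero) simp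
    thus ?thesis by (simp add: power_divide)
  qed
  have "uniform_limit (Omegabar l) v w sequentially"
  proof (rule uniform_limitI)
    fix e :: real assume "e > 0"
    hence "eventually (\<lambda>n. 2 * C / 2 ^ n < e) sequentially" using small by (intro order_tendstoD) auto
    thus "eventually (\<lambda>n. \<forall>p\<in>Omegabar l. dist (v n p) (w p) < e) sequentially"
    proof eventually_elim
      case (elim n)
      have "dist (v n p) (w p) \<le> 2 * C / 2 ^ n" if "p \<in> Omegabar l" for p
        using unif[OF that, of n] by (simp add: dist_real_def abs_minus_commute)
      with elim show ?case by (meson order_le_less_trans)
    qed
  qed
  hence wc: "continuous_on (Omegabar l) w"
    by (rule uniform_limit_theorem[rotated]) (simp_all add: H2star_continuous[OF v])
  \<comment> \<open>In the weak identity the left side converges by uniform convergence of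
    \<open>v n\<close>, the right side by L2 convergence of the derivatives against a bounded test
    function.\<close>
  have der: "\<exists>g'. sq l g' \<and> weak_deriv (Omega l) ws w g' \<and> (\<lambda>n. LBINT p. (rep l ws (v n) p - g' p)\<^sup>2) \<longlonglongrightarrow> 0"
    if ws: "ws \<in> {[True,True], [True,False], [False,False]}" for ws
  proof -
    define g where "g n = rep l ws (v n)" for n
    have g: "sq l (g n)" "weak_deriv (Omega l) ws (v n) (g n)" for n
      using rep_props[OF v, of ws n] ws by (auto simp: g_def)
    have bd: "(LBINT p. (g (Suc n) p - g n p)\<^sup>2) \<le> 1 / (1 - \<sigma>) * (1/8) ^ n" for n
    proof -
      have sd: "sq l (\<lambda>p. g (Suc n) p - g n p)" using sq_add[OF g(1)[of "Suc n"] g(1)[of n], of "-1"] by simp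
      have wdd: "weak_deriv (Omega l) ws (\<lambda>p. v (Suc n) p - v n p) (\<lambda>p. g (Suc n) p - g n p)"
        using weak_deriv_add[OF H2star_continuous[OF v[of "Suc n"]] H2star_continuous[OF v[of n]] g[of "Suc n"] g[of n], of "-1"] by simp
      have "(1 - \<sigma>) * (LBINT p. (g (Suc n) p - g n p)\<^sup>2) \<le> (1/8) ^ n"
        using coercive[OF Vd[OF v v] ws sd wdd] d[of n] by (rule order_trans)
      thus ?thesis using \<sigma> by (simp add: field_simps)
    qed
    obtain g' where g': "sq l g'" "(\<lambda>n. LBINT p. (g n p - g' p)\<^sup>2) \<longlonglongrightarrow> 0"
      using L2_complete[OF g(1) bd] .
    have "weak_deriv (Omega l) ws w g'"
      unfolding weak_deriv_sq_iff[OF wc g'(1)]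
    proof (intro allI impI)
      fix \<phi> assume t: "test_fun (Omega l) \<phi>"
      note t' = test_fun_Dw[OF t, of ws]
      let ?\<psi> = "Dw ws \<phi>"
      have psi: "integrable lborel ?\<psi>" using integrable_mult_test_fun[OF continuous_on_const[of _ 1] t'] by simp
      have 1: "(\<lambda>n. LBINT p. v n p * ?\<psi> p) \<longlonglongrightarrow> (LBINT p. w p * ?\<psi> p)"
      proof (rule LIM_zero_cancel, rule Lim_null_comparison)
        show "(\<lambda>n. 2 * C / 2 ^ n * (LBINT p. \<bar>?\<psi> p\<bar>)) \<longlonglongrightarrow> 0"
          by (rule tendsto_mult_left_zero[OF small])
        show "eventually (\<lambda>n. norm ((LBINT p. v n p * ?\<psi> p) - (LBINT p. w p * ?\<psi> p)) \<le> 2 * C / 2 ^ n * (LBINT p. \<bar>?\<psi> p\<bar>)) sequentially"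
        proof (rule always_eventually, rule allI)
          fix n
          note i = integrable_mult_test_fun[OF H2star_continuous[OF v] t', of n] integrable_mult_test_fun[OF wc t']
          have "(LBINT p. v n p * ?\<psi> p) - (LBINT p. w p * ?\<psi> p) = (LBINT p. (v n p - w p) * ?\<psi> p)"
            using i by (simp add: left_diff_distrib)
          also have "\<bar>\<dots>\<bar> \<le> (LBINT p. \<bar>(v n p - w p) * ?\<psi> p\<bar>)" by (rule integral_abs_bound)
          also have "\<dots> \<le> (LBINT p. 2 * C / 2 ^ n * \<bar>?\<psi> p\<bar>)"
          proof (rule integral_mono)
            show "integrable lborel (\<lambda>p. \<bar>(v n p - w p) * ?\<psi> p\<bar>)" using i by (simp add: left_diff_distrib)
            show "integrable lborel (\<lambda>p. 2 * C / 2 ^ n * \<bar>?\<psi> p\<bar>)" using psi by simp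
            fix p show "\<bar>(v n p - w p) * ?\<psi> p\<bar> \<le> 2 * C / 2 ^ n * \<bar>?\<psi> p\<bar>"
            proof (cases "p \<in> Omega l")
              case True
              hence "p \<in> Omegabar l" using Omega_subset by blast
              thus ?thesis using unif[of p n] unfolding abs_mult by (intro mult_right_mono) (auto simp: abs_minus_commute)
            next
              case False
              thus ?thesis using test_fun_outside[OF t'] by simp
            qed
          qed
          also have "\<dots> = 2 * C / 2 ^ n * (LBINT p. \<bar>?\<psi> p\<bar>)" by simp
          finally show "norm ((LBINT p. v n p * ?\<psi> p) - (LBINT p. w p * ?\<psi> p)) \<le> 2 * C / 2 ^ n * (LBINT p. \<bar>?\<psi> p\<bar>)" by simp
        qed
      qed
      obtain B where B: "\<And>x. \<bar>\<phi> x\<bar> \<le> B" "B \<ge> 0" using test_fun_bounded[OF t] by blast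
      have 2: "(\<lambda>n. LBINT p. g n p * \<phi> p) \<longlonglongrightarrow> (LBINT p. g' p * \<phi> p)"
      proof (rule LIM_zero_cancel, rule Lim_null_comparison)
        have "(\<lambda>n. B * sqrt (area l * (LBINT p. (g n p - g' p)\<^sup>2))) \<longlonglongrightarrow> B * sqrt (area l * 0)"
          by (intro tendsto_intros g')
        thus "(\<lambda>n. B * sqrt (area l * (LBINT p. (g n p - g' p)\<^sup>2))) \<longlonglongrightarrow> 0" by simp
        show "eventually (\<lambda>n. norm ((LBINT p. g n p * \<phi> p) - (LBINT p. g' p * \<phi> p)) \<le> B * sqrt (area l * (LBINT p. (g n p - g' p)\<^sup>2))) sequentially"
        proof (rule always_eventually, rule allI)
          fix n
          have sd: "sq l (\<lambda>p. g n p - g' p)" using sq_add[OF g(1)[of n] g'(1), of "-1"] by simp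
          note i = sq_mult_test_fun[OF g(1) t, of n] sq_mult_test_fun[OF g'(1) t]
          have "(LBINT p. g n p * \<phi> p) - (LBINT p. g' p * \<phi> p) = (LBINT p. (g n p - g' p) * \<phi> p)"
            using i by (simp add: left_diff_distrib)
          also have "\<bar>\<dots>\<bar> \<le> (LBINT p. \<bar>(g n p - g' p) * \<phi> p\<bar>)" by (rule integral_abs_bound)
          also have "\<dots> \<le> (LBINT p. B * \<bar>g n p - g' p\<bar>)"
          proof (rule integral_mono)
            show "integrable lborel (\<lambda>p. \<bar>(g n p - g' p) * \<phi> p\<bar>)" using i by (simp add: left_diff_distrib)
            show "integrable lborel (\<lambda>p. B * \<bar>g n p - g' p\<bar>)" using sq_integrable[OF sd] by simp
            fix p show "\<bar>(g n p - g' p) * \<phi> p\<bar> \<le> B * \<bar>g n p - g' p\<bar>"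
              unfolding abs_mult using B(1)[of p] by (subst mult.commute) (intro mult_right_mono, auto)
          qed
          also have "\<dots> = B * (LBINT p. \<bar>g n p - g' p\<bar>)" by simp
          also have "\<dots> \<le> B * sqrt (area l * (LBINT p. (g n p - g' p)\<^sup>2))"
            using sq_L1_le_L2[OF sd] B(2) by (intro mult_left_mono real_le_rsqrt)
          finally show "norm ((LBINT p. g n p * \<phi> p) - (LBINT p. g' p * \<phi> p)) \<le> B * sqrt (area l * (LBINT p. (g n p - g' p)\<^sup>2))" by simp
        qed
      qed
      have "(LBINT p. v n p * ?\<psi> p) = (-1) ^ length ws * (LBINT p. g n p * \<phi> p)" for n
        using g(2)[of n] t unfolding weak_deriv_sq_iff[OF H2star_continuous[OF v] g(1)] by blast
      with 1 have "(\<lambda>n. (-1) ^ length ws * (LBINT p. g n p * \<phi> p)) \<longlonglongrightarrow> (LBINT p. w p * ?\<psi> p)" by simp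
      moreover have "(\<lambda>n. (-1) ^ length ws * (LBINT p. g n p * \<phi> p)) \<longlonglongrightarrow> (-1) ^ length ws * (LBINT p. g' p * \<phi> p)"
        by (intro tendsto_intros 2)
      ultimately show "(LBINT p. w p * ?\<psi> p) = (-1) ^ length ws * (LBINT p. g' p * \<phi> p)"
        by (rule LIMSEQ_unique)
    qed
    with g' show ?thesis by (auto simp: g_def)
  qed
  obtain a where a: "sq l a" "weak_deriv (Omega l) [True,True] w a" "(\<lambda>n. LBINT p. (rep l [True,True] (v n) p - a p)\<^sup>2) \<longlonglongrightarrow> 0"
    using der[of "[True,True]"] by auto
  obtain b where b: "sq l b" "weak_deriv (Omega l) [True,False] w b" "(\<lambda>n. LBINT p. (rep l [True,False] (v n) p - b p)\<^sup>2) \<longlonglongrightarrow> 0"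
    using der[of "[True,False]"] by auto
  obtain c where c: "sq l c" "weak_deriv (Omega l) [False,False] w c" "(\<lambda>n. LBINT p. (rep l [False,False] (v n) p - c p)\<^sup>2) \<longlonglongrightarrow> 0"
    using der[of "[False,False]"] by auto
  have Vw: "V w"
  proof (rule H2starI[OF l wc _ a(1,2) b(1,2) c(2)])
    fix x y :: real assume xy: "x \<in> {0, pi}" "y \<in> {-l..l}"
    have "(x, y) \<in> Omegabar l" using xy pi_ge_zero by (auto simp: Omegabar_def)
    from lim[OF this] have "(\<lambda>n. 0) \<longlonglongrightarrow> w (x, y)" using H2star_boundary[OF v l xy] by simp
    thus "w (x, y) = 0" using LIMSEQ_unique tendsto_const by blast
  qed
  \<comment> \<open>The energy of the difference is at most twice the sum of the squared L2
    distances, by \<open>form_upper\<close>.\<close>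
  have "(\<lambda>n. bil (\<lambda>p. v n p - w p) (\<lambda>p. v n p - w p)) \<longlonglongrightarrow> 0"
  proof (rule Lim_null_comparison)
    let ?S = "\<lambda>n. 2 * ((LBINT p. (rep l [True,True] (v n) p - a p)\<^sup>2) + (LBINT p. (rep l [True,False] (v n) p - b p)\<^sup>2)
       + (LBINT p. (rep l [False,False] (v n) p - c p)\<^sup>2))"
    have "?S \<longlonglongrightarrow> 2 * (0 + 0 + 0)" by (intro tendsto_intros a b c)
    thus "?S \<longlonglongrightarrow> 0" by simp
    show "eventually (\<lambda>n. norm (bil (\<lambda>p. v n p - w p) (\<lambda>p. v n p - w p)) \<le> ?S n) sequentially"
    proof (rule always_eventually, rule allI)
      fix n
      note r = rep_props[OF v, of _ n]
      let ?a = "\<lambda>p. rep l [True,True] (v n) p - a p" and ?b = "\<lambda>p. rep l [True,False] (v n) p - b p"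
        and ?c = "\<lambda>p. rep l [False,False] (v n) p - c p"
      have d: "sq l (\<lambda>p. rep l ws (v n) p - g p)" "weak_deriv (Omega l) ws (\<lambda>p. v n p - w p) (\<lambda>p. rep l ws (v n) p - g p)"
        if "sq l g" "weak_deriv (Omega l) ws w g" "length ws \<in> {1, 2}" for ws g
        using sq_add[OF r(1)[OF that(3)] that(1), of "-1"]
          weak_deriv_add[OF H2star_continuous[OF v] wc r[OF that(3)] that(1,2), of "-1"] by simp_all
      have s: "sq l ?a" "sq l ?b" "sq l ?c" using d a b c by auto
      have i: "integrable lborel (\<lambda>p. (?a p)\<^sup>2)" "integrable lborel (\<lambda>p. (?b p)\<^sup>2)" "integrable lborel (\<lambda>p. (?c p)\<^sup>2)"
        using s by (simp_all add: sq_def)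
      have "bil (\<lambda>p. v n p - w p) (\<lambda>p. v n p - w p) = (LBINT p. form \<sigma> (?a p) (?b p) (?c p) (?a p) (?b p) (?c p))"
        using d a b c by (intro inner_rep l) auto
      also have "\<dots> \<le> (LBINT p. 2 * ((?a p)\<^sup>2 + (?b p)\<^sup>2 + (?c p)\<^sup>2))"
      proof (rule integral_mono)
        show "integrable lborel (\<lambda>p. form \<sigma> (?a p) (?b p) (?c p) (?a p) (?b p) (?c p))"
          by (rule form_integrable[OF s s])
      qed (use i form_upper[OF \<sigma>] in auto)
      also have "\<dots> = ?S n" using i by simp
      finally show "norm (bil (\<lambda>p. v n p - w p) (\<lambda>p. v n p - w p)) \<le> ?S n"
        using bil_nonneg[OF Vd[OF v Vw], of n] by simp
    qed
  qed
  with Vw lim show thesis by (rule that)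
qed

end

section \<open>The obstacle problem\<close>

context plate_form
begin

lemma V_add: "V u \<Longrightarrow> V v \<Longrightarrow> V (\<lambda>p. u p + c * v p)"
  by (rule H2star_add[OF l])

lemma V_diff: "V u \<Longrightarrow> V v \<Longrightarrow> V (\<lambda>p. u p - v p)"
  using V_add[of u v "-1"] by simp

lemma bil_add_left: "V u \<Longrightarrow> V v \<Longrightarrow> V w \<Longrightarrow> bil (\<lambda>p. u p + c * v p) w = bil u w + c * bil v w"
  by (rule inner_add_left[OF l])

lemma bil_add_right: "V u \<Longrightarrow> V v \<Longrightarrow> V w \<Longrightarrow> bil w (\<lambda>p. u p + c * v p) = bil w u + c * bil w v"
  using bil_add_left[of u v w c] by (simp add: inner_sym[of l \<sigma> w])

lemma bil_diff_left: "V u \<Longrightarrow> V v \<Longrightarrow> V w \<Longrightarrow> bil (\<lambda>p. u p - v p) w = bil u w - bil v w"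
  using bil_add_left[of u v w "-1"] by simp

lemma bil_diff_right: "V u \<Longrightarrow> V v \<Longrightarrow> V w \<Longrightarrow> bil w (\<lambda>p. u p - v p) = bil w u - bil w v"
  using bil_add_right[of u v w "-1"] by simp

lemma bil_quadratic:
  assumes "V u" "V v"
  shows "bil (\<lambda>p. u p + t * v p) (\<lambda>p. u p + t * v p) = bil u u + 2 * t * bil u v + t\<^sup>2 * bil v v"
proof -
  have "bil (\<lambda>p. u p + t * v p) (\<lambda>p. u p + t * v p) = bil u (\<lambda>p. u p + t * v p) + t * bil v (\<lambda>p. u p + t * v p)"
    using assms V_add by (intro bil_add_left)
  also have "bil u (\<lambda>p. u p + t * v p) = bil u u + t * bil u v" using assms by (intro bil_add_right)
  also have "bil v (\<lambda>p. u p + t * v p) = bil v u + t * bil v v" using assms by (intro bil_add_right)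
  also have "bil v u = bil u v" by (rule inner_sym)
  finally show ?thesis by (simp add: power2_eq_square algebra_simps)
qed

lemma bil_Cauchy_Schwarz:
  assumes "V u" "V v" shows "\<bar>bil u v\<bar> \<le> sqrt (bil u u) * sqrt (bil v v)"
proof -
  have "(bil u v)\<^sup>2 \<le> bil u u * bil v v"
  proof (rule quadratic_nonneg_imp)
    fix t
    show "0 \<le> bil u u + 2 * t * bil u v + t\<^sup>2 * bil v v"
      using bil_nonneg[OF V_add[OF assms, of t]] bil_quadratic[OF assms, of t] by simp
  qed (rule bil_nonneg[OF assms(2)])
  hence "\<bar>bil u v\<bar>\<^sup>2 \<le> bil u u * bil v v" by simp
  hence "\<bar>bil u v\<bar> \<le> sqrt (bil u u * bil v v)" by (rule real_le_rsqrt)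
  thus ?thesis by (simp add: real_sqrt_mult)
qed

lemma F_odd_linear:
  assumes "f \<in> F_odd l" "continuous_on (Omegabar l) u" "continuous_on (Omegabar l) v"
  shows "f (\<lambda>p. u p + c * v p) = f u + c * f v"
proof -
  have "continuous_on (Omegabar l) (\<lambda>p. c * v p)" using assms(3) by (intro continuous_intros)
  thus ?thesis using assms by (simp add: F_odd_def)
qed

lemma F_odd_uminus:
  assumes "f \<in> F_odd l" "continuous_on (Omegabar l) u" shows "f (\<lambda>p. - u p) = - f u"
proof -
  have "f (\<lambda>p. (-1) * u p) = (-1) * f u" using assms unfolding F_odd_def by blast
  thus ?thesis by simp
qed

lemma Omegabar_ne: "Omegabar l \<noteq> {}"
  using l by (auto simp: Omegabar_def)

lemma F_odd_le_energy:
  assumes f: "f \<in> F_odd l"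
  obtains C where "C \<ge> 0" "\<And>u. V u \<Longrightarrow> \<bar>f u\<bar> \<le> C * sqrt (bil u u)"
proof -
  obtain C where C: "C \<ge> 0" "\<And>u p. V u \<Longrightarrow> p \<in> Omegabar l \<Longrightarrow> \<bar>u p\<bar> \<le> C * sqrt (bil u u)"
    by (rule sup_le_energy) blast
  show thesis
  proof (rule that[OF C(1)])
    fix u assume u: "V u"
    have "\<bar>f u\<bar> \<le> Sup ((\<lambda>p. \<bar>u p\<bar>) ` Omegabar l)"
      using f H2star_continuous[OF u] by (simp add: F_odd_def)
    also have "\<dots> \<le> C * sqrt (bil u u)"
      using C(2)[OF u] Omegabar_ne by (intro cSup_least) auto
    finally show "\<bar>f u\<bar> \<le> C * sqrt (bil u u)" .
  qed
qed

text \<open>The direct method for \<open>J u = bil u u / 2 - f u\<close> on the convex set of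
  admissible functions. The parallelogram identity makes a minimising sequence Cauchy in energy, so
  its limit is a minimiser, and the variational inequality is the first variation along
  segments.\<close>

lemma solution_exists:
  assumes f: "f \<in> F_odd l" and O: "OmO \<subseteq> Omegabar l" and \<psi>: "\<And>p. p \<in> OmO \<Longrightarrow> \<psi> p \<ge> 0"
  obtains u where "is_u l \<sigma> OmO f \<psi> u"
proof -
  obtain C where C: "C \<ge> 0" "\<And>u. V u \<Longrightarrow> \<bar>f u\<bar> \<le> C * sqrt (bil u u)" using F_odd_le_energy[OF f] by blast
  define K where "K = K_psi l OmO \<psi>"
  have KV: "V u" if "u \<in> K" for u using that by (simp add: K_def K_psi_def)
  define J where "J u = bil u u / 2 - f u" for u
  have Jlow: "J u \<ge> - (C\<^sup>2 / 2)" if "V u" for u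
  proof -
    define s where "s = sqrt (bil u u)"
    have s: "bil u u = s\<^sup>2" using bil_nonneg[OF that] by (simp add: s_def)
    \<comment> \<open>Completing the square bounds \<open>J\<close> below, with \<open>f u\<close>
      absorbed by the energy.\<close>
    have "0 \<le> (s - C)\<^sup>2" by simp
    hence "C * s \<le> s\<^sup>2 / 2 + C\<^sup>2 / 2" by (simp add: power2_eq_square algebra_simps)
    moreover have "f u \<le> C * s" using C(2)[OF that] unfolding s_def by linarith
    ultimately show ?thesis by (simp add: J_def s)
  qed
  have K0: "(\<lambda>_. 0) \<in> K" using H2star_zero[OF l] \<psi> by (auto simp: K_def K_psi_def)
  have Kconv: "(\<lambda>p. u p + t * (v p - u p)) \<in> K" if "u \<in> K" "v \<in> K" "0 \<le> t" "t \<le> 1" for u v t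
  proof -
    have "- \<psi> p \<le> u p + t * (v p - u p) \<and> u p + t * (v p - u p) \<le> \<psi> p" if "p \<in> OmO" for p
    proof -
      have b: "- \<psi> p \<le> u p" "u p \<le> \<psi> p" "- \<psi> p \<le> v p" "v p \<le> \<psi> p"
        using \<open>u \<in> K\<close> \<open>v \<in> K\<close> \<open>p \<in> OmO\<close> by (auto simp: K_def K_psi_def)
      have e: "u p + t * (v p - u p) = (1 - t) * u p + t * v p" by (simp add: algebra_simps)
      have "(1 - t) * u p + t * v p \<le> (1 - t) * \<psi> p + t * \<psi> p"
        using b \<open>0 \<le> t\<close> \<open>t \<le> 1\<close> by (intro add_mono mult_left_mono) auto
      moreover have "(1 - t) * (- \<psi> p) + t * (- \<psi> p) \<le> (1 - t) * u p + t * v p"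
        using b \<open>0 \<le> t\<close> \<open>t \<le> 1\<close> by (intro add_mono mult_left_mono) auto
      ultimately show ?thesis unfolding e by (simp add: algebra_simps)
    qed
    moreover have "V (\<lambda>p. u p + t * (v p - u p))" by (intro V_add V_diff KV that)
    ultimately show ?thesis by (simp add: K_def K_psi_def)
  qed
  have Jstep: "J (\<lambda>p. u p + t * w p) = J u + t * (bil u w - f w) + t\<^sup>2 / 2 * bil w w" if "V u" "V w" for u w t
    using bil_quadratic[OF that, of t] F_odd_linear[OF f H2star_continuous[OF that(1)] H2star_continuous[OF that(2)], of t]
    by (simp add: J_def algebra_simps)
  define d where "d = Inf (J ` K)"
  have bdd: "bdd_below (J ` K)" using Jlow KV by (auto intro!: bdd_belowI[of _ "- (C\<^sup>2 / 2)"])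
  have dle: "d \<le> J u" if "u \<in> K" for u unfolding d_def using that bdd by (intro cInf_lower) auto
  \<comment> \<open>The tolerance is fixed in advance so that the increments meet the rate required
    by \<open>complete\<close>.\<close>
  have "\<exists>u. u \<in> K \<and> J u < d + (1/8) ^ n / 16" for n
  proof -
    have "Inf (J ` K) < d + (1/8) ^ n / 16" by (simp add: d_def)
    from cInf_lessD[OF _ this] K0 show ?thesis by auto
  qed
  then obtain v where v: "\<And>n. v n \<in> K" "\<And>n. J (v n) < d + (1/8) ^ n / 16" by metis
  have Vv: "V (v n)" for n using v KV by blast
  have inc: "bil (\<lambda>p. v (Suc n) p - v n p) (\<lambda>p. v (Suc n) p - v n p) \<le> (1/8) ^ n" for n
  proof -
    let ?w = "\<lambda>p. v (Suc n) p - v n p"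
    have Vw: "V ?w" by (rule V_diff[OF Vv Vv])
    \<comment> \<open>The average of \<open>J\<close> at \<open>v n\<close> and
      \<open>v (Suc n)\<close> exceeds its value at the midpoint, hence \<open>d\<close>, by one
      eighth of the energy of their difference. The factor 1/16 in the tolerance absorbs this
      8.\<close>
    have "d \<le> J (\<lambda>p. v n p + 1/2 * ?w p)" by (intro dle Kconv v) auto
    also have "\<dots> = J (v n) + 1/2 * (bil (v n) ?w - f ?w) + 1/8 * bil ?w ?w"
      using Jstep[OF Vv Vw, of n "1/2"] by (simp add: power2_eq_square)
    finally have 1: "d \<le> J (v n) + 1/2 * (bil (v n) ?w - f ?w) + 1/8 * bil ?w ?w" .
    have "(\<lambda>p. v n p + 1 * ?w p) = v (Suc n)" by (simp add: fun_eq_iff)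
    with Jstep[OF Vv Vw, of n 1] have 2: "J (v (Suc n)) = J (v n) + (bil (v n) ?w - f ?w) + 1/2 * bil ?w ?w" by simp
    have "(1/8 :: real) ^ Suc n \<le> (1/8) ^ n" "0 \<le> (1/8 :: real) ^ n" by simp_all
    thus ?thesis using 1 2 v(2)[of n] v(2)[of "Suc n"] by argo
  qed
  obtain w where w: "V w" "\<And>p. p \<in> Omegabar l \<Longrightarrow> (\<lambda>n. v n p) \<longlonglongrightarrow> w p"
    "(\<lambda>n. bil (\<lambda>p. v n p - w p) (\<lambda>p. v n p - w p)) \<longlonglongrightarrow> 0"
    using complete[of v, OF Vv inc] by blast
  have wK: "w \<in> K"
  proof -
    have "- \<psi> p \<le> w p \<and> w p \<le> \<psi> p" if "p \<in> OmO" for p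
    proof -
      have "\<And>n. - \<psi> p \<le> v n p \<and> v n p \<le> \<psi> p" using v(1) that by (simp add: K_def K_psi_def)
      moreover have "(\<lambda>n. v n p) \<longlonglongrightarrow> w p" using w(2) that O by blast
      ultimately show ?thesis by (meson LIMSEQ_le_const LIMSEQ_le_const2)
    qed
    thus ?thesis using w(1) by (simp add: K_def K_psi_def)
  qed
  \<comment> \<open>\<open>J\<close> is continuous in the energy norm: Cauchy-Schwarz controls the
    quadratic part and \<open>F_odd_le_energy\<close> the functional.\<close>
  have Jlim: "(\<lambda>n. J (v n)) \<longlonglongrightarrow> J w"
  proof (rule LIM_zero_cancel, rule Lim_null_comparison)
    let ?e = "\<lambda>n p. v n p - w p"
    let ?b = "\<lambda>n. bil (?e n) (?e n)"
    have s0: "(\<lambda>n. sqrt (?b n)) \<longlonglongrightarrow> 0" using tendsto_real_sqrt[OF w(3)] by simp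
    have "(\<lambda>n. sqrt (bil w w) * sqrt (?b n) + C * sqrt (?b n) + ?b n / 2) \<longlonglongrightarrow> sqrt (bil w w) * 0 + C * 0 + 0 / 2"
      by (intro tendsto_intros s0 w(3)) simp
    thus "(\<lambda>n. sqrt (bil w w) * sqrt (?b n) + C * sqrt (?b n) + ?b n / 2) \<longlonglongrightarrow> 0" by simp
    show "eventually (\<lambda>n. norm (J (v n) - J w) \<le> sqrt (bil w w) * sqrt (?b n) + C * sqrt (?b n) + ?b n / 2) sequentially"
    proof (rule always_eventually, rule allI)
      fix n
      have Ve: "V (?e n)" by (rule V_diff[OF Vv w(1)])
      have "(\<lambda>p. w p + 1 * ?e n p) = v n" by (simp add: fun_eq_iff)
      with Jstep[OF w(1) Ve, of 1] have "J (v n) - J w = bil w (?e n) - f (?e n) + ?b n / 2" by simp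
      thus "norm (J (v n) - J w) \<le> sqrt (bil w w) * sqrt (?b n) + C * sqrt (?b n) + ?b n / 2"
        using bil_Cauchy_Schwarz[OF w(1) Ve] C(2)[OF Ve] bil_nonneg[OF Ve] unfolding real_norm_def by argo
    qed
  qed
  have "(\<lambda>n. d + (1/8) ^ n / 16) \<longlonglongrightarrow> d + 0 / 16"
    by (intro tendsto_intros LIMSEQ_power_zero) auto
  hence "J w \<le> d" using LIMSEQ_le[OF Jlim, of "\<lambda>n. d + (1/8) ^ n / 16" d] v(2) by (auto intro: less_imp_le)
  hence Jmin: "J w \<le> J z" if "z \<in> K" for z using dle[OF that] by simp
  have "f (\<lambda>p. z p - w p) \<le> bil w (\<lambda>p. z p - w p)" if z: "z \<in> K" for z
  proof (rule ccontr)
    let ?h = "\<lambda>p. z p - w p"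
    assume "\<not> ?thesis"
    hence X: "f ?h - bil w ?h > 0" by simp
    define X where "X = f ?h - bil w ?h"
    have Vh: "V ?h" by (rule V_diff[OF KV[OF z] w(1)])
    define Q where "Q = bil ?h ?h"
    have Q: "Q \<ge> 0" using bil_nonneg[OF Vh] by (simp add: Q_def)
    \<comment> \<open>A step so short that the quadratic term cannot outweigh the linear decrease
      \<open>t * X\<close>. The \<open>+ 1\<close> guards against \<open>Q = 0\<close>, and the
      minimum with 1 keeps the point on the segment.\<close>
    define t where "t = min 1 (X / (Q + 1))"
    have t: "0 < t" "t \<le> 1" "t \<le> X / (Q + 1)" using X Q by (auto simp: t_def X_def)
    have "J w \<le> J (\<lambda>p. w p + t * ?h p)" using t by (intro Jmin Kconv wK z) auto
    also have "\<dots> = J w - t * X + t\<^sup>2 / 2 * Q" using Jstep[OF w(1) Vh, of t] by (simp add: X_def Q_def algebra_simps)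
    finally have "t * X \<le> t * (t / 2 * Q)" by (simp add: power2_eq_square)
    hence "X \<le> t / 2 * Q" using t(1) by simp
    also have "\<dots> \<le> X / (Q + 1) / 2 * Q" using t(3) Q by (intro mult_right_mono divide_right_mono) auto
    also have "\<dots> \<le> X / 2" using Q X by (simp add: X_def[symmetric] field_simps)
    finally show False using X by (simp add: X_def)
  qed
  with wK have "is_u l \<sigma> OmO f \<psi> w" by (simp add: is_u_def K_def)
  thus thesis by (rule that)
qed

text \<open>Each inequality is tested with the other solution. In the sum \<open>f\<close> cancels,
  leaving zero energy for the difference, and the sup bound gives equality on the closed rectangle;
  outside it the representatives are arbitrary.\<close>

lemma solution_unique:
  assumes f: "f \<in> F_odd l" and u: "is_u l \<sigma> OmO f \<psi> u" and v: "is_u l \<sigma> OmO f \<psi> v" and p: "p \<in> Omegabar l"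
  shows "u p = v p"
proof -
  have K: "u \<in> K_psi l OmO \<psi>" "v \<in> K_psi l OmO \<psi>" using u v by (auto simp: is_u_def)
  hence V: "V u" "V v" by (auto simp: K_psi_def)
  have "bil u (\<lambda>p. v p - u p) \<ge> f (\<lambda>p. v p - u p)" "bil v (\<lambda>p. u p - v p) \<ge> f (\<lambda>p. u p - v p)"
    using u v K by (auto simp: is_u_def)
  moreover have "f (\<lambda>p. v p - u p) = - f (\<lambda>p. u p - v p)"
    using F_odd_uminus[OF f, of "\<lambda>p. u p - v p"] H2star_continuous[OF V_diff[OF V]] by simp
  moreover have "bil u (\<lambda>p. v p - u p) + bil v (\<lambda>p. u p - v p) = - bil (\<lambda>p. u p - v p) (\<lambda>p. u p - v p)"
    using V V_diff by (simp add: bil_diff_left bil_diff_right inner_sym[of l \<sigma> v u])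
  ultimately have "bil (\<lambda>p. u p - v p) (\<lambda>p. u p - v p) \<le> 0" by linarith
  hence 0: "bil (\<lambda>p. u p - v p) (\<lambda>p. u p - v p) = 0" using bil_nonneg[OF V_diff[OF V]] by linarith
  obtain C where "\<And>u p. V u \<Longrightarrow> p \<in> Omegabar l \<Longrightarrow> \<bar>u p\<bar> \<le> C * sqrt (bil u u)"
    by (rule sup_le_energy) blast
  from this[OF V_diff[OF V] p] 0 show ?thesis by simp
qed

end

section \<open>Reflection and oddness of solutions\<close>

definition refl_y :: "(real \<times> real \<Rightarrow> real) \<Rightarrow> real \<times> real \<Rightarrow> real" where
  "refl_y u = (\<lambda>p. u (fst p, - snd p))"

lemma refl_y_refl_y: "refl_y (refl_y u) = u"
  by (simp add: refl_y_def)

lemma refl_y_borel: "(\<lambda>p::real \<times> real. (fst p, - snd p)) \<in> borel_measurable borel"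
  by (intro borel_measurable_continuous_onI continuous_intros)

text \<open>Fubini on indicators reduces the invariance to reflection of one-dimensional Lebesgue
  measure, which is the affine substitution with factor -1.\<close>

lemma distr_refl_y: "distr lborel borel (\<lambda>p::real \<times> real. (fst p, - snd p)) = lborel"
proof (rule measure_eqI)
  fix A assume "A \<in> sets (distr lborel borel (\<lambda>p::real \<times> real. (fst p, - snd p)))"
  hence A[measurable]: "A \<in> sets (borel :: (real \<times> real) measure)" by simp
  have m: "(indicator A :: _ \<Rightarrow> ennreal) \<in> borel_measurable borel" using A by simp
  have mm: "(\<lambda>p. indicator A (fst p, - snd p) :: ennreal) \<in> borel_measurable borel"
    by (rule measurable_compose[OF refl_y_borel m])
  have ms: "(\<lambda>y. indicator A (x, y) :: ennreal) \<in> borel_measurable borel" for x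
    by (rule measurable_compose[OF _ m]) (intro borel_measurable_continuous_onI continuous_intros)
  have "emeasure (distr lborel borel (\<lambda>p. (fst p, - snd p))) A = (\<integral>\<^sup>+p. indicator A p \<partial>distr lborel borel (\<lambda>p::real \<times> real. (fst p, - snd p)))"
    by simp
  also have "\<dots> = (\<integral>\<^sup>+p. indicator A (fst p, - snd p) \<partial>lborel)"
    using refl_y_borel by (intro nn_integral_distr) auto
  also have "\<dots> = (\<integral>\<^sup>+x. \<integral>\<^sup>+y. indicator A (x, - y) \<partial>lborel \<partial>lborel)"
    using nn_integral_iter(1)[OF mm] by simp
  also have "\<dots> = (\<integral>\<^sup>+x. \<integral>\<^sup>+y. indicator A (x, y) \<partial>lborel \<partial>lborel)"
  proof (rule nn_integral_cong)
    fix x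
    show "(\<integral>\<^sup>+y. indicator A (x, - y) \<partial>lborel) = (\<integral>\<^sup>+y. indicator A (x, y) \<partial>lborel)"
      using nn_integral_real_affine[OF ms, of "-1" x 0] by simp
  qed
  also have "\<dots> = (\<integral>\<^sup>+p. indicator A p \<partial>lborel)" using nn_integral_iter(1)[OF m] by simp
  also have "\<dots> = emeasure lborel A" by simp
  finally show "emeasure (distr lborel borel (\<lambda>p. (fst p, - snd p))) A = emeasure lborel A" .
qed simp

lemma
  assumes f: "f \<in> borel_measurable borel"
  shows integral_refl_y: "(LBINT p. refl_y f p) = (LBINT p. f p)"
    and integrable_refl_y: "integrable lborel (refl_y f) \<longleftrightarrow> integrable lborel f"
proof -
  have m: "(\<lambda>p::real \<times> real. (fst p, - snd p)) \<in> measurable lborel borel" using refl_y_borel by simp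
  show "(LBINT p. refl_y f p) = (LBINT p. f p)"
    using integral_distr[OF m f] by (simp add: distr_refl_y refl_y_def)
  show "integrable lborel (refl_y f) \<longleftrightarrow> integrable lborel f"
    using integrable_distr_eq[OF m f] by (simp add: distr_refl_y refl_y_def)
qed

lemma refl_y_measurable: "f \<in> borel_measurable borel \<Longrightarrow> refl_y f \<in> borel_measurable borel"
  unfolding refl_y_def by (rule measurable_compose[OF refl_y_borel])

lemma Omega_refl: "(x, - y) \<in> Omega l \<longleftrightarrow> (x, y) \<in> Omega l" "(x, - y) \<in> Omegabar l \<longleftrightarrow> (x, y) \<in> Omegabar l"
  by (auto simp: Omega_def Omegabar_def)

lemma sq_refl_y: assumes "sq l g" shows "sq l (refl_y g)"
proof -
  have g: "g \<in> borel_measurable borel" "integrable lborel (\<lambda>p. (g p)\<^sup>2)" using assms by (auto simp: sq_def)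
  have "integrable lborel (refl_y (\<lambda>p. (g p)\<^sup>2))" using g by (subst integrable_refl_y) auto
  moreover have "refl_y g p = 0" if "p \<notin> Omega l" for p
    using sq_outside[OF assms] that Omega_refl(1)[of "fst p" "snd p" l] by (simp add: refl_y_def)
  ultimately show ?thesis using refl_y_measurable[OF g(1)] by (simp add: sq_def refl_y_def)
qed

lemma pd_refl_y:
  assumes "smooth2 \<phi>"
  shows "pdx (refl_y \<phi>) = refl_y (pdx \<phi>)" "pdy (refl_y \<phi>) = (\<lambda>p. - refl_y (pdy \<phi>) p)"
proof -
  show "pdx (refl_y \<phi>) = refl_y (pdx \<phi>)" by (simp add: pdx_def refl_y_def)
  have "((\<lambda>t. \<phi> (x, - t)) has_real_derivative - pdy \<phi> (x, - y)) (at y)" for x y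
  proof -
    have "((\<lambda>t. \<phi> (x, - t)) has_real_derivative pdy \<phi> (x, - y) * (-1)) (at y)"
      by (rule DERIV_chain2[where f="\<lambda>t. \<phi> (x, t)"])
        (auto intro!: derivative_eq_intros differentiable_slice_y smooth2_differentiable assms)
    thus ?thesis by simp
  qed
  thus "pdy (refl_y \<phi>) = (\<lambda>p. - refl_y (pdy \<phi>) p)"
    by (auto simp: pdy_def[of "refl_y \<phi>"] pdy_def[of "\<lambda>p. \<phi> (fst p, - snd p)"] refl_y_def fun_eq_iff intro: DERIV_imp_deriv)
qed

definition refl_sign :: "bool list \<Rightarrow> real" where
  "refl_sign ws = (-1) ^ length (filter Not ws)"

lemma pd_cmult:
  fixes f :: "real \<times> real \<Rightarrow> real"
  assumes "f differentiable_on UNIV"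
  shows "pdx (\<lambda>p. c * f p) = (\<lambda>p. c * pdx f p)" "pdy (\<lambda>p. c * f p) = (\<lambda>p. c * pdy f p)"
proof -
  have "((\<lambda>t. c * f (t, y)) has_real_derivative c * pdx f (x, y)) (at x)"
    "((\<lambda>t. c * f (x, t)) has_real_derivative c * pdy f (x, y)) (at y)" for x y
    by (intro DERIV_cmult differentiable_slice_x differentiable_slice_y assms)+
  from DERIV_imp_deriv[OF this(1)] DERIV_imp_deriv[OF this(2)]
  show "pdx (\<lambda>p. c * f p) = (\<lambda>p. c * pdx f p)" "pdy (\<lambda>p. c * f p) = (\<lambda>p. c * pdy f p)"
    by (auto simp: pdx_def[of "\<lambda>p. c * f p"] pdy_def[of "\<lambda>p. c * f p"] fun_eq_iff)
qed

lemma differentiable_refl_y: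
  assumes "f differentiable_on UNIV" shows "refl_y f differentiable_on UNIV"
proof -
  have "(\<lambda>p::real \<times> real. (fst p, - snd p)) differentiable (at p)" for p
    by (intro bounded_linear_imp_differentiable bounded_linear_Pair bounded_linear_fst bounded_linear_minus bounded_linear_snd)
  thus ?thesis
    using assms differentiable_compose[of f "\<lambda>p. (fst p, - snd p)"] by (auto simp: differentiable_on_def refl_y_def)
qed

lemma Dw_refl_y:
  assumes "smooth2 \<phi>" shows "Dw ws (refl_y \<phi>) = (\<lambda>p. refl_sign ws * refl_y (Dw ws \<phi>) p)"
proof (induction ws)
  case (Cons b bs)
  have d: "refl_y (Dw bs \<phi>) differentiable_on UNIV"
    by (intro differentiable_refl_y smooth2_differentiable smooth2_Dw assms)
  show ?case
    using Cons pd_cmult[OF d, of "refl_sign bs"] pd_refl_y[OF smooth2_Dw[OF assms, of bs]]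
    by (cases b) (simp_all add: refl_sign_def)
qed (simp add: refl_sign_def)

lemma test_fun_refl_y:
  assumes "test_fun (Omega l) \<phi>" shows "test_fun (Omega l) (refl_y \<phi>)"
proof -
  obtain K where K: "compact K" "K \<subseteq> Omega l" "\<And>p. p \<notin> K \<Longrightarrow> \<phi> p = 0" and sm: "smooth2 \<phi>"
    using assms by (auto simp: test_fun_def)
  let ?r = "\<lambda>p::real \<times> real. (fst p, - snd p)"
  have "compact (?r ` K)" using K(1) by (intro compact_continuous_image continuous_intros)
  moreover have "?r ` K \<subseteq> Omega l" using K(2) Omega_refl(1) by force
  moreover have "refl_y \<phi> p = 0" if "p \<notin> ?r ` K" for p
  proof -
    have "?r p \<notin> K" using that by (metis (no_types, lifting) add.inverse_inverse fst_conv image_eqI prod.collapse snd_conv)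
    thus ?thesis using K(3) by (simp add: refl_y_def)
  qed
  moreover have "smooth2 (refl_y \<phi>)"
    unfolding smooth2_def
  proof
    fix bs
    have "(\<lambda>p. refl_sign bs * refl_y (Dw bs \<phi>) p) differentiable_on UNIV"
      by (intro differentiable_on_mult differentiable_on_const differentiable_refl_y smooth2_differentiable smooth2_Dw sm)
    thus "Dw bs (refl_y \<phi>) differentiable_on UNIV" by (simp add: Dw_refl_y[OF sm])
  qed
  ultimately show ?thesis unfolding test_fun_def by blast
qed

lemma continuous_refl_y:
  assumes "continuous_on (Omegabar l) u" shows "continuous_on (Omegabar l) (refl_y u)"
  unfolding refl_y_def
  by (rule continuous_on_compose2[OF assms]) (auto intro!: continuous_intros simp: Omega_refl)

text \<open>A change of variables moves the reflection onto the test function, where each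
  \<open>y\<close>-derivative produces a factor -1.\<close>

lemma weak_deriv_refl_y:
  assumes u: "continuous_on (Omegabar l) u" and g: "sq l g" "weak_deriv (Omega l) ws u g"
  shows "sq l (\<lambda>p. refl_sign ws * refl_y g p)"
    and "weak_deriv (Omega l) ws (refl_y u) (\<lambda>p. refl_sign ws * refl_y g p)"
proof -
  have "sq l (\<lambda>_. 0)" by (simp add: sq_def)
  from sq_add[OF this sq_refl_y[OF g(1)], of "refl_sign ws"]
  show s: "sq l (\<lambda>p. refl_sign ws * refl_y g p)" by simp
  \<comment> \<open>The sign is its own inverse, so it can be moved from the test function to the
    derivative of \<open>u\<close>.\<close>
  have ss: "refl_sign ws * refl_sign ws = 1" by (simp add: refl_sign_def power_mult_distrib[symmetric])
  show "weak_deriv (Omega l) ws (refl_y u) (\<lambda>p. refl_sign ws * refl_y g p)"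
    unfolding weak_deriv_sq_iff[OF continuous_refl_y[OF u] s]
  proof (intro allI impI)
    fix \<phi> assume t: "test_fun (Omega l) \<phi>"
    note t' = test_fun_refl_y[OF t]
    have D: "Dw ws \<phi> p = refl_sign ws * refl_y (Dw ws (refl_y \<phi>)) p" for p
      using Dw_refl_y[OF test_fun_smooth2[OF t'], of ws] by (simp add: refl_y_refl_y)
    have "(LBINT p. refl_y u p * Dw ws \<phi> p) = (LBINT p. refl_sign ws * refl_y (\<lambda>p. u p * Dw ws (refl_y \<phi>) p) p)"
      by (simp add: D refl_y_def mult.left_commute)
    also have "\<dots> = refl_sign ws * (LBINT p. u p * Dw ws (refl_y \<phi>) p)"
      using integral_refl_y[OF borel_mult_test_fun[OF u test_fun_Dw[OF t']]] by simp
    also have "\<dots> = (-1) ^ length ws * (refl_sign ws * (LBINT p. g p * refl_y \<phi> p))"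
      using g(2) t' unfolding weak_deriv_sq_iff[OF u g(1)] by simp
    also have "(LBINT p. g p * refl_y \<phi> p) = (LBINT p. refl_y (\<lambda>p. g p * refl_y \<phi> p) p)"
    proof (rule integral_refl_y[symmetric])
      show "(\<lambda>p. g p * refl_y \<phi> p) \<in> borel_measurable borel"
        using g(1) test_fun_borel[OF t'] by (auto simp: sq_def)
    qed
    also have "(\<lambda>p. refl_y (\<lambda>p. g p * refl_y \<phi> p) p) = (\<lambda>p. refl_y g p * \<phi> p)"
      by (simp add: refl_y_def fun_eq_iff)
    also have "refl_sign ws * (LBINT p. refl_y g p * \<phi> p) = (LBINT p. (refl_sign ws * refl_y g p) * \<phi> p)"
      by (simp add: mult.assoc)
    finally show "(LBINT p. refl_y u p * Dw ws \<phi> p)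
      = (-1) ^ length ws * (LBINT p. (refl_sign ws * refl_y g p) * \<phi> p)" .
  qed
qed

lemma H2star_refl_y:
  assumes l: "l > 0" and u: "H2star l u" shows "H2star l (refl_y u)"
proof (rule H2starI[OF l])
  note r = rep_props[OF u]
  note w = weak_deriv_refl_y[OF H2star_continuous[OF u] r]
  show "continuous_on (Omegabar l) (refl_y u)" by (rule continuous_refl_y[OF H2star_continuous[OF u]])
  show "refl_y u (x, y) = 0" if "x \<in> {0, pi}" "y \<in> {-l..l}" for x y
    using H2star_boundary[OF u l that(1), of "-y"] that by (auto simp: refl_y_def)
  show "sq l (\<lambda>p. refl_sign [True,True] * refl_y (rep l [True,True] u) p)"
    "weak_deriv (Omega l) [True,True] (refl_y u) (\<lambda>p. refl_sign [True,True] * refl_y (rep l [True,True] u) p)"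
    "sq l (\<lambda>p. refl_sign [True,False] * refl_y (rep l [True,False] u) p)"
    "weak_deriv (Omega l) [True,False] (refl_y u) (\<lambda>p. refl_sign [True,False] * refl_y (rep l [True,False] u) p)"
    "weak_deriv (Omega l) [False,False] (refl_y u) (\<lambda>p. refl_sign [False,False] * refl_y (rep l [False,False] u) p)"
    by (rule w; simp)+
qed

text \<open>Of the three Hessian entries only the mixed one changes sign, and the form contains it
  solely through the product of two mixed entries.\<close>

lemma inner_refl_y:
  assumes l: "l > 0" and u: "H2star l u" and v: "H2star l v"
  shows "inner_H2star l \<sigma> (refl_y u) (refl_y v) = inner_H2star l \<sigma> u v"
proof -
  note ru = rep_props[OF u] and rv = rep_props[OF v]
  note wu = weak_deriv_refl_y[OF H2star_continuous[OF u] ru]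
    and wv = weak_deriv_refl_y[OF H2star_continuous[OF v] rv]
  let ?F = "\<lambda>p. form \<sigma> (rep l [True,True] u p) (rep l [True,False] u p) (rep l [False,False] u p)
     (rep l [True,True] v p) (rep l [True,False] v p) (rep l [False,False] v p)"
  have "inner_H2star l \<sigma> (refl_y u) (refl_y v) = (LBINT p. form \<sigma>
     (refl_sign [True,True] * refl_y (rep l [True,True] u) p) (refl_sign [True,False] * refl_y (rep l [True,False] u) p)
     (refl_sign [False,False] * refl_y (rep l [False,False] u) p)
     (refl_sign [True,True] * refl_y (rep l [True,True] v) p) (refl_sign [True,False] * refl_y (rep l [True,False] v) p)
     (refl_sign [False,False] * refl_y (rep l [False,False] v) p))"
    by (rule inner_rep[OF l]; (rule wu wv; simp))
  also have "\<dots> = (LBINT p. refl_y ?F p)"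
    by (simp add: refl_sign_def form_def refl_y_def)
  also have "\<dots> = (LBINT p. ?F p)"
  proof (rule integral_refl_y)
    have "integrable lborel ?F" using ru(1) rv(1) by (intro form_integrable[of l]) auto
    thus "?F \<in> borel_measurable borel" using borel_measurable_integrable by force
  qed
  also have "\<dots> = inner_H2star l \<sigma> u v" by (rule inner_rep_std[OF l u v, symmetric])
  finally show ?thesis .
qed

context plate_form
begin

lemma solution_odd:
  assumes f: "f \<in> F_odd l" and u: "is_u l \<sigma> OmO f \<psi> u"
    and sym: "\<And>x y. (x, y) \<in> OmO \<Longrightarrow> (x, -y) \<in> OmO" "\<And>x y. (x, y) \<in> OmO \<Longrightarrow> \<psi> (x, -y) = \<psi> (x, y)"
    and p: "(x, y) \<in> Omegabar l"
  shows "u (x, -y) = - u (x, y)"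
proof -
  have KR: "(\<lambda>p. - refl_y w p) \<in> K_psi l OmO \<psi>" if "w \<in> K_psi l OmO \<psi>" for w
  proof -
    have Vw: "V w" using that by (simp add: K_psi_def)
    have "V (\<lambda>p. (0::real) + (-1) * refl_y w p)" by (intro V_add H2star_zero[OF l] H2star_refl_y[OF l Vw])
    hence "V (\<lambda>p. - refl_y w p)" by simp
    moreover have "- \<psi> (x, y) \<le> - refl_y w (x, y) \<and> - refl_y w (x, y) \<le> \<psi> (x, y)" if "(x, y) \<in> OmO" for x y
      using sym[OF that] \<open>w \<in> K_psi l OmO \<psi>\<close> by (force simp: K_psi_def refl_y_def)
    ultimately show ?thesis by (auto simp: K_psi_def)
  qed
  have uK: "u \<in> K_psi l OmO \<psi>" using u by (simp add: is_u_def)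
  hence Vu: "V u" by (simp add: K_psi_def)
  let ?v = "\<lambda>p. - refl_y u p"
  have "is_u l \<sigma> OmO f \<psi> ?v"
    unfolding is_u_def
  proof (intro conjI ballI)
    show vK: "?v \<in> K_psi l OmO \<psi>" by (rule KR[OF uK])
    fix \<phi> assume \<phi>: "\<phi> \<in> K_psi l OmO \<psi>"
    \<comment> \<open>The competitor for the reflected problem corresponds to this competitor for
      \<open>u\<close>, admissible because the obstacles are symmetric.\<close>
    let ?\<phi>' = "\<lambda>p. - refl_y \<phi> p"
    let ?h = "\<lambda>p. ?\<phi>' p - u p"
    have V\<phi>: "V \<phi>" "V ?\<phi>'" using \<phi> KR[OF \<phi>] by (auto simp: K_psi_def)
    have Vh: "V ?h" by (rule V_diff[OF V\<phi>(2) Vu])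
    have Vr: "V (refl_y u)" "V (refl_y ?h)" by (intro H2star_refl_y[OF l] Vu Vh)+
    \<comment> \<open>In the shape \<open>0 + (-1) * w\<close> the additivity lemmas for
      \<open>bil\<close> serve as rules for negation.\<close>
    have eq: "(\<lambda>p. \<phi> p - ?v p) = (\<lambda>p. 0 + (-1) * refl_y ?h p)" by (simp add: refl_y_def fun_eq_iff)
    have "bil ?v (\<lambda>p. \<phi> p - ?v p) = bil (\<lambda>p. 0 + (-1) * refl_y u p) (\<lambda>p. 0 + (-1) * refl_y ?h p)"
      unfolding eq by simp
    also have "\<dots> = bil (refl_y u) (refl_y ?h)"
    proof -
      have z: "bil (\<lambda>_. 0) w = 0" if "V w" for w
        using bil_diff_left[OF that that that] by simp
      have z': "bil w (\<lambda>_. 0) = 0" if "V w" for w using z[OF that] inner_sym by metis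
      have "bil (\<lambda>p. 0 + (-1) * refl_y u p) (\<lambda>p. 0 + (-1) * refl_y ?h p)
          = bil (\<lambda>_. 0) (\<lambda>p. 0 + (-1) * refl_y ?h p) + (-1) * bil (refl_y u) (\<lambda>p. 0 + (-1) * refl_y ?h p)"
        by (intro bil_add_left H2star_zero[OF l] Vr V_add)
      also have "bil (refl_y u) (\<lambda>p. 0 + (-1) * refl_y ?h p) = bil (refl_y u) (\<lambda>_. 0) + (-1) * bil (refl_y u) (refl_y ?h)"
        by (intro bil_add_right H2star_zero[OF l] Vr)
      also have "bil (\<lambda>_. 0) (\<lambda>p. 0 + (-1) * refl_y ?h p) = 0"
        by (intro z V_add H2star_zero[OF l] Vr)
      finally show ?thesis using z'[OF Vr(1)] by simp
    qed
    also have "\<dots> = bil u ?h" by (rule inner_refl_y[OF l Vu Vh])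
    also have "\<dots> \<ge> f ?h" using u KR[OF \<phi>] by (simp add: is_u_def)
    also have "f ?h = f (\<lambda>p. \<phi> p - ?v p)"
    proof -
      have c: "continuous_on (Omegabar l) ?h" "continuous_on (Omegabar l) (refl_y ?h)"
        using Vh Vr H2star_continuous by blast+
      \<comment> \<open>The sum of a function and its reflection is even in \<open>y\<close>, so
        \<open>f\<close> annihilates it. Hence \<open>f\<close> changes sign under
        reflection.\<close>
      have e: "f (\<lambda>p. ?h p + refl_y ?h p) = 0"
      proof -
        have "continuous_on (Omegabar l) (\<lambda>p. ?h p + refl_y ?h p)" using c by (rule continuous_on_add)
        moreover have "\<And>x y. (\<lambda>p. ?h p + refl_y ?h p) (x, -y) = (\<lambda>p. ?h p + refl_y ?h p) (x, y)"
          by (simp add: refl_y_def)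
        ultimately show ?thesis using f unfolding F_odd_def by blast
      qed
      have "f (\<lambda>p. ?h p + 1 * refl_y ?h p) = f ?h + 1 * f (refl_y ?h)" by (rule F_odd_linear[OF f c])
      with e have "f ?h = - f (refl_y ?h)" by simp
      also have "\<dots> = f (\<lambda>p. - refl_y ?h p)" using F_odd_uminus[OF f c(2)] by simp
      also have "(\<lambda>p. - refl_y ?h p) = (\<lambda>p. \<phi> p - ?v p)" by (simp add: refl_y_def fun_eq_iff)
      finally show ?thesis .
    qed
    finally show "bil ?v (\<lambda>p. \<phi> p - ?v p) \<ge> f (\<lambda>p. \<phi> p - ?v p)" .
  qed
  from solution_unique[OF f u this, of "(x, -y)"] p show ?thesis by (simp add: refl_y_def Omega_refl)
qed

end

section \<open>Gap functions\<close>

locale bridge = plate_form +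
  fixes \<alpha> \<gamma> \<kappa> :: real and OmO :: "(real \<times> real) set"
  assumes OmO: "OmO \<subseteq> Omegabar l" "\<And>x y. (x, y) \<in> OmO \<Longrightarrow> (x, -y) \<in> OmO"
      "{0..pi} \<times> {-l} \<subseteq> OmO" "{0..pi} \<times> {l} \<subseteq> OmO"
    and \<gamma>: "0 < \<gamma>" "\<gamma> \<le> \<kappa>"
begin

abbreviation \<Psi> where "\<Psi> \<equiv> Psi_e_plus OmO \<alpha> \<gamma> \<kappa>"
abbreviation edge where "edge u \<equiv> Sup ((\<lambda>x. \<bar>u (x, l)\<bar>) ` {0..pi})"
abbreviation sol where "sol f \<psi> u \<equiv> is_u l \<sigma> OmO f \<psi> u"

lemma sol_continuous_edge: assumes "sol f \<psi> u" shows "continuous_on {0..pi} (\<lambda>x. \<bar>u (x, l)\<bar>)"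
proof -
  have "continuous_on (Omegabar l) u" using assms by (simp add: is_u_def K_psi_def H2star_def)
  from continuous_on_slice(2)[OF this, of l] show ?thesis using l by (intro continuous_intros) auto
qed

lemma edge_attained:
  assumes "sol f \<psi> u"
  obtains x where "x \<in> {0..pi}" "edge u = \<bar>u (x, l)\<bar>" "\<And>z. z \<in> {0..pi} \<Longrightarrow> \<bar>u (z, l)\<bar> \<le> edge u"
proof -
  have "{0..pi} \<noteq> {}" by simp
  then obtain x where x: "x \<in> {0..pi}" "\<And>z. z \<in> {0..pi} \<Longrightarrow> \<bar>u (z, l)\<bar> \<le> \<bar>u (x, l)\<bar>"
    using continuous_attains_sup[OF compact_Icc _ sol_continuous_edge[OF assms]] by auto
  have "edge u = \<bar>u (x, l)\<bar>" using x by (intro cSup_eq_maximum) auto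
  with x show thesis by (intro that) auto
qed

lemma gap_eq_edge:
  assumes f: "f \<in> F_odd l" and \<psi>: "\<psi> \<in> \<Psi>" and u: "sol f \<psi> u"
  shows "gap l u = 2 * edge u"
proof -
  have "u (x, -l) = - u (x, l)" if "x \<in> {0..pi}" for x
    using that l OmO(2) \<psi> by (intro solution_odd[OF f u]) (auto simp: Omegabar_def Psi_e_plus_def)
  hence "(\<lambda>x. \<bar>u (x, l) - u (x, -l)\<bar>) ` {0..pi} = (\<lambda>x. 2 * \<bar>u (x, l)\<bar>) ` {0..pi}"
    by (intro image_cong) auto
  moreover obtain x where x: "x \<in> {0..pi}" "edge u = \<bar>u (x, l)\<bar>" "\<And>z. z \<in> {0..pi} \<Longrightarrow> \<bar>u (z, l)\<bar> \<le> edge u"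
    using edge_attained[OF u] by blast
  have "Sup ((\<lambda>x. 2 * \<bar>u (x, l)\<bar>) ` {0..pi}) = 2 * edge u"
    using x by (intro cSup_eq_maximum) auto
  ultimately show ?thesis by (simp add: gap_def)
qed

text \<open>Solutions may differ outside the closed rectangle, but the gap reads only edge values,
  so the description in \<open>G_f_psi\<close> has a unique witness.\<close>

lemma G_f_psi_eq:
  assumes f: "f \<in> F_odd l" and \<psi>: "\<psi> \<in> \<Psi>" and u: "sol f \<psi> u"
  shows "G_f_psi l \<sigma> OmO f \<psi> = 2 * edge u"
  unfolding G_f_psi_def
proof (rule the_equality)
  show "\<exists>v. sol f \<psi> v \<and> 2 * edge u = gap l v" using u gap_eq_edge[OF f \<psi> u] by auto
  fix g assume "\<exists>v. sol f \<psi> v \<and> g = gap l v"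
  then obtain v where v: "sol f \<psi> v" "g = gap l v" by blast
  have "v (x, l) = u (x, l)" if "x \<in> {0..pi}" for x
    using that l by (intro solution_unique[OF f v(1) u]) (auto simp: Omegabar_def)
  hence "(\<lambda>x. \<bar>v (x, l)\<bar>) ` {0..pi} = (\<lambda>x. \<bar>u (x, l)\<bar>) ` {0..pi}" by (intro image_cong) auto
  thus "g = 2 * edge u" using gap_eq_edge[OF f \<psi> v(1)] v(2) by simp
qed

lemma sol_exists:
  assumes "f \<in> F_odd l" "\<psi> \<in> \<Psi>" obtains u where "sol f \<psi> u"
proof -
  have "\<psi> p \<ge> 0" if "p \<in> OmO" for p
  proof -
    have "\<psi> p \<ge> \<gamma>" using assms(2) that unfolding Psi_e_plus_def by blast
    thus ?thesis using \<gamma> by simp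
  qed
  from solution_exists[OF assms(1) OmO(1), of \<psi>, OF this] that show thesis by blast
qed

lemma G_f_psi_bounds:
  assumes f: "f \<in> F_odd l" and \<psi>: "\<psi> \<in> \<Psi>" and c: "\<And>x. x \<in> {0..pi} \<Longrightarrow> \<psi> (x, l) \<le> c"
  shows "0 \<le> G_f_psi l \<sigma> OmO f \<psi>" "G_f_psi l \<sigma> OmO f \<psi> \<le> 2 * c"
proof -
  obtain u where u: "sol f \<psi> u" using sol_exists[OF f \<psi>] .
  obtain x where x: "x \<in> {0..pi}" "edge u = \<bar>u (x, l)\<bar>" using edge_attained[OF u] by blast
  have "(x, l) \<in> OmO" using OmO(4) x(1) by auto
  hence "\<bar>u (x, l)\<bar> \<le> \<psi> (x, l)" using u by (auto simp: is_u_def K_psi_def abs_le_iff minus_le_iff)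
  with c[OF x(1)] x(2) G_f_psi_eq[OF f \<psi> u]
  show "0 \<le> G_f_psi l \<sigma> OmO f \<psi>" "G_f_psi l \<sigma> OmO f \<psi> \<le> 2 * c" by auto
qed

lemma Psi_bounded:
  assumes "\<psi> \<in> \<Psi>" obtains c where "\<And>x. x \<in> {0..pi} \<Longrightarrow> \<psi> (x, l) \<le> c"
proof -
  have "bdd_above ((\<lambda>p. \<bar>\<psi> p\<bar>) ` OmO)" using assms by (simp add: Psi_e_plus_def in_holder_def)
  then obtain c where c: "\<And>p. p \<in> OmO \<Longrightarrow> \<bar>\<psi> p\<bar> \<le> c" unfolding bdd_above_def by auto
  have "\<psi> (x, l) \<le> c" if "x \<in> {0..pi}" for x
  proof -
    have "(x, l) \<in> OmO" using that OmO(4) by auto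
    from c[OF this] show ?thesis by simp
  qed
  thus thesis by (rule that)
qed

text \<open>Keeps the supremum defining \<open>G_psi\<close> from being taken over the empty
  set.\<close>

lemma zero_F_odd: "(\<lambda>_. 0) \<in> F_odd l"
proof -
  have "0 \<le> Sup ((\<lambda>p. \<bar>u p\<bar>) ` Omegabar l)" if "continuous_on (Omegabar l) u" for u :: "real \<times> real \<Rightarrow> real"
  proof -
    obtain p where p: "p \<in> Omegabar l" using Omegabar_ne by blast
    have "compact ((\<lambda>p. \<bar>u p\<bar>) ` Omegabar l)"
      using that compact_Omegabar by (intro compact_continuous_image continuous_on_rabs)
    hence "bdd_above ((\<lambda>p. \<bar>u p\<bar>) ` Omegabar l)" by (intro bounded_imp_bdd_above compact_imp_bounded)
    from cSup_upper[OF imageI[OF p] this] show ?thesis by (rule order_trans[rotated]) simp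
  qed
  thus ?thesis by (auto simp: F_odd_def)
qed

text \<open>Bounds the infimum over obstacles from below, so that \<open>G_inf\<close> is below each
  of its members. The zero functional serves as competitor.\<close>

lemma G_psi_nonneg: assumes \<psi>: "\<psi> \<in> \<Psi>" shows "0 \<le> G_psi l \<sigma> OmO \<psi>"
proof -
  obtain c where c: "\<And>x. x \<in> {0..pi} \<Longrightarrow> \<psi> (x, l) \<le> c" using Psi_bounded[OF \<psi>] by blast
  have "bdd_above ((\<lambda>f. G_f_psi l \<sigma> OmO f \<psi>) ` F_odd l)"
    using G_f_psi_bounds(2)[OF _ \<psi> c] by (auto intro!: bdd_aboveI[of _ "2 * c"])
  hence "G_f_psi l \<sigma> OmO (\<lambda>_. 0) \<psi> \<le> G_psi l \<sigma> OmO \<psi>"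
    unfolding G_psi_def using zero_F_odd by (intro cSup_upper) auto
  thus ?thesis using G_f_psi_bounds(1)[OF zero_F_odd \<psi> c] by simp
qed

lemma G_psi_le:
  assumes \<psi>: "\<psi> \<in> \<Psi>" and c: "\<And>x. x \<in> {0..pi} \<Longrightarrow> \<psi> (x, l) \<le> c" shows "G_psi l \<sigma> OmO \<psi> \<le> 2 * c"
  unfolding G_psi_def using zero_F_odd G_f_psi_bounds(2)[OF _ \<psi> c] by (intro cSup_least) auto

lemma G_inf_le: assumes \<psi>: "\<psi> \<in> \<Psi>" shows "G_inf l \<sigma> OmO \<alpha> \<gamma> \<kappa> \<le> G_psi l \<sigma> OmO \<psi>"
  unfolding G_inf_def using G_psi_nonneg \<psi> by (intro cInf_lower bdd_belowI[of _ 0]) auto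

lemma const_Psi: "(\<lambda>_. \<gamma>) \<in> \<Psi>"
proof -
  \<comment> \<open>Two distinct points of \<open>OmO\<close> ensure that the set of Hoelder
    quotients is \<open>{0}\<close> and not empty, so the seminorm of a constant is 0 and its norm
    is \<open>\<gamma>\<close>.\<close>
  have ne: "(0, l) \<in> OmO" "(0, -l) \<in> OmO" using OmO(3,4) by auto
  moreover have "(0::real, l) \<noteq> (0, -l)" using l by simp
  ultimately have h: "holder_sup \<alpha> OmO (\<lambda>_. \<gamma>) = {0}" unfolding holder_sup_def by force
  have i: "(\<lambda>p. \<bar>\<gamma>\<bar>) ` OmO = {\<gamma>}" using ne \<gamma> by auto
  show ?thesis using h i \<gamma> by (simp add: Psi_e_plus_def in_holder_def holder_norm_def)
qed

lemma G_inf_le_2gamma: "G_inf l \<sigma> OmO \<alpha> \<gamma> \<kappa> \<le> 2 * \<gamma>"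
  using G_inf_le[OF const_Psi] G_psi_le[OF const_Psi, of \<gamma>] by simp

end

theorem theorem4p7:
  fixes l \<sigma> \<alpha> \<gamma> \<kappa> :: real
    and OmO :: "(real \<times> real) set"
    and fbar :: "(real \<times> real \<Rightarrow> real) \<Rightarrow> real"
    and psibar ubar :: "real \<times> real \<Rightarrow> real"
  assumes "l > 0" and "0 < \<sigma>" and "\<sigma> < 1"
    and "OmO \<noteq> {}" and "closed OmO" and "OmO \<subseteq> Omegabar l"
    and "\<forall>x y. (x, y) \<in> OmO \<longrightarrow> (x, -y) \<in> OmO"
    and "{0..pi} \<times> {-l} \<subseteq> OmO" and "{0..pi} \<times> {l} \<subseteq> OmO"
    and "0 < \<alpha>" and "\<alpha> < 1" and "0 < \<gamma>" and "\<gamma> \<le> \<kappa>"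
    and "fbar \<in> F_odd l" and "psibar \<in> Psi_e_plus OmO \<alpha> \<gamma> \<kappa>"
    and "G_f_psi l \<sigma> OmO fbar psibar = G_psi l \<sigma> OmO psibar"
    and "G_psi l \<sigma> OmO psibar = G_inf l \<sigma> OmO \<alpha> \<gamma> \<kappa>"
    and "is_u l \<sigma> OmO fbar psibar ubar"
  shows "(G_inf l \<sigma> OmO \<alpha> \<gamma> \<kappa> < 2 * \<gamma> \<longleftrightarrow> Sup ((\<lambda>x. \<bar>ubar (x, l)\<bar>) ` {0..pi}) < \<gamma>)
       \<and> (G_inf l \<sigma> OmO \<alpha> \<gamma> \<kappa> = 2 * \<gamma> \<longleftrightarrow> (\<exists>x0 \<in> {0<..<pi}. \<bar>ubar (x0, l)\<bar> = \<gamma>))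
       \<and> (G_inf l \<sigma> OmO \<alpha> \<gamma> \<kappa> = 2 * \<gamma> \<longrightarrow>
            (\<forall>\<psi>\<gamma> \<in> Psi_e_plus OmO \<alpha> \<gamma> \<kappa>. (\<forall>x \<in> {0..pi}. \<psi>\<gamma> (x, l) = \<gamma>) \<longrightarrow>
               G_inf l \<sigma> OmO \<alpha> \<gamma> \<kappa> = G_psi l \<sigma> OmO \<psi>\<gamma>))"
proof -
  interpret bridge l \<sigma> \<alpha> \<gamma> \<kappa> OmO
    using assms by unfold_locales auto
  have eq: "G_inf l \<sigma> OmO \<alpha> \<gamma> \<kappa> = 2 * edge ubar"
    using G_f_psi_eq[OF assms(14,15,18)] assms(16,17) by simp
  obtain x where x: "x \<in> {0..pi}" "edge ubar = \<bar>ubar (x, l)\<bar>" "\<And>z. z \<in> {0..pi} \<Longrightarrow> \<bar>ubar (z, l)\<bar> \<le> edge ubar"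
    using edge_attained[OF assms(18)] by blast
  have "H2star l ubar" using assms(18) by (simp add: is_u_def K_psi_def)
  from H2star_boundary[OF this l, of _ l] have 0: "ubar (0, l) = 0" "ubar (pi, l) = 0" using l by auto
  have "x \<in> {0<..<pi}" if "edge ubar = \<gamma>"
  proof -
    have "x \<noteq> 0" "x \<noteq> pi" using that x(2) 0 \<gamma> by auto
    thus ?thesis using x(1) by auto
  qed
  hence "edge ubar = \<gamma> \<longleftrightarrow> (\<exists>x0 \<in> {0<..<pi}. \<bar>ubar (x0, l)\<bar> = \<gamma>)"
  proof (intro iffI)
    assume "\<exists>x0 \<in> {0<..<pi}. \<bar>ubar (x0, l)\<bar> = \<gamma>"
    then obtain x0 where "x0 \<in> {0<..<pi}" "\<bar>ubar (x0, l)\<bar> = \<gamma>" by blast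
    hence "\<gamma> \<le> edge ubar" using x(3)[of x0] by simp
    \<comment> \<open>The reverse inequality is the universal bound by the constant
      obstacle.\<close>
    thus "edge ubar = \<gamma>" using G_inf_le_2gamma eq by simp
  qed (use x(2) in metis)
  \<comment> \<open>Squeezing: \<open>G_inf\<close> is at most \<open>G_psi\<close> for this
    obstacle, which is at most \<open>2 * \<gamma>\<close> because only the obstacle's values on the
    upper edge limit the gap.\<close>
  moreover have "G_inf l \<sigma> OmO \<alpha> \<gamma> \<kappa> = G_psi l \<sigma> OmO \<psi>\<gamma>"
    if "G_inf l \<sigma> OmO \<alpha> \<gamma> \<kappa> = 2 * \<gamma>" "\<psi>\<gamma> \<in> \<Psi>" "\<forall>x \<in> {0..pi}. \<psi>\<gamma> (x, l) = \<gamma>" for \<psi>\<gamma>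
    using G_inf_le[OF that(2)] G_psi_le[OF that(2), of \<gamma>] that(1,3) by simp
  ultimately show ?thesis using eq by auto
qed

end
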